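(* Let $X$ be a finite space. The following conditions are equivalent: (1) $X$ is proper. (2) For every closed point $x_0\in X$ and every $p>x_0$, the space $\partial C_p-\{x_0\}$ is cohomologically trivial, i.e. $\mathbb R\Gamma_{\mathrm{red}}(\partial C_p-\{x_0\},\mathbb Z)=0$. (3) For every closed point $x_0\in X$ and every $p>x_0$, the natural morphism $\mathbb R\Gamma_{x_0}(\partial C_p,\mathbb Z)\to\mathbb R\Gamma(\partial C_p,\mathbb Z)\to\mathbb R\Gamma_{\mathrm{red}}(\partial C_p,\mathbb Z)$ is an isomorphism.
   Context: A finite space is a finite $T_0$ topological space, equivalently a finite poset with $p\le q$ iff $\overline{\{p\}}\subseteq\overline{\{q\}}$; open subsets are the upper sets and closed subsets are the lower sets. $C_p=\{x\in X: x\le p\}$ is the closure of $\{p\}$ and $\partial C_p=C_p-\{p\}$. Closed points are the minimal elements. $\mathrm D(X)$ is the derived category of complexes of sheaves of abelian groups on $X$. For a locally closed subset $S\subseteq X$ and a complex of sheaves $F$, $F_S$ denotes the complex with $(F_S)|_S=F|_S$ and $(F_S)|_{X-S}=0$; in particular $\mathbb Z_{\{p\}}$ is the constant sheaf $\mathbb Z$ supported in $\{p\}$. $\mathbb R\Gamma_{x_0}(X,-)$ is derived sections with support in the closed point $x_0$. The reduced cohomology $\mathbb R\Gamma_{\mathrm{red}}(X,\mathbb Z)$ is the cone of $\mathbb Z\to\mathbb R\Gamma(X,\mathbb Z)$ (so $\mathbb R\Gamma_{\mathrm{red}}(\emptyset,\mathbb Z)=\mathbb Z[1]$). $X$ is cohomologically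 trivial if $\mathbb R\Gamma_{\mathrm{red}}(X,\mathbb Z)=0$. A finite space $X$ is proper if for every closed point $x_0\in X$ and every $p\ge x_0$ the natural morphism $\mathbb R\Gamma_{x_0}(X,\mathbb Z_{\{p\}})\to\mathbb R\Gamma(X,\mathbb Z_{\{p\}})$ is an isomorphism (equivalently, the global dualizing complex of $X$ restricted to the smallest open neighbourhood $U_{x_0}$ of $x_0$ agrees, via the natural morphism, with the local dualizing complex of $U_{x_0}$, for every closed point $x_0$). *)

theory Defs
  imports
    "HOL-Analysis.Analysis"
    "HOL-Algebra.Elementary_Groups"
    "HOL-Library.Infinite_Typeclass"
begin

section \<open>Finite spaces\<close>

definition finite_space :: "'x topology \<Rightarrow> bool" where
  "finite_space X \<longleftrightarrow> finite (topspace X) \<and> t0_space X"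

definition spec_le :: "'x topology \<Rightarrow> 'x \<Rightarrow> 'x \<Rightarrow> bool" where
  "spec_le X p q \<longleftrightarrow> p \<in> topspace X \<and> q \<in> topspace X \<and> X closure_of {p} \<subseteq> X closure_of {q}"

definition spec_less :: "'x topology \<Rightarrow> 'x \<Rightarrow> 'x \<Rightarrow> bool" where
  "spec_less X p q \<longleftrightarrow> spec_le X p q \<and> p \<noteq> q"

definition closed_point :: "'x topology \<Rightarrow> 'x \<Rightarrow> bool" where
  "closed_point X x \<longleftrightarrow> x \<in> topspace X \<and> closedin X {x}"

definition Cset :: "'x topology \<Rightarrow> 'x \<Rightarrow> 'x set" where
  "Cset X p = {x \<in> topspace X. spec_le X x p}"

definition bdC :: "'x topology \<Rightarrow> 'x \<Rightarrow> 'x set" where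
  "bdC X p = Cset X p - {p}"


section \<open>Sheaves of abelian groups\<close>

text \<open>Abelian groups are written multiplicatively, as in \<^const>\<open>comm_group\<close>. Only the values of a
  presheaf on open sets, and of \<open>res F U V\<close> on pairs of open sets with \<open>V \<subseteq> U\<close>, are meaningful.\<close>

record ('x, 'u) psh =
  sec :: "'x set \<Rightarrow> 'u monoid"
  res :: "'x set \<Rightarrow> 'x set \<Rightarrow> 'u \<Rightarrow> 'u"

definition presheaf :: "'x topology \<Rightarrow> ('x, 'u) psh \<Rightarrow> bool" where
  "presheaf X F \<longleftrightarrow>
     (\<forall>U. openin X U \<longrightarrow> comm_group (sec F U)) \<and>
     (\<forall>U V. openin X U \<and> openin X V \<and> V \<subseteq> U \<longrightarrow> res F U V \<in> hom (sec F U) (sec F V)) \<and>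
     (\<forall>U. openin X U \<longrightarrow> (\<forall>s \<in> carrier (sec F U). res F U U s = s)) \<and>
     (\<forall>U V W. openin X U \<and> openin X V \<and> openin X W \<and> W \<subseteq> V \<and> V \<subseteq> U \<longrightarrow>
        (\<forall>s \<in> carrier (sec F U). res F V W (res F U V s) = res F U W s))"

definition sheaf :: "'x topology \<Rightarrow> ('x, 'u) psh \<Rightarrow> bool" where
  "sheaf X F \<longleftrightarrow> presheaf X F \<and>
     (\<forall>\<U> s. (\<forall>U \<in> \<U>. openin X U \<and> s U \<in> carrier (sec F U)) \<and>
            (\<forall>U \<in> \<U>. \<forall>V \<in> \<U>. res F U (U \<inter> V) (s U) = res F V (U \<inter> V) (s V)) \<longrightarrow>
        (\<exists>!t. t \<in> carrier (sec F (\<Union>\<U>)) \<and> (\<forall>U \<in> \<U>. res F (\<Union>\<U>) U t = s U)))"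

definition sheaf_hom ::
  "'x topology \<Rightarrow> ('x, 'u) psh \<Rightarrow> ('x, 'v) psh \<Rightarrow> ('x set \<Rightarrow> 'u \<Rightarrow> 'v) \<Rightarrow> bool" where
  "sheaf_hom X F G \<phi> \<longleftrightarrow>
     (\<forall>U. openin X U \<longrightarrow> \<phi> U \<in> hom (sec F U) (sec G U)) \<and>
     (\<forall>U V. openin X U \<and> openin X V \<and> V \<subseteq> U \<longrightarrow>
        (\<forall>s \<in> carrier (sec F U). \<phi> V (res F U V s) = res G U V (\<phi> U s)))"

definition sheaf_mono ::
  "'x topology \<Rightarrow> ('x, 'u) psh \<Rightarrow> ('x, 'v) psh \<Rightarrow> ('x set \<Rightarrow> 'u \<Rightarrow> 'v) \<Rightarrow> bool" where
  "sheaf_mono X F G \<phi> \<longleftrightarrow> sheaf_hom X F G \<phi> \<and>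
     (\<forall>U. openin X U \<longrightarrow> inj_on (\<phi> U) (carrier (sec F U)))"

text \<open>Exactness of \<open>F \<rightarrow> G \<rightarrow> H\<close> at \<open>G\<close> as sheaves: the kernel is the image sheaf, that is, a
  section of \<open>G\<close> is killed iff it lifts to \<open>F\<close> locally.\<close>

definition sheaf_exact ::
  "'x topology \<Rightarrow> ('x, 'u) psh \<Rightarrow> ('x, 'v) psh \<Rightarrow> ('x, 'w) psh \<Rightarrow>
   ('x set \<Rightarrow> 'u \<Rightarrow> 'v) \<Rightarrow> ('x set \<Rightarrow> 'v \<Rightarrow> 'w) \<Rightarrow> bool" where
  "sheaf_exact X F G H \<phi> \<psi> \<longleftrightarrow>
     (\<forall>U. openin X U \<longrightarrow> (\<forall>s \<in> carrier (sec G U).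
        \<psi> U s = \<one>\<^bsub>sec H U\<^esub> \<longleftrightarrow>
        (\<forall>x \<in> U. \<exists>V. openin X V \<and> x \<in> V \<and> V \<subseteq> U \<and> res G U V s \<in> \<phi> V ` carrier (sec F V))))"

text \<open>Injectivity is tested against the sheaves whose groups of sections have their carriers in the
  same type \<open>'u\<close>. On a finite space and for infinite \<open>'u\<close> this is the usual notion: by Baer's
  criterion it suffices to test subsheaves of the sheaves \<open>\<int>\<^sub>U\<close>, whose section groups are countable.\<close>

definition injective_sheaf :: "'x topology \<Rightarrow> ('x, 'u) psh \<Rightarrow> bool" where
  "injective_sheaf X I \<longleftrightarrow> sheaf X I \<and>
     (\<forall>(A :: ('x, 'u) psh) (B :: ('x, 'u) psh) i f.
        sheaf X A \<and> sheaf X B \<and> sheaf_mono X A B i \<and> sheaf_hom X A I f \<longrightarrow>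
        (\<exists>g. sheaf_hom X B I g \<and>
             (\<forall>U. openin X U \<longrightarrow> (\<forall>s \<in> carrier (sec A U). g U (i U s) = f U s))))"

text \<open>The sheaf \<open>\<int>\<^sub>S\<close> for \<open>S\<close> locally closed in \<open>X\<close>: the constant sheaf on \<open>S\<close>, extended by zero.
  Its sections over \<open>U\<close> are the sections over \<open>S \<inter> U\<close> of the constant sheaf (the locally constant
  functions) whose support is closed in \<open>U\<close>; functions are set to \<open>0\<close> outside \<open>S \<inter> U\<close>. For
  \<open>S = topspace X\<close> the support condition is automatic and this is the constant sheaf on \<open>X\<close>.\<close>

definition int_sheaf_on :: "'x topology \<Rightarrow> 'x set \<Rightarrow> ('x, 'x \<Rightarrow> int) psh" where
  "int_sheaf_on X S =
    \<lparr> sec = (\<lambda>U. \<lparr> carrier = {f. (\<forall>x. x \<notin> S \<inter> U \<longrightarrow> f x = 0) \<and>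
                              continuous_map (subtopology X (S \<inter> U)) (discrete_topology UNIV) f \<and>
                              closedin (subtopology X U) {x \<in> U. f x \<noteq> 0}},
                   monoid.mult = (\<lambda>f g x. f x + g x),
                   one = (\<lambda>x. 0) \<rparr>),
      res = (\<lambda>U V f x. if x \<in> V then f x else 0) \<rparr>"

definition const_int_sheaf :: "'x topology \<Rightarrow> ('x, 'x \<Rightarrow> int) psh" where
  "const_int_sheaf X = int_sheaf_on X (topspace X)"


section \<open>Cochain complexes of abelian groups\<close>

record 'a cochain =
  grp :: "int \<Rightarrow> 'a monoid"
  diff :: "int \<Rightarrow> 'a \<Rightarrow> 'a"  \<comment> \<open>\<open>diff C n\<close> goes from degree \<open>n\<close> to degree \<open>n + 1\<close>\<close>

definition cocycles :: "'a cochain \<Rightarrow> int \<Rightarrow> 'a set" where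
  "cocycles C n = kernel (grp C n) (grp C (n + 1)) (diff C n)"

definition coboundaries :: "'a cochain \<Rightarrow> int \<Rightarrow> 'a set" where
  "coboundaries C n = diff C (n - 1) ` carrier (grp C (n - 1))"

definition cohom :: "'a cochain \<Rightarrow> int \<Rightarrow> 'a set monoid" where
  "cohom C n = (grp C n)\<lparr>carrier := cocycles C n\<rparr> Mod coboundaries C n"

definition acyclic_cochain :: "'a cochain \<Rightarrow> bool" where
  "acyclic_cochain C \<longleftrightarrow> (\<forall>n. trivial_group (cohom C n))"

definition chain_map :: "'a cochain \<Rightarrow> 'b cochain \<Rightarrow> (int \<Rightarrow> 'a \<Rightarrow> 'b) \<Rightarrow> bool" where
  "chain_map C D f \<longleftrightarrow>
     (\<forall>n. f n \<in> hom (grp C n) (grp D n) \<and>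
          (\<forall>x \<in> carrier (grp C n). f (n + 1) (diff C n x) = diff D n (f n x)))"

text \<open>The induced map sends the class of a cocycle \<open>z\<close> to the class of \<open>f n z\<close>.\<close>

definition cohom_map :: "'a cochain \<Rightarrow> 'b cochain \<Rightarrow> (int \<Rightarrow> 'a \<Rightarrow> 'b) \<Rightarrow> int \<Rightarrow> 'a set \<Rightarrow> 'b set" where
  "cohom_map C D f n K = coboundaries D n <#>\<^bsub>grp D n\<^esub> (f n ` K)"

text \<open>A morphism of complexes is an isomorphism in the derived category of abelian groups iff it is
  a quasi-isomorphism, and a complex is zero there iff it is acyclic.\<close>

definition quasi_iso :: "'a cochain \<Rightarrow> 'b cochain \<Rightarrow> (int \<Rightarrow> 'a \<Rightarrow> 'b) \<Rightarrow> bool" where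
  "quasi_iso C D f \<longleftrightarrow> chain_map C D f \<and> (\<forall>n. cohom_map C D f n \<in> iso (cohom C n) (cohom D n))"

definition cone :: "'a cochain \<Rightarrow> 'b cochain \<Rightarrow> (int \<Rightarrow> 'a \<Rightarrow> 'b) \<Rightarrow> ('a \<times> 'b) cochain" where
  "cone C D f =
    \<lparr> grp = (\<lambda>n. grp C (n + 1) \<times>\<times> grp D n),
      diff = (\<lambda>n (a, b). (inv\<^bsub>grp C (n + 2)\<^esub> (diff C (n + 1) a),
                         f (n + 1) a \<otimes>\<^bsub>grp D (n + 1)\<^esub> diff D n b)) \<rparr>"

text \<open>The canonical morphism \<open>D \<rightarrow> cone (C \<rightarrow> D)\<close>.\<close>

definition to_cone :: "'a cochain \<Rightarrow> int \<Rightarrow> 'b \<Rightarrow> 'a \<times> 'b" where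
  "to_cone C n b = (\<one>\<^bsub>grp C (n + 1)\<^esub>, b)"

definition int_cochain :: "int cochain" where  \<comment> \<open>\<open>\<int>\<close> in degree 0\<close>
  "int_cochain = \<lparr> grp = (\<lambda>n. if n = 0 then integer_group else singleton_group 0),
                   diff = (\<lambda>n k. 0) \<rparr>"


section \<open>Right derived sections\<close>

record ('x, 'b, 'u) resolution =
  robj :: "int \<Rightarrow> ('x, 'u) psh"
  rdiff :: "int \<Rightarrow> 'x set \<Rightarrow> 'u \<Rightarrow> 'u"
  raug :: "'x set \<Rightarrow> 'b \<Rightarrow> 'u"

text \<open>Injective resolutions \<open>0 \<rightarrow> F \<rightarrow> I\<^sup>0 \<rightarrow> I\<^sup>1 \<rightarrow> \<dots>\<close>, with the complex \<open>I\<close> continued by zero in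
  negative degrees. The sections of \<open>F\<close> need not have the same type as those of \<open>I\<close>.\<close>

definition injective_resolution ::
  "'x topology \<Rightarrow> ('x, 'b) psh \<Rightarrow> ('x, 'b, 'u) resolution \<Rightarrow> bool" where
  "injective_resolution X F R \<longleftrightarrow>
     (\<forall>n. injective_sheaf X (robj R n)) \<and>
     (\<forall>n<0. \<forall>U. openin X U \<longrightarrow> trivial_group (sec (robj R n) U)) \<and>
     (\<forall>n. sheaf_hom X (robj R n) (robj R (n + 1)) (rdiff R n)) \<and>
     sheaf_mono X F (robj R 0) (raug R) \<and>
     sheaf_exact X F (robj R 0) (robj R 1) (raug R) (rdiff R 0) \<and>
     (\<forall>n\<ge>0. sheaf_exact X (robj R n) (robj R (n + 1)) (robj R (n + 2)) (rdiff R n) (rdiff R (n + 1)))"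

definition inj_res :: "'x topology \<Rightarrow> ('x, 'b) psh \<Rightarrow> ('x, 'b, 'u) resolution" where
  "inj_res X F = (SOME R. injective_resolution X F R)"

definition RGamma :: "'x topology \<Rightarrow> ('x, 'b) psh \<Rightarrow> 'u cochain" where
  "RGamma X F = \<lparr> grp = (\<lambda>n. sec (robj (inj_res X F) n) (topspace X)),
                  diff = (\<lambda>n. rdiff (inj_res X F) n (topspace X)) \<rparr>"

text \<open>Sections with support in a closed subset \<open>Z\<close>: those whose restriction to the complement of
  \<open>Z\<close> is zero.\<close>

definition supp_sec :: "'x topology \<Rightarrow> 'x set \<Rightarrow> ('x, 'u) psh \<Rightarrow> 'u monoid" where
  "supp_sec X Z F = (sec F (topspace X))\<lparr>carrier :=
     kernel (sec F (topspace X)) (sec F (topspace X - Z)) (res F (topspace X) (topspace X - Z))\<rparr>"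

definition RGamma_supp :: "'x topology \<Rightarrow> 'x set \<Rightarrow> ('x, 'b) psh \<Rightarrow> 'u cochain" where
  "RGamma_supp X Z F = \<lparr> grp = (\<lambda>n. supp_sec X Z (robj (inj_res X F) n)),
                         diff = (\<lambda>n. rdiff (inj_res X F) n (topspace X)) \<rparr>"

text \<open>As \<^const>\<open>RGamma\<close> and \<^const>\<open>RGamma_supp\<close> use the same chosen resolution, the natural morphism
  \<open>RGamma_supp X Z F \<rightarrow> RGamma X F\<close> is the inclusion \<open>\<lambda>n s. s\<close>.\<close>

text \<open>The natural morphism \<open>\<int> \<rightarrow> RGamma X \<int>\<close>.\<close>

definition int_to_RGamma :: "'x topology \<Rightarrow> int \<Rightarrow> int \<Rightarrow> 'u" where
  "int_to_RGamma X n k =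
     (if n = 0
      then raug (inj_res X (const_int_sheaf X) :: ('x, 'x \<Rightarrow> int, 'u) resolution) (topspace X)
             (\<lambda>x. if x \<in> topspace X then k else 0)
      else \<one>\<^bsub>grp (RGamma X (const_int_sheaf X) :: 'u cochain) n\<^esub>)"

definition RGamma_red :: "'x topology \<Rightarrow> (int \<times> 'u) cochain" where
  "RGamma_red X = cone int_cochain (RGamma X (const_int_sheaf X)) (int_to_RGamma X)"


section \<open>Cohomologically trivial and proper finite spaces\<close>

text \<open>The first argument fixes the type \<open>'u\<close> in which the injective resolutions are formed. Every
  infinite \<open>'u\<close> is large enough for the resolutions used here to exist.\<close>

definition cohomologically_trivial :: "'u itself \<Rightarrow> 'x topology \<Rightarrow> bool" where
  "cohomologically_trivial u X \<longleftrightarrow> acyclic_cochain (RGamma_red X :: (int \<times> 'u) cochain)"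

definition proper_space :: "'u itself \<Rightarrow> 'x topology \<Rightarrow> bool" where
  "proper_space u X \<longleftrightarrow>
     (\<forall>x0 p. closed_point X x0 \<and> spec_le X x0 p \<longrightarrow>
        quasi_iso (RGamma_supp X {x0} (int_sheaf_on X {p}) :: 'u cochain)
                  (RGamma X (int_sheaf_on X {p}) :: 'u cochain) (\<lambda>n s. s))"

end

theory Submission
  imports Defs
begin

text \<open>
  All three conditions are compared with one combinatorial statement: for every closed point \<open>x0\<close> and
  every \<open>p > x0\<close>, the augmented cochain complex of the order complex of \<open>W = bdC X p - {x0}\<close> (functions
  on the finite chains of \<open>W\<close>, the empty chain included) is exact.

  \<^bold>\<open>Cochains compute cohomology.\<close> For a convex set \<open>S\<close> of points, let \<open>G\<^sup>n\<close> be the sheaf whose sections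
  over \<open>U\<close> are the integer functions on the strict chains \<open>x\<^sub>0 < \<dots> < x\<^sub>n\<close> in \<open>U\<close> with \<open>x\<^sub>n \<in> S\<close>. These
  sheaves are products of skyscrapers, hence flabby, and \<open>0 \<rightarrow> \<int>\<^sub>S \<rightarrow> G\<^sup>0 \<rightarrow> G\<^sup>1 \<rightarrow> \<dots>\<close> is exact: the
  cocycles in \<open>G\<^sup>0\<close> are the sections of \<open>\<int>\<^sub>S\<close> (\<open>cdiff_0_aug\<close>), and exactness in positive degrees holds because
  every smallest open neighbourhood is a cone (\<open>cdiff_exact\<close>). If \<open>I\<close> is an injective
  resolution of \<open>\<int>\<^sub>S\<close>, injectivity yields a morphism \<open>G \<rightarrow> I\<close> over \<open>\<int>\<^sub>S\<close> (\<open>ex_comparison\<close>). Injective sheaves are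
  flabby (\<open>flabby_injective\<close>), so its mapping cone is a complex of flabby sheaves that is exact on stalks,
  and such a complex is exact on sections over every open set by a Mayer-Vietoris induction
  (\<open>flabby_complex_exact\<close>). Thus \<open>\<Gamma>(U, G) \<rightarrow> \<Gamma>(U, I)\<close> is a quasi-isomorphism for every open set \<open>U\<close>
  (\<open>ex_comparison_quasi_iso\<close>). Since the derived functors are defined by choosing some resolution, one also
  has to know that injective resolutions exist (\<open>ex_injective_resolution\<close>): one takes the total complex of
  the cochains with values in \<open>\<rat>\<close> and in \<open>\<rat>/\<int>\<close>, which is injective since these groups are divisible
  (\<open>divisible_extend\<close>), and renames its countably many sections into the given infinite type.

  \<^bold>\<open>Reduction to acyclicity.\<close> For a closed point \<open>x0\<close> of a space \<open>Y\<close> and flabby \<open>I\<close> the sequence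
  \<open>0 \<rightarrow> \<Gamma>\<^sub>x\<^sub>0(Y, I) \<rightarrow> \<Gamma>(Y, I) \<rightarrow> \<Gamma>(Y - x0, I) \<rightarrow> 0\<close> is exact, so \<open>\<Gamma>\<^sub>x\<^sub>0(Y, I) \<rightarrow> \<Gamma>(Y, I)\<close> is a quasi-isomorphism
  iff \<open>\<Gamma>(Y - x0, I)\<close> is acyclic; the same holds for the cones of \<open>\<int> \<rightarrow> \<Gamma>(Y, I)\<close> and \<open>\<int> \<rightarrow> \<Gamma>(Y - x0, I)\<close>
  when \<open>I\<close> resolves the constant sheaf (\<open>quasi_iso_supp_iff\<close>, \<open>quasi_iso_supp_red_iff\<close>).

  \<^bold>\<open>Conclusion.\<close> The cone of \<open>\<int> \<rightarrow> \<Gamma>(W, I)\<close> is acyclic iff the augmented cochains of \<open>W\<close> are exact, both for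
  a resolution on the space \<open>W\<close> and for one on the larger space \<open>bdC X p\<close> (\<open>acyclic_red_complex_iff\<close>); this
  settles the second and the third condition. For properness, the complex to be acyclic is that of the
  cochains of \<open>\<int>\<^sub>p\<close> on \<open>X - x0\<close>. A chain in \<open>X - x0\<close> that ends in \<open>p\<close> is a chain in \<open>W\<close> with \<open>p\<close> appended, so
  this is the augmented complex of \<open>W\<close> shifted by one degree (\<open>cochains_point_exact_iff\<close>); for \<open>p = x0\<close>
  there is no such chain and the complex is zero.
\<close>

section \<open>Finite spaces as partial orders\<close>

text \<open>In a finite space this is the smallest open neighbourhood of \<open>x\<close>.\<close>

definition nb :: "'x topology \<Rightarrow> 'x \<Rightarrow> 'x set" where
  "nb X x = {y. spec_le X x y}"

lemma spec_le_iff: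
  "spec_le X p q \<longleftrightarrow> p \<in> topspace X \<and> q \<in> topspace X \<and> (\<forall>U. openin X U \<and> p \<in> U \<longrightarrow> q \<in> U)"
proof -
  have "X closure_of {p} \<subseteq> X closure_of {q} \<longleftrightarrow> p \<in> X closure_of {q}"
    if "p \<in> topspace X" "q \<in> topspace X"
  proof
    show "p \<in> X closure_of {q}" if "X closure_of {p} \<subseteq> X closure_of {q}"
      using that closure_of_subset[of "{p}" X] \<open>p \<in> topspace X\<close> by auto
    show "X closure_of {p} \<subseteq> X closure_of {q}" if "p \<in> X closure_of {q}"
      by (rule closure_of_minimal) (use that in auto)
  qed
  then show ?thesis
    unfolding spec_le_def in_closure_of by auto
qed

lemma spec_le_refl: "x \<in> topspace X \<Longrightarrow> spec_le X x x"
  by (simp add: spec_le_def)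

lemma spec_le_trans: "spec_le X x y \<Longrightarrow> spec_le X y z \<Longrightarrow> spec_le X x z"
  by (auto simp: spec_le_def)

lemma spec_le_antisym: "finite_space X \<Longrightarrow> spec_le X x y \<Longrightarrow> spec_le X y x \<Longrightarrow> x = y"
  unfolding finite_space_def t0_space_def spec_le_iff by (metis (no_types))

lemma spec_le_topspace: "spec_le X x y \<Longrightarrow> x \<in> topspace X" "spec_le X x y \<Longrightarrow> y \<in> topspace X"
  by (auto simp: spec_le_def)

lemma nb_least: "openin X U \<Longrightarrow> x \<in> U \<Longrightarrow> nb X x \<subseteq> U"
  by (auto simp: nb_def spec_le_iff)

lemma nb_self: "x \<in> topspace X \<Longrightarrow> x \<in> nb X x"
  by (simp add: nb_def spec_le_refl)

lemma nb_mono: "y \<in> nb X x \<Longrightarrow> nb X y \<subseteq> nb X x"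
  by (auto simp: nb_def intro: spec_le_trans)

lemma nb_topspace: "y \<in> nb X x \<Longrightarrow> y \<in> topspace X" "y \<in> nb X x \<Longrightarrow> x \<in> topspace X"
  by (auto simp: nb_def spec_le_def)

lemma openin_nb:
  assumes "finite_space X" "x \<in> topspace X"
  shows "openin X (nb X x)"
proof -
  let ?N = "{U. openin X U \<and> x \<in> U}"
  have "?N \<subseteq> Pow (topspace X)" by (auto dest: openin_subset)
  then have "finite ?N"
    using assms(1) by (metis finite_Pow_iff finite_space_def finite_subset)
  moreover have "topspace X \<in> ?N" using assms(2) by simp
  ultimately have "openin X (\<Inter>?N)" by (intro openin_Inter) auto
  moreover have "\<Inter>?N = nb X x"
    using assms(2) by (auto simp: nb_def spec_le_iff)
  ultimately show ?thesis by simp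
qed

lemma openin_iff_upper:
  assumes "finite_space X"
  shows "openin X U \<longleftrightarrow> U \<subseteq> topspace X \<and> (\<forall>x\<in>U. \<forall>y. spec_le X x y \<longrightarrow> y \<in> U)"
proof
  assume "openin X U"
  then show "U \<subseteq> topspace X \<and> (\<forall>x\<in>U. \<forall>y. spec_le X x y \<longrightarrow> y \<in> U)"
    by (auto simp: spec_le_iff dest: openin_subset)
next
  assume U: "U \<subseteq> topspace X \<and> (\<forall>x\<in>U. \<forall>y. spec_le X x y \<longrightarrow> y \<in> U)"
  then have "U = \<Union>(nb X ` U)" by (fastforce simp: nb_def intro: spec_le_refl)
  moreover have "openin X (\<Union>(nb X ` U))"
    using U assms by (intro openin_Union) (auto intro: openin_nb)
  ultimately show "openin X U" by simp
qed

lemma nb_inj: "finite_space X \<Longrightarrow> x \<in> topspace X \<Longrightarrow> y \<in> topspace X \<Longrightarrow> nb X x = nb X y \<Longrightarrow> x = y"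
  by (metis mem_Collect_eq nb_def nb_self spec_le_antisym)

lemma Union_nb: "openin X U \<Longrightarrow> \<Union>(nb X ` U) = U"
  using nb_least nb_self openin_subset by fast


section \<open>Sheaves on finite spaces\<close>

lemma hom_inv_eq:
  "h \<in> hom G H \<Longrightarrow> group G \<Longrightarrow> group H \<Longrightarrow> x \<in> carrier G \<Longrightarrow> h (inv\<^bsub>G\<^esub> x) = inv\<^bsub>H\<^esub> (h x)"
  by (intro group_hom.hom_inv) (auto simp: group_hom_def group_hom_axioms_def)

context
  fixes X :: "'x topology" and F :: "('x, 'u) psh"
  assumes F: "presheaf X F"
begin

lemma psh_comm_group: "openin X U \<Longrightarrow> comm_group (sec F U)"
  using F by (simp add: presheaf_def)

lemma psh_group: "openin X U \<Longrightarrow> group (sec F U)"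
  using psh_comm_group by (simp add: comm_group_def)

lemma res_hom: "openin X U \<Longrightarrow> openin X V \<Longrightarrow> V \<subseteq> U \<Longrightarrow> res F U V \<in> hom (sec F U) (sec F V)"
  using F by (simp add: presheaf_def)

lemma res_closed:
  "openin X U \<Longrightarrow> openin X V \<Longrightarrow> V \<subseteq> U \<Longrightarrow> s \<in> carrier (sec F U) \<Longrightarrow> res F U V s \<in> carrier (sec F V)"
  using res_hom by (meson hom_in_carrier)

lemma res_id: "openin X U \<Longrightarrow> s \<in> carrier (sec F U) \<Longrightarrow> res F U U s = s"
  using F by (simp add: presheaf_def)

lemma res_res:
  "openin X U \<Longrightarrow> openin X V \<Longrightarrow> openin X W \<Longrightarrow> W \<subseteq> V \<Longrightarrow> V \<subseteq> U \<Longrightarrow> s \<in> carrier (sec F U) \<Longrightarrow>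
   res F V W (res F U V s) = res F U W s"
  using F unfolding presheaf_def by blast

lemma res_mult:
  "openin X U \<Longrightarrow> openin X V \<Longrightarrow> V \<subseteq> U \<Longrightarrow> s \<in> carrier (sec F U) \<Longrightarrow> t \<in> carrier (sec F U) \<Longrightarrow>
   res F U V (s \<otimes>\<^bsub>sec F U\<^esub> t) = res F U V s \<otimes>\<^bsub>sec F V\<^esub> res F U V t"
  using res_hom by (meson hom_mult)

lemma res_one:
  "openin X U \<Longrightarrow> openin X V \<Longrightarrow> V \<subseteq> U \<Longrightarrow> res F U V \<one>\<^bsub>sec F U\<^esub> = \<one>\<^bsub>sec F V\<^esub>"
  using res_hom psh_group by (meson hom_one)

lemma res_inv:
  "openin X U \<Longrightarrow> openin X V \<Longrightarrow> V \<subseteq> U \<Longrightarrow> s \<in> carrier (sec F U) \<Longrightarrow>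
   res F U V (inv\<^bsub>sec F U\<^esub> s) = inv\<^bsub>sec F V\<^esub> (res F U V s)"
  using res_hom psh_group by (meson hom_inv_eq)

end

lemma sheaf_presheaf: "sheaf X F \<Longrightarrow> presheaf X F"
  by (simp add: sheaf_def)

lemmas sh_comm_group = psh_comm_group[OF sheaf_presheaf]
  and sh_group = psh_group[OF sheaf_presheaf]

lemma sheaf_glue:
  assumes "sheaf X F" "\<And>i. i \<in> I \<Longrightarrow> openin X (U i)" "\<And>i. i \<in> I \<Longrightarrow> s i \<in> carrier (sec F (U i))"
    and "\<And>i j. i \<in> I \<Longrightarrow> j \<in> I \<Longrightarrow>
           res F (U i) (U i \<inter> U j) (s i) = res F (U j) (U i \<inter> U j) (s j)"
    and "(\<Union>i\<in>I. U i) = W"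
  shows "\<exists>!t. t \<in> carrier (sec F W) \<and> (\<forall>i\<in>I. res F W (U i) t = s i)"
proof -
  define s' where "s' V = s (SOME i. i \<in> I \<and> U i = V)" for V
  have pick: "\<exists>j\<in>I. U j = U i \<and> s' (U i) = s j" if "i \<in> I" for i
    unfolding s'_def using someI[of "\<lambda>j. j \<in> I \<and> U j = U i" i] that by auto
  have s': "s' (U i) = s i" if i: "i \<in> I" for i
  proof -
    obtain j where j: "j \<in> I" "U j = U i" "s' (U i) = s j" using pick[OF i] by auto
    have "res F (U i) (U i) (s i) = res F (U i) (U i) (s j)"
      using assms(4)[OF i j(1)] j(2) by simp
    then have "s i = s j"
      using res_id[OF sheaf_presheaf[OF assms(1)]] assms(2,3) i j(1,2) by metis
    then show ?thesis using j by simp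
  qed
  have ex: "(\<forall>V \<in> \<U>. openin X V \<and> s V \<in> carrier (sec F V)) \<Longrightarrow>
            (\<forall>V \<in> \<U>. \<forall>W \<in> \<U>. res F V (V \<inter> W) (s V) = res F W (V \<inter> W) (s W)) \<Longrightarrow>
        (\<exists>!t. t \<in> carrier (sec F (\<Union>\<U>)) \<and> (\<forall>V \<in> \<U>. res F (\<Union>\<U>) V t = s V))" for \<U> s
    by (rule mp[OF spec[OF spec[OF conjunct2[OF assms(1)[unfolded sheaf_def]]]]]) (rule conjI)
  have "\<exists>!t. t \<in> carrier (sec F (\<Union>(U ` I))) \<and> (\<forall>V \<in> U ` I. res F (\<Union>(U ` I)) V t = s' V)"
    by (rule ex) (use assms(2-4) s' in auto)
  then show ?thesis using assms(5) s' by simp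
qed

lemma stalk_sep:
  assumes fs: "finite_space X" and "sheaf X F" "openin X U" "s \<in> carrier (sec F U)" "t \<in> carrier (sec F U)"
    and "\<And>x. x \<in> U \<Longrightarrow> res F U (nb X x) s = res F U (nb X x) t"
  shows "s = t"
proof -
  note p = sheaf_presheaf[OF assms(2)]
  have n: "openin X (nb X x)" "nb X x \<subseteq> U" if "x \<in> U" for x
    using that assms(3) fs nb_least openin_nb openin_subset by fast+
  have "\<exists>!r. r \<in> carrier (sec F U) \<and> (\<forall>x\<in>U. res F U (nb X x) r = res F U (nb X x) s)"
  proof (rule sheaf_glue[OF assms(2)])
    show "res F (nb X x) (nb X x \<inter> nb X y) (res F U (nb X x) s) =
      res F (nb X y) (nb X x \<inter> nb X y) (res F U (nb X y) s)" if "x \<in> U" "y \<in> U" for x y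
      using n that by (simp add: res_res[OF p] assms openin_Int)
    show "(\<Union>x\<in>U. nb X x) = U" by (rule Union_nb[OF assms(3)])
  qed (use n assms in \<open>auto intro: res_closed[OF p]\<close>)
  then show ?thesis using assms by metis
qed

lemma stalk_glue:
  assumes fs: "finite_space X" and F: "sheaf X F" and U: "openin X U"
    and t: "\<And>x. x \<in> U \<Longrightarrow> t x \<in> carrier (sec F (nb X x))"
    and c: "\<And>x y. x \<in> U \<Longrightarrow> y \<in> nb X x \<Longrightarrow> res F (nb X x) (nb X y) (t x) = t y"
  shows "\<exists>s \<in> carrier (sec F U). \<forall>x\<in>U. res F U (nb X x) s = t x"
proof -
  note p = sheaf_presheaf[OF F]
  have n: "openin X (nb X x)" "nb X x \<subseteq> U" if "x \<in> U" for x
    using that U fs nb_least openin_nb openin_subset by fast+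
  have "\<exists>!s. s \<in> carrier (sec F U) \<and> (\<forall>x\<in>U. res F U (nb X x) s = t x)"
  proof (rule sheaf_glue[OF F])
    fix x y assume xy: "x \<in> U" "y \<in> U"
    let ?W = "nb X x \<inter> nb X y"
    have W: "openin X ?W" using n xy by (simp add: openin_Int)
    show "res F (nb X x) ?W (t x) = res F (nb X y) ?W (t y)"
    proof (rule stalk_sep[OF fs F W])
      fix z assume z: "z \<in> ?W"
      then have "nb X z \<subseteq> ?W" "openin X (nb X z)"
        using W nb_least openin_nb[OF fs] openin_subset by fast+
      then show "res F ?W (nb X z) (res F (nb X x) ?W (t x)) = res F ?W (nb X z) (res F (nb X y) ?W (t y))"
        using z xy n W t c by (simp add: res_res[OF p])
    qed (use xy n t W in \<open>auto intro!: res_closed[OF p]\<close>)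
  qed (use n t Union_nb[OF U] in auto)
  then show ?thesis by blast
qed

lemma sheaf_hom_hom: "sheaf_hom X F G \<phi> \<Longrightarrow> openin X U \<Longrightarrow> \<phi> U \<in> hom (sec F U) (sec G U)"
  by (simp add: sheaf_hom_def)

lemma sheaf_hom_closed:
  "sheaf_hom X F G \<phi> \<Longrightarrow> openin X U \<Longrightarrow> s \<in> carrier (sec F U) \<Longrightarrow> \<phi> U s \<in> carrier (sec G U)"
  by (meson sheaf_hom_hom hom_in_carrier)

lemma sheaf_hom_res:
  "sheaf_hom X F G \<phi> \<Longrightarrow> openin X U \<Longrightarrow> openin X V \<Longrightarrow> V \<subseteq> U \<Longrightarrow> s \<in> carrier (sec F U) \<Longrightarrow>
   \<phi> V (res F U V s) = res G U V (\<phi> U s)"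
  by (simp add: sheaf_hom_def)

lemma sheaf_hom_mult:
  "sheaf_hom X F G \<phi> \<Longrightarrow> openin X U \<Longrightarrow> s \<in> carrier (sec F U) \<Longrightarrow> t \<in> carrier (sec F U) \<Longrightarrow>
   \<phi> U (s \<otimes>\<^bsub>sec F U\<^esub> t) = \<phi> U s \<otimes>\<^bsub>sec G U\<^esub> \<phi> U t"
  by (meson sheaf_hom_hom hom_mult)

lemma sheaf_hom_one:
  "sheaf_hom X F G \<phi> \<Longrightarrow> sheaf X F \<Longrightarrow> sheaf X G \<Longrightarrow> openin X U \<Longrightarrow> \<phi> U \<one>\<^bsub>sec F U\<^esub> = \<one>\<^bsub>sec G U\<^esub>"
  by (meson sheaf_hom_hom hom_one sh_group)

lemma sheaf_hom_inv:
  "sheaf_hom X F G \<phi> \<Longrightarrow> sheaf X F \<Longrightarrow> sheaf X G \<Longrightarrow> openin X U \<Longrightarrow> s \<in> carrier (sec F U) \<Longrightarrow>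
   \<phi> U (inv\<^bsub>sec F U\<^esub> s) = inv\<^bsub>sec G U\<^esub> (\<phi> U s)"
  by (meson sheaf_hom_hom hom_inv_eq sh_group)

lemma sheaf_homI:
  assumes "\<And>U. openin X U \<Longrightarrow> \<phi> U \<in> hom (sec F U) (sec G U)"
    and "\<And>U V s. openin X U \<Longrightarrow> openin X V \<Longrightarrow> V \<subseteq> U \<Longrightarrow> s \<in> carrier (sec F U) \<Longrightarrow>
       \<phi> V (res F U V s) = res G U V (\<phi> U s)"
  shows "sheaf_hom X F G \<phi>"
  using assms by (simp add: sheaf_hom_def)

lemma sheaf_hom_comp:
  assumes "sheaf_hom X F G \<phi>" "sheaf_hom X G H \<psi>"
  shows "sheaf_hom X F H (\<lambda>U s. \<psi> U (\<phi> U s))"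
proof (rule sheaf_homI)
  fix U assume "openin X U"
  then have "\<psi> U \<circ> \<phi> U \<in> hom (sec F U) (sec H U)"
    using assms by (meson hom_compose sheaf_hom_hom)
  then show "(\<lambda>s. \<psi> U (\<phi> U s)) \<in> hom (sec F U) (sec H U)" by (simp add: comp_def)
qed (simp add: sheaf_hom_res[OF assms(1)] sheaf_hom_res[OF assms(2)] sheaf_hom_closed[OF assms(1)])

text \<open>On a finite space a morphism into a sheaf is the same thing as a compatible family of
  homomorphisms between the stalks, i.e. the sections over the smallest open neighbourhoods.\<close>

lemma hom_from_stalks:
  assumes fs: "finite_space X" and A: "presheaf X A" and B: "sheaf X B"
    and h: "\<And>x. x \<in> topspace X \<Longrightarrow> h x \<in> hom (sec A (nb X x)) (sec B (nb X x))"
    and nat: "\<And>x y s. x \<in> topspace X \<Longrightarrow> y \<in> nb X x \<Longrightarrow> s \<in> carrier (sec A (nb X x)) \<Longrightarrow>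
          h y (res A (nb X x) (nb X y) s) = res B (nb X x) (nb X y) (h x s)"
  shows "\<exists>\<phi>. sheaf_hom X A B \<phi> \<and> (\<forall>x\<in>topspace X. \<forall>s\<in>carrier (sec A (nb X x)). \<phi> (nb X x) s = h x s)"
proof -
  note pB = sheaf_presheaf[OF B]
  define \<phi> where "\<phi> U s = (SOME t. t \<in> carrier (sec B U) \<and>
      (\<forall>x\<in>U. res B U (nb X x) t = h x (res A U (nb X x) s)))" for U s
  have n: "openin X (nb X x)" "nb X x \<subseteq> U" "x \<in> topspace X" if "x \<in> U" "openin X U" for x U
    using that fs nb_least openin_nb openin_subset by fast+
  have hc: "h x (res A U (nb X x) s) \<in> carrier (sec B (nb X x))"
    if "x \<in> U" "openin X U" "s \<in> carrier (sec A U)" for x U s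
    using that n h by (meson A hom_in_carrier res_closed)
  have \<phi>: "\<phi> U s \<in> carrier (sec B U)" "\<And>x. x \<in> U \<Longrightarrow> res B U (nb X x) (\<phi> U s) = h x (res A U (nb X x) s)"
    if U: "openin X U" and s: "s \<in> carrier (sec A U)" for U s
  proof -
    have "\<exists>t. t \<in> carrier (sec B U) \<and> (\<forall>x\<in>U. res B U (nb X x) t = h x (res A U (nb X x) s))"
      unfolding Bex_def[symmetric]
    proof (rule stalk_glue[OF fs B U])
      fix x y assume xy: "x \<in> U" "y \<in> nb X x"
      then have y: "y \<in> U" using n U by blast
      show "res B (nb X x) (nb X y) (h x (res A U (nb X x) s)) = h y (res A U (nb X y) s)"
        using nat[OF _ xy(2), of "res A U (nb X x) s"] n[OF xy(1) U] n[OF y U] U s xy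
        by (simp add: res_res[OF A] res_closed[OF A] nb_mono)
    qed (use hc U s in auto)
    from someI_ex[OF this] show "\<phi> U s \<in> carrier (sec B U)"
      "\<And>x. x \<in> U \<Longrightarrow> res B U (nb X x) (\<phi> U s) = h x (res A U (nb X x) s)"
      unfolding \<phi>_def by blast+
  qed
  have "sheaf_hom X A B \<phi>"
  proof (rule sheaf_homI)
    fix U assume U: "openin X U"
    show "\<phi> U \<in> hom (sec A U) (sec B U)"
    proof (rule homI)
      fix s t assume st: "s \<in> carrier (sec A U)" "t \<in> carrier (sec A U)"
      have m: "s \<otimes>\<^bsub>sec A U\<^esub> t \<in> carrier (sec A U)"
        using st U psh_group[OF A] by (simp add: group.is_monoid monoid.m_closed)
      have m': "\<phi> U s \<otimes>\<^bsub>sec B U\<^esub> \<phi> U t \<in> carrier (sec B U)"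
        using \<phi>(1)[OF U] st U psh_group[OF pB] by (simp add: group.is_monoid monoid.m_closed)
      show "\<phi> U (s \<otimes>\<^bsub>sec A U\<^esub> t) = \<phi> U s \<otimes>\<^bsub>sec B U\<^esub> \<phi> U t"
      proof (rule stalk_sep[OF fs B U \<phi>(1)[OF U m] m'])
        fix x assume x: "x \<in> U"
        show "res B U (nb X x) (\<phi> U (s \<otimes>\<^bsub>sec A U\<^esub> t)) = res B U (nb X x) (\<phi> U s \<otimes>\<^bsub>sec B U\<^esub> \<phi> U t)"
          using n[OF x U] U st x m h[of x]
          by (simp add: \<phi> res_mult[OF pB] res_mult[OF A] res_closed[OF A] hom_mult)
      qed
    qed (use \<phi>(1)[OF U] in simp)
  next
    fix U V s assume U: "openin X U" and V: "openin X V" "V \<subseteq> U" and s: "s \<in> carrier (sec A U)"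
    have rs: "res A U V s \<in> carrier (sec A V)" using U V s res_closed[OF A] by simp
    show "\<phi> V (res A U V s) = res B U V (\<phi> U s)"
    proof (rule stalk_sep[OF fs B V(1) \<phi>(1)[OF V(1) rs]])
      fix x assume x: "x \<in> V"
      then have xU: "x \<in> U" using V by auto
      show "res B V (nb X x) (\<phi> V (res A U V s)) = res B V (nb X x) (res B U V (\<phi> U s))"
        using n[OF x V(1)] V U s x xU rs by (simp add: \<phi> res_res[OF A] res_res[OF pB])
    qed (use U V s \<phi> in \<open>auto intro: res_closed[OF pB]\<close>)
  qed
  moreover have "\<phi> (nb X x) s = h x s" if "x \<in> topspace X" "s \<in> carrier (sec A (nb X x))" for x s
  proof -
    have o: "openin X (nb X x)" by (rule openin_nb[OF fs that(1)])
    have "res B (nb X x) (nb X x) (\<phi> (nb X x) s) = h x (res A (nb X x) (nb X x) s)"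
      by (rule \<phi>(2)[OF o that(2) nb_self[OF that(1)]])
    then show ?thesis using \<phi>(1)[OF o that(2)] o that by (simp add: res_id[OF A] res_id[OF pB])
  qed
  ultimately show ?thesis by blast
qed

lemma comm_group_subgroup:
  assumes "comm_group G" "subgroup H G"
  shows "comm_group (G\<lparr>carrier := H\<rparr>)"
proof -
  interpret comm_group G by fact
  have "group (G\<lparr>carrier := H\<rparr>)" using assms(2) by (rule subgroup_imp_group)
  then show ?thesis
    by (rule group.group_comm_groupI) (use assms(2) m_comm in \<open>auto dest: subgroup.mem_carrier\<close>)
qed

section \<open>Kernels, products and renamings of sheaves\<close>

lemma sheaf_sep:
  assumes "sheaf X F" "\<And>i. i \<in> I \<Longrightarrow> openin X (U i)" "(\<Union>i\<in>I. U i) = W"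
    and "s \<in> carrier (sec F W)" "t \<in> carrier (sec F W)"
    and "\<And>i. i \<in> I \<Longrightarrow> res F W (U i) s = res F W (U i) t"
  shows "s = t"
proof -
  note p = sheaf_presheaf[OF assms(1)]
  have W: "openin X W" using assms(2,3) by (metis (mono_tags) image_iff openin_Union)
  have "\<exists>!r. r \<in> carrier (sec F W) \<and> (\<forall>i\<in>I. res F W (U i) r = res F W (U i) s)"
  proof (rule sheaf_glue[OF assms(1)])
    show "res F (U i) (U i \<inter> U j) (res F W (U i) s) = res F (U j) (U i \<inter> U j) (res F W (U j) s)"
      if "i \<in> I" "j \<in> I" for i j
    proof -
      have *: "openin X (U i)" "openin X (U j)" "openin X (U i \<inter> U j)" "U i \<subseteq> W" "U j \<subseteq> W"
        using assms(2,3) that by (auto intro: openin_Int)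
      then show ?thesis using assms(4) W by (simp add: res_res[OF p])
    qed
  qed (use assms W in \<open>auto intro!: res_closed[OF p]\<close>)
  then show ?thesis using assms by metis
qed

lemma sheafI:
  assumes "presheaf X F"
    and "\<And>\<U> s. (\<And>U. U \<in> \<U> \<Longrightarrow> openin X U) \<Longrightarrow> (\<And>U. U \<in> \<U> \<Longrightarrow> s U \<in> carrier (sec F U)) \<Longrightarrow>
      (\<And>U V. U \<in> \<U> \<Longrightarrow> V \<in> \<U> \<Longrightarrow> res F U (U \<inter> V) (s U) = res F V (U \<inter> V) (s V)) \<Longrightarrow>
      \<exists>t \<in> carrier (sec F (\<Union>\<U>)). \<forall>U \<in> \<U>. res F (\<Union>\<U>) U t = s U"
    and "\<And>\<U> s t. (\<And>U. U \<in> \<U> \<Longrightarrow> openin X U) \<Longrightarrow> s \<in> carrier (sec F (\<Union>\<U>)) \<Longrightarrow>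
      t \<in> carrier (sec F (\<Union>\<U>)) \<Longrightarrow> (\<And>U. U \<in> \<U> \<Longrightarrow> res F (\<Union>\<U>) U s = res F (\<Union>\<U>) U t) \<Longrightarrow> s = t"
  shows "sheaf X F"
  unfolding sheaf_def
proof (intro conjI allI impI, rule assms(1))
  fix \<U> s
  assume *: "(\<forall>U \<in> \<U>. openin X U \<and> s U \<in> carrier (sec F U)) \<and>
            (\<forall>U \<in> \<U>. \<forall>V \<in> \<U>. res F U (U \<inter> V) (s U) = res F V (U \<inter> V) (s V))"
  have "\<exists>t \<in> carrier (sec F (\<Union>\<U>)). \<forall>U \<in> \<U>. res F (\<Union>\<U>) U t = s U"
    by (rule assms(2)) (use * in auto)
  moreover have "s' = t'" if "s' \<in> carrier (sec F (\<Union>\<U>)) \<and> (\<forall>U\<in>\<U>. res F (\<Union>\<U>) U s' = s U)"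
     "t' \<in> carrier (sec F (\<Union>\<U>)) \<and> (\<forall>U\<in>\<U>. res F (\<Union>\<U>) U t' = s U)" for s' t'
    by (rule assms(3)[of \<U>]) (use * that in auto)
  ultimately show "\<exists>!t. t \<in> carrier (sec F (\<Union>\<U>)) \<and> (\<forall>U\<in>\<U>. res F (\<Union>\<U>) U t = s U)"
    by blast
qed

text \<open>The kernel of a morphism of sheaves, with sections formed open set by open set.\<close>

definition ker_psh :: "('x, 'u) psh \<Rightarrow> ('x, 'v) psh \<Rightarrow> ('x set \<Rightarrow> 'u \<Rightarrow> 'v) \<Rightarrow> ('x, 'u) psh" where
  "ker_psh B C d = \<lparr> sec = (\<lambda>U. (sec B U)\<lparr>carrier := kernel (sec B U) (sec C U) (d U)\<rparr>), res = res B \<rparr>"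

lemma sec_ker_psh:
  "s \<in> carrier (sec (ker_psh B C d) U) \<longleftrightarrow> s \<in> carrier (sec B U) \<and> d U s = \<one>\<^bsub>sec C U\<^esub>"
  "\<one>\<^bsub>sec (ker_psh B C d) U\<^esub> = \<one>\<^bsub>sec B U\<^esub>" "monoid.mult (sec (ker_psh B C d) U) = monoid.mult (sec B U)"
  "res (ker_psh B C d) = res B"
  by (auto simp: ker_psh_def kernel_def)

lemma sheaf_ker_psh:
  assumes B: "sheaf X B" and C: "sheaf X C" and d: "sheaf_hom X B C d"
  shows "sheaf X (ker_psh B C d)"
proof (rule sheafI)
  note pB = sheaf_presheaf[OF B] and pC = sheaf_presheaf[OF C]
  show "presheaf X (ker_psh B C d)"
    unfolding presheaf_def
  proof (intro conjI allI impI ballI)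
    fix U assume U: "openin X U"
    then have "group_hom (sec B U) (sec C U) (d U)"
      using sh_group[OF B] sh_group[OF C] sheaf_hom_hom[OF d] by (simp add: group_hom_def group_hom_axioms_def)
    then have "subgroup (kernel (sec B U) (sec C U) (d U)) (sec B U)" by (rule group_hom.subgroup_kernel)
    then show "comm_group (sec (ker_psh B C d) U)"
      by (simp add: ker_psh_def comm_group_subgroup sh_comm_group[OF B U])
  next
    fix U V assume UV: "openin X U \<and> openin X V \<and> V \<subseteq> U"
    then show "res (ker_psh B C d) U V \<in> hom (sec (ker_psh B C d) U) (sec (ker_psh B C d) V)"
      by (intro homI) (auto simp: sec_ker_psh res_closed[OF pB] res_mult[OF pB] sheaf_hom_res[OF d]
          res_one[OF pC])
  qed (auto simp: sec_ker_psh res_id[OF pB] res_res[OF pB])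
  {
    fix \<U> s
    assume U: "\<And>U. U \<in> \<U> \<Longrightarrow> openin X U" and s: "\<And>U. U \<in> \<U> \<Longrightarrow> s U \<in> carrier (sec (ker_psh B C d) U)"
      and e: "\<And>U V. U \<in> \<U> \<Longrightarrow> V \<in> \<U> \<Longrightarrow>
          res (ker_psh B C d) U (U \<inter> V) (s U) = res (ker_psh B C d) V (U \<inter> V) (s V)"
    have o: "openin X (\<Union>\<U>)" using U by blast
    have "\<exists>!t. t \<in> carrier (sec B (\<Union>\<U>)) \<and> (\<forall>U\<in>\<U>. res B (\<Union>\<U>) U t = s U)"
      by (rule sheaf_glue[OF B]) (use U s e in \<open>auto simp: sec_ker_psh\<close>)
    then obtain t where t: "t \<in> carrier (sec B (\<Union>\<U>))" "\<And>U. U\<in>\<U> \<Longrightarrow> res B (\<Union>\<U>) U t = s U" by blast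
    have "d (\<Union>\<U>) t = \<one>\<^bsub>sec C (\<Union>\<U>)\<^esub>"
    proof (rule sheaf_sep[OF C, of \<U> "\<lambda>U. U"])
      show "d (\<Union>\<U>) t \<in> carrier (sec C (\<Union>\<U>))" by (rule sheaf_hom_closed[OF d o t(1)])
      show "\<one>\<^bsub>sec C (\<Union>\<U>)\<^esub> \<in> carrier (sec C (\<Union>\<U>))"
        using sh_group[OF C o] by (simp add: group.is_monoid)
      fix V assume V: "V \<in> \<U>"
      have "d V (res B (\<Union>\<U>) V t) = \<one>\<^bsub>sec C V\<^esub>" using t(2)[OF V] s[OF V] by (simp add: sec_ker_psh)
      then show "res C (\<Union>\<U>) V (d (\<Union>\<U>) t) = res C (\<Union>\<U>) V \<one>\<^bsub>sec C (\<Union>\<U>)\<^esub>"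
        using sheaf_hom_res[OF d o U[OF V] Union_upper[OF V] t(1)]
          res_one[OF pC o U[OF V] Union_upper[OF V]] by simp
    qed (use U in auto)
    then show "\<exists>t\<in>carrier (sec (ker_psh B C d) (\<Union> \<U>)). \<forall>U\<in>\<U>. res (ker_psh B C d) (\<Union> \<U>) U t = s U"
      using t by (intro bexI[of _ t]) (auto simp: sec_ker_psh)
  }
  {
    fix \<U> s t
    assume U: "\<And>U. U \<in> \<U> \<Longrightarrow> openin X U" and st: "s \<in> carrier (sec (ker_psh B C d) (\<Union>\<U>))"
      "t \<in> carrier (sec (ker_psh B C d) (\<Union>\<U>))"
      and r: "\<And>U. U \<in> \<U> \<Longrightarrow> res (ker_psh B C d) (\<Union>\<U>) U s = res (ker_psh B C d) (\<Union>\<U>) U t"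
    show "s = t"
      by (rule sheaf_sep[OF B, of \<U> "\<lambda>U. U"]) (use U st r in \<open>auto simp: sec_ker_psh\<close>)
  }
qed

text \<open>The product of two sheaves.\<close>

definition prod_psh :: "('x, 'u) psh \<Rightarrow> ('x, 'v) psh \<Rightarrow> ('x, 'u \<times> 'v) psh" where
  "prod_psh F G = \<lparr> sec = (\<lambda>U. sec F U \<times>\<times> sec G U), res = (\<lambda>U V (s, t). (res F U V s, res G U V t)) \<rparr>"

lemma sec_prod_psh [simp]:
  "sec (prod_psh F G) U = sec F U \<times>\<times> sec G U"
  "res (prod_psh F G) U V st = (res F U V (fst st), res G U V (snd st))"
  by (auto simp: prod_psh_def case_prod_unfold)

lemma comm_group_DirProd:
  assumes "comm_group G" "comm_group H"
  shows "comm_group (G \<times>\<times> H)"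
proof (rule group.group_comm_groupI)
  show "group (G \<times>\<times> H)" using assms by (simp add: DirProd_group comm_group_def)
qed (use assms in \<open>auto simp: comm_group_def intro: comm_monoid.m_comm\<close>)

lemma sheaf_prod_psh:
  assumes F: "sheaf X F" and G: "sheaf X G"
  shows "sheaf X (prod_psh F G)"
proof (rule sheafI)
  note pF = sheaf_presheaf[OF F] and pG = sheaf_presheaf[OF G]
  show "presheaf X (prod_psh F G)"
    unfolding presheaf_def
  proof (intro conjI allI impI ballI)
    fix U V assume UV: "openin X U \<and> openin X V \<and> V \<subseteq> U"
    then show "res (prod_psh F G) U V \<in> hom (sec (prod_psh F G) U) (sec (prod_psh F G) V)"
      by (intro homI) (auto simp: res_closed[OF pF] res_mult[OF pF] res_closed[OF pG] res_mult[OF pG])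
  qed (auto simp: comm_group_DirProd sh_comm_group[OF F] sh_comm_group[OF G] res_id[OF pF] res_res[OF pF] res_id[OF pG] res_res[OF pG])
  {
    fix \<U> s
    assume U: "\<And>U. U \<in> \<U> \<Longrightarrow> openin X U" and s: "\<And>U. U \<in> \<U> \<Longrightarrow> s U \<in> carrier (sec (prod_psh F G) U)"
      and e: "\<And>U V. U \<in> \<U> \<Longrightarrow> V \<in> \<U> \<Longrightarrow>
          res (prod_psh F G) U (U \<inter> V) (s U) = res (prod_psh F G) V (U \<inter> V) (s V)"
    have "\<exists>!t. t \<in> carrier (sec F (\<Union>\<U>)) \<and> (\<forall>U\<in>\<U>. res F (\<Union>\<U>) U t = fst (s U))"
      by (rule sheaf_glue[OF F]) (use U s e in \<open>auto simp: mem_Times_iff\<close>)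
    moreover have "\<exists>!t. t \<in> carrier (sec G (\<Union>\<U>)) \<and> (\<forall>U\<in>\<U>. res G (\<Union>\<U>) U t = snd (s U))"
      by (rule sheaf_glue[OF G]) (use U s e in \<open>auto simp: mem_Times_iff\<close>)
    ultimately obtain t1 t2 where "t1 \<in> carrier (sec F (\<Union>\<U>))" "\<forall>U\<in>\<U>. res F (\<Union>\<U>) U t1 = fst (s U)"
      "t2 \<in> carrier (sec G (\<Union>\<U>))" "\<forall>U\<in>\<U>. res G (\<Union>\<U>) U t2 = snd (s U)" by blast
    then show "\<exists>t\<in>carrier (sec (prod_psh F G) (\<Union> \<U>)). \<forall>U\<in>\<U>. res (prod_psh F G) (\<Union> \<U>) U t = s U"
      by (intro bexI[of _ "(t1, t2)"]) auto
  }
  {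
    fix \<U> s t
    assume U: "\<And>U. U \<in> \<U> \<Longrightarrow> openin X U" and st: "s \<in> carrier (sec (prod_psh F G) (\<Union>\<U>))"
      "t \<in> carrier (sec (prod_psh F G) (\<Union>\<U>))"
      and r: "\<And>U. U \<in> \<U> \<Longrightarrow> res (prod_psh F G) (\<Union>\<U>) U s = res (prod_psh F G) (\<Union>\<U>) U t"
    have "fst s = fst t"
      by (rule sheaf_sep[OF F, of \<U> "\<lambda>U. U"]) (use U st r in \<open>auto simp: mem_Times_iff\<close>)
    moreover have "snd s = snd t"
      by (rule sheaf_sep[OF G, of \<U> "\<lambda>U. U"]) (use U st r in \<open>auto simp: mem_Times_iff\<close>)
    ultimately show "s = t" by (rule prod_eqI)
  }
qed

text \<open>A sheaf whose sections are renamed along a map \<open>e\<close>, with \<open>e'\<close> inverse to \<open>e\<close> on the sections.\<close>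

definition trans_psh :: "('u \<Rightarrow> 'v) \<Rightarrow> ('v \<Rightarrow> 'u) \<Rightarrow> ('x, 'u) psh \<Rightarrow> ('x, 'v) psh" where
  "trans_psh e e' F = \<lparr>
     sec = (\<lambda>U. \<lparr> carrier = e ` carrier (sec F U), monoid.mult = (\<lambda>a b. e (e' a \<otimes>\<^bsub>sec F U\<^esub> e' b)),
                 one = e \<one>\<^bsub>sec F U\<^esub> \<rparr>),
     res = (\<lambda>U V a. e (res F U V (e' a))) \<rparr>"

lemma sec_trans_psh:
  "carrier (sec (trans_psh e e' F) U) = e ` carrier (sec F U)"
  "\<one>\<^bsub>sec (trans_psh e e' F) U\<^esub> = e \<one>\<^bsub>sec F U\<^esub>"
  "a \<otimes>\<^bsub>sec (trans_psh e e' F) U\<^esub> b = e (e' a \<otimes>\<^bsub>sec F U\<^esub> e' b)"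
  "res (trans_psh e e' F) U V a = e (res F U V (e' a))"
  by (simp_all add: trans_psh_def)

context
  fixes X :: "'x topology" and F :: "('x, 'u) psh" and e :: "'u \<Rightarrow> 'v" and e' :: "'v \<Rightarrow> 'u"
  assumes F: "sheaf X F" and inv: "\<And>U s. openin X U \<Longrightarrow> s \<in> carrier (sec F U) \<Longrightarrow> e' (e s) = s"
begin

private lemma pF: "presheaf X F" using F by (rule sheaf_presheaf)

private lemma monF: "openin X U \<Longrightarrow> monoid (sec F U)" using sh_group[OF F] by (simp add: group.is_monoid)

lemma comm_group_trans_psh:
  assumes U: "openin X U"
  shows "comm_group (sec (trans_psh e e' F) U)"
proof -
  interpret comm_group "sec F U" by (rule sh_comm_group[OF F U])
  show ?thesis
  proof (rule comm_groupI)
    fix a assume "a \<in> carrier (sec (trans_psh e e' F) U)"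
    then obtain s where "s \<in> carrier (sec F U)" "a = e s" by (auto simp: sec_trans_psh)
    then show "\<exists>b\<in>carrier (sec (trans_psh e e' F) U). b \<otimes>\<^bsub>sec (trans_psh e e' F) U\<^esub> a = \<one>\<^bsub>sec (trans_psh e e' F) U\<^esub>"
      by (intro bexI[of _ "e (inv\<^bsub>sec F U\<^esub> s)"]) (auto simp: sec_trans_psh inv[OF U])
  qed (auto simp: sec_trans_psh inv[OF U] m_ac)
qed

lemma sheaf_trans_psh: "sheaf X (trans_psh e e' F)"
proof (rule sheafI)
  show "presheaf X (trans_psh e e' F)"
    unfolding presheaf_def
  proof (intro conjI allI impI ballI)
    fix U V assume UV: "openin X U \<and> openin X V \<and> V \<subseteq> U"
    then show "res (trans_psh e e' F) U V \<in> hom (sec (trans_psh e e' F) U) (sec (trans_psh e e' F) V)"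
      by (intro homI) (auto simp: sec_trans_psh inv res_closed[OF pF] res_mult[OF pF] monF monoid.m_closed)
  qed (auto simp: sec_trans_psh comm_group_trans_psh inv res_id[OF pF] res_res[OF pF] res_closed[OF pF])
  {
    fix \<U> s
    assume U: "\<And>U. U \<in> \<U> \<Longrightarrow> openin X U" and s: "\<And>U. U \<in> \<U> \<Longrightarrow> s U \<in> carrier (sec (trans_psh e e' F) U)"
      and eq: "\<And>U V. U \<in> \<U> \<Longrightarrow> V \<in> \<U> \<Longrightarrow>
          res (trans_psh e e' F) U (U \<inter> V) (s U) = res (trans_psh e e' F) V (U \<inter> V) (s V)"
    have o: "openin X (\<Union>\<U>)" using U by blast
    have s': "e' (s V) \<in> carrier (sec F V)" "e (e' (s V)) = s V" if "V \<in> \<U>" for V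
      using s[OF that] U[OF that] by (auto simp: sec_trans_psh inv)
    have "\<exists>!t. t \<in> carrier (sec F (\<Union>\<U>)) \<and> (\<forall>U\<in>\<U>. res F (\<Union>\<U>) U t = e' (s U))"
    proof (rule sheaf_glue[OF F])
      fix V W assume VW: "V \<in> \<U>" "W \<in> \<U>"
      then have o': "openin X (V \<inter> W)" using U by blast
      have "e' (e (res F V (V \<inter> W) (e' (s V)))) = e' (e (res F W (V \<inter> W) (e' (s W))))"
        using eq[OF VW] by (simp add: sec_trans_psh)
      then show "res F V (V \<inter> W) (e' (s V)) = res F W (V \<inter> W) (e' (s W))"
        using s' VW U o' by (simp add: inv[OF o'] res_closed[OF pF])
    qed (use U s' in auto)
    then obtain t where "t \<in> carrier (sec F (\<Union>\<U>))" "\<forall>U\<in>\<U>. res F (\<Union>\<U>) U t = e' (s U)" by blast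
    then show "\<exists>t\<in>carrier (sec (trans_psh e e' F) (\<Union> \<U>)). \<forall>U\<in>\<U>. res (trans_psh e e' F) (\<Union> \<U>) U t = s U"
      by (intro bexI[of _ "e t"]) (auto simp: sec_trans_psh inv[OF o] s')
  }
  {
    fix \<U> a b
    assume U: "\<And>U. U \<in> \<U> \<Longrightarrow> openin X U" and ab: "a \<in> carrier (sec (trans_psh e e' F) (\<Union>\<U>))"
      "b \<in> carrier (sec (trans_psh e e' F) (\<Union>\<U>))"
      and r: "\<And>U. U \<in> \<U> \<Longrightarrow> res (trans_psh e e' F) (\<Union>\<U>) U a = res (trans_psh e e' F) (\<Union>\<U>) U b"
    have o: "openin X (\<Union>\<U>)" using U by blast
    obtain s t where st: "s \<in> carrier (sec F (\<Union>\<U>))" "a = e s" "t \<in> carrier (sec F (\<Union>\<U>))" "b = e t"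
      using ab by (auto simp: sec_trans_psh)
    have "s = t"
    proof (rule sheaf_sep[OF F, of \<U> "\<lambda>U. U"])
      fix V assume V: "V \<in> \<U>"
      have "e' (e (res F (\<Union>\<U>) V s)) = e' (e (res F (\<Union>\<U>) V t))"
        using r[OF V] st by (simp add: sec_trans_psh inv[OF o])
      then show "res F (\<Union>\<U>) V s = res F (\<Union>\<U>) V t"
        using st o U[OF V] V by (subst (asm) (1 2) inv[OF U[OF V]]) (auto intro!: res_closed[OF pF])
    qed (use U st in auto)
    then show "a = b" using st by simp
  }
qed

lemma sheaf_hom_to_trans: "sheaf_hom X F (trans_psh e e' F) (\<lambda>U. e)"
  by (intro sheaf_homI homI) (auto simp: sec_trans_psh inv)

lemma sheaf_hom_from_trans: "sheaf_hom X (trans_psh e e' F) F (\<lambda>U. e')"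
  by (intro sheaf_homI homI) (auto simp: sec_trans_psh inv res_closed[OF pF] monF monoid.m_closed)

end

text \<open>Every countable set can be renamed into an infinite type.\<close>

lemma countable_code:
  assumes "countable T"
  shows "\<exists>(e :: 'a \<Rightarrow> 'u::infinite) e'. \<forall>s\<in>T. e' (e s) = s"
proof -
  obtain f :: "nat \<Rightarrow> 'u" where "inj f"
    using infinite_countable_subset[OF infinite_UNIV] by auto
  then show ?thesis using assms
    by (intro exI[of _ "\<lambda>s. f (to_nat_on T s)"] exI[of _ "\<lambda>u. from_nat_into T (inv_into UNIV f u)"]) auto
qed

text \<open>The extension property of injective sheaves holds for all test sheaves with countably many
  sections, whatever the type of these.\<close>

lemma injective_extend:
  fixes I :: "('x, 'u::infinite) psh" and A B :: "('x, 'a) psh"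
  assumes fs: "finite_space X" and I: "injective_sheaf X I" and A: "sheaf X A" and B: "sheaf X B"
    and AB: "sheaf_hom X A B (\<lambda>U s. s)"
    and T: "countable T" "\<And>U. openin X U \<Longrightarrow> carrier (sec B U) \<subseteq> T"
    and h: "\<And>x. x \<in> topspace X \<Longrightarrow> h x \<in> hom (sec A (nb X x)) (sec I (nb X x))"
    and nat: "\<And>x y s. x \<in> topspace X \<Longrightarrow> y \<in> nb X x \<Longrightarrow> s \<in> carrier (sec A (nb X x)) \<Longrightarrow>
          h y (res A (nb X x) (nb X y) s) = res I (nb X x) (nb X y) (h x s)"
  shows "\<exists>g. sheaf_hom X B I g \<and> (\<forall>x\<in>topspace X. \<forall>s\<in>carrier (sec A (nb X x)). g (nb X x) s = h x s)"
proof -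
  have shI: "sheaf X I" using I by (simp add: injective_sheaf_def)
  obtain f where f: "sheaf_hom X A I f" "\<And>x s. x\<in>topspace X \<Longrightarrow> s\<in>carrier (sec A (nb X x)) \<Longrightarrow> f (nb X x) s = h x s"
    using hom_from_stalks[where h = h, OF fs sheaf_presheaf[OF A] shI h nat] by blast
  obtain e :: "'a \<Rightarrow> 'u" and e' where ee: "\<And>s. s \<in> T \<Longrightarrow> e' (e s) = s"
    using countable_code[OF T(1)] by blast
  have invB: "e' (e s) = s" if "openin X U" "s \<in> carrier (sec B U)" for U s using ee T(2) that by blast
  have invA: "e' (e s) = s" if "openin X U" "s \<in> carrier (sec A U)" for U s
    using invB that sheaf_hom_closed[OF AB] by blast
  let ?A = "trans_psh e e' A" and ?B = "trans_psh e e' B"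
  have 1: "sheaf_hom X ?A ?B (\<lambda>U s. e (e' s))"
    by (rule sheaf_hom_comp[OF sheaf_hom_comp[OF sheaf_hom_from_trans[where e = e and e' = e', OF A invA] AB] sheaf_hom_to_trans[where e = e and e' = e', OF B invB]])
  have 2: "sheaf_hom X ?A I (\<lambda>U s. f U (e' s))"
    by (rule sheaf_hom_comp[OF sheaf_hom_from_trans[where e = e and e' = e', OF A invA] f(1)])
  have 3: "sheaf_mono X ?A ?B (\<lambda>U s. e (e' s))"
    unfolding sheaf_mono_def using 1 by (auto simp: inj_on_def sec_trans_psh invA)
  have "\<exists>g. sheaf_hom X ?B I g \<and>
        (\<forall>U. openin X U \<longrightarrow> (\<forall>s \<in> carrier (sec ?A U). g U (e (e' s)) = f U (e' s)))"
    using I sheaf_trans_psh[where e = e and e' = e', OF A invA] sheaf_trans_psh[where e = e and e' = e', OF B invB] 2 3 unfolding injective_sheaf_def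
    by (elim conjE allE[of _ ?A] allE[of _ ?B] allE[of _ "\<lambda>U s. e (e' s)"] allE[of _ "\<lambda>U s. f U (e' s)"]) simp
  then obtain g where g: "sheaf_hom X ?B I g"
    "\<And>U s. openin X U \<Longrightarrow> s \<in> carrier (sec ?A U) \<Longrightarrow> g U (e (e' s)) = f U (e' s)" by blast
  have "sheaf_hom X B I (\<lambda>U s. g U (e s))"
    by (rule sheaf_hom_comp[OF sheaf_hom_to_trans[where e = e and e' = e', OF B invB] g(1)])
  moreover have "g (nb X x) (e s) = h x s" if "x \<in> topspace X" "s\<in>carrier (sec A (nb X x))" for x s
    using g(2)[OF openin_nb[OF fs that(1)], of "e s"] that f(2) invA openin_nb[OF fs that(1)]
    by (simp add: sec_trans_psh)
  ultimately show ?thesis by blast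
qed

section \<open>Divisible groups\<close>

lemma fst_hom_DirProd: "fst \<in> hom (G \<times>\<times> H) G" and snd_hom_DirProd: "snd \<in> hom (G \<times>\<times> H) H"
  by (auto simp: hom_def)

lemma int_pow_DirProd:
  assumes "group G" "group H" "x \<in> carrier G" "y \<in> carrier H"
  shows "(x, y) [^]\<^bsub>G \<times>\<times> H\<^esub> (k::int) = (x [^]\<^bsub>G\<^esub> k, y [^]\<^bsub>H\<^esub> k)"
proof (rule prod_eqI)
  have g: "group (G \<times>\<times> H)" using assms by (simp add: DirProd_group)
  have xy: "(x, y) \<in> carrier (G \<times>\<times> H)" using assms by simp
  show "fst ((x, y) [^]\<^bsub>G \<times>\<times> H\<^esub> k) = fst (x [^]\<^bsub>G\<^esub> k, y [^]\<^bsub>H\<^esub> k)"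
    using hom_int_pow[OF fst_hom_DirProd xy g assms(1)] by simp
  show "snd ((x, y) [^]\<^bsub>G \<times>\<times> H\<^esub> k) = snd (x [^]\<^bsub>G\<^esub> k, y [^]\<^bsub>H\<^esub> k)"
    using hom_int_pow[OF snd_hom_DirProd xy g assms(2)] by simp
qed

text \<open>The step of Baer's argument: a partial homomorphism \<open>M\<close> into a divisible group, given by its
  graph, prescribes a compatible image \<open>z\<close> for every element \<open>b\<close>.\<close>

lemma divisible_extend_step:
  fixes D :: "'d monoid"
  assumes B: "comm_group B" and D: "comm_group D"
    and div: "\<And>n y. n > 0 \<Longrightarrow> y \<in> carrier D \<Longrightarrow> \<exists>z\<in>carrier D. z [^]\<^bsub>D\<^esub> (n::nat) = y"
    and M: "subgroup M (B \<times>\<times> D)" and fun_M: "\<And>y. (\<one>\<^bsub>B\<^esub>, y) \<in> M \<Longrightarrow> y = \<one>\<^bsub>D\<^esub>"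
    and b: "b \<in> carrier B"
  shows "\<exists>z\<in>carrier D. \<forall>k::int. \<forall>y. (b [^]\<^bsub>B\<^esub> k, y) \<in> M \<longrightarrow> y = z [^]\<^bsub>D\<^esub> k"
proof -
  interpret B: comm_group B by fact
  interpret D: comm_group D by fact
  interpret P: comm_group "B \<times>\<times> D" by (rule comm_group_DirProd[OF B D])
  interpret M: subgroup M "B \<times>\<times> D" by fact
  have carD: "y \<in> carrier D" if "(a, y) \<in> M" for a y using M.mem_carrier[OF that] by simp
  have invM: "(inv\<^bsub>B\<^esub> a, inv\<^bsub>D\<^esub> y) \<in> M" if "(a, y) \<in> M" for a y
    using M.m_inv_closed[OF that] M.mem_carrier[OF that] B.is_group D.is_group by simp
  have mulM: "(a \<otimes>\<^bsub>B\<^esub> a', y \<otimes>\<^bsub>D\<^esub> y') \<in> M" if "(a, y) \<in> M" "(a', y') \<in> M" for a y a' y'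
    using M.m_closed[OF that] by simp
  have powM: "(a [^]\<^bsub>B\<^esub> k, y [^]\<^bsub>D\<^esub> k) \<in> M" if "(a, y) \<in> M" for a y and k :: int
  proof -
    have "(a, y) [^]\<^bsub>B \<times>\<times> D\<^esub> k \<in> M" by (rule P.subgroup_int_pow_closed[OF M that])
    then show ?thesis
      using M.mem_carrier[OF that] int_pow_DirProd[OF B.is_group D.is_group] by simp
  qed
  \<comment> \<open>the positive exponents \<open>n\<close> for which \<open>b\<^sup>n\<close> is in the domain; these are the multiples of the least
    one, so an \<open>n\<close>-th root of the prescribed value is compatible with all of them\<close>
  define J where "J = {n::nat. n > 0 \<and> (\<exists>y. (b [^]\<^bsub>B\<^esub> int n, y) \<in> M)}"
  have J: "nat \<bar>k\<bar> \<in> J" if "(b [^]\<^bsub>B\<^esub> k, y) \<in> M" "k \<noteq> 0" for k y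
  proof (cases "k > 0")
    case True
    then show ?thesis using that by (auto simp: J_def)
  next
    case False
    then have "(b [^]\<^bsub>B\<^esub> (- k), inv\<^bsub>D\<^esub> y) \<in> M" using invM[OF that(1)] b by (simp add: B.int_pow_neg)
    then show ?thesis using False that by (auto simp: J_def)
  qed
  show ?thesis
  proof (cases "J = {}")
    case True
    have "y = \<one>\<^bsub>D\<^esub> [^]\<^bsub>D\<^esub> k" if "(b [^]\<^bsub>B\<^esub> k, y) \<in> M" for k :: int and y
    proof -
      have "k = 0" using J[OF that] True by auto
      then show ?thesis using that fun_M by simp
    qed
    then show ?thesis by blast
  next
    case False
    define n where "n = (LEAST n. n \<in> J)"
    have n: "n \<in> J" using False unfolding n_def by (metis LeastI ex_in_conv)
    have least: "n \<le> m" if "m \<in> J" for m using that unfolding n_def by (rule Least_le)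
    obtain y0 where n0: "n > 0" and y0: "(b [^]\<^bsub>B\<^esub> int n, y0) \<in> M" using n by (auto simp: J_def)
    obtain z where z: "z \<in> carrier D" "z [^]\<^bsub>D\<^esub> n = y0" using div[OF n0 carD[OF y0]] by blast
    have "y = z [^]\<^bsub>D\<^esub> k" if ky: "(b [^]\<^bsub>B\<^esub> k, y) \<in> M" for k :: int and y
    proof -
      let ?q = "k div int n" and ?r = "k mod int n"
      have k: "k = int n * ?q + ?r" by simp
      have q: "(b [^]\<^bsub>B\<^esub> (int n * ?q), z [^]\<^bsub>D\<^esub> (int n * ?q)) \<in> M"
        using powM[OF y0, of ?q] B.int_pow_pow[OF b, of "int n" ?q] D.int_pow_pow[OF z(1), of "int n" ?q] z(2)
        by (simp add: int_pow_int)
      have "b [^]\<^bsub>B\<^esub> ?r = b [^]\<^bsub>B\<^esub> (k - int n * ?q)" by (simp add: minus_mult_div_eq_mod)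
      also have "\<dots> = b [^]\<^bsub>B\<^esub> k \<otimes>\<^bsub>B\<^esub> inv\<^bsub>B\<^esub> (b [^]\<^bsub>B\<^esub> (int n * ?q))"
        using b by (rule B.int_pow_diff)
      finally have r: "(b [^]\<^bsub>B\<^esub> ?r, y \<otimes>\<^bsub>D\<^esub> inv\<^bsub>D\<^esub> (z [^]\<^bsub>D\<^esub> (int n * ?q))) \<in> M"
        using mulM[OF ky invM[OF q]] by simp
      have "?r = 0"
      proof (rule ccontr)
        assume "?r \<noteq> 0"
        then have "n \<le> nat \<bar>?r\<bar>" using least J[OF r] by blast
        moreover have "0 \<le> ?r" "?r < int n" using n0 by auto
        ultimately show False by linarith
      qed
      then have "y \<otimes>\<^bsub>D\<^esub> inv\<^bsub>D\<^esub> (z [^]\<^bsub>D\<^esub> (int n * ?q)) = \<one>\<^bsub>D\<^esub>" and kq: "k = int n * ?q"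
        using r fun_M k by auto
      then have "y = z [^]\<^bsub>D\<^esub> (int n * ?q)"
        using carD[OF ky] z(1) by (metis D.int_pow_closed D.inv_closed D.inv_equality D.inv_inv)
      then show ?thesis using kq by simp
    qed
    then show ?thesis using z(1) by blast
  qed
qed

text \<open>Homomorphisms into a divisible abelian group extend along injections of abelian groups.\<close>

lemma divisible_extend:
  fixes D :: "'d monoid"
  assumes B: "comm_group B" and D: "comm_group D"
    and div: "\<And>n y. n > 0 \<Longrightarrow> y \<in> carrier D \<Longrightarrow> \<exists>z\<in>carrier D. z [^]\<^bsub>D\<^esub> (n::nat) = y"
    and A: "group A" and i: "i \<in> hom A B" "inj_on i (carrier A)" and f: "f \<in> hom A D"
  shows "\<exists>g\<in>hom B D. \<forall>a\<in>carrier A. g (i a) = f a"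
proof -
  interpret B: comm_group B by fact
  interpret D: comm_group D by fact
  let ?P = "B \<times>\<times> D"
  interpret P: comm_group ?P by (rule comm_group_DirProd[OF B D])
  have gi: "group_hom A B i" "group_hom A D f"
    using A i f B.is_group D.is_group by (simp_all add: group_hom_def group_hom_axioms_def)
  \<comment> \<open>Zorn's lemma for the partial homomorphisms extending \<open>f\<close>, represented by their graphs: subgroups of
    the product in which only \<open>1\<close> lies over \<open>1\<close>\<close>
  define G0 where "G0 = (\<lambda>a. (i a, f a)) ` carrier A"
  define \<A> where "\<A> = {M. subgroup M ?P \<and> G0 \<subseteq> M \<and> (\<forall>y. (\<one>\<^bsub>B\<^esub>, y) \<in> M \<longrightarrow> y = \<one>\<^bsub>D\<^esub>)}"
  have "group_hom A ?P (\<lambda>a. (i a, f a))"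
    using A P.is_group i f by (auto simp: group_hom_def group_hom_axioms_def hom_def Pi_iff)
  then have "subgroup G0 ?P" unfolding G0_def by (rule group_hom.img_is_subgroup)
  moreover have "y = \<one>\<^bsub>D\<^esub>" if y: "(\<one>\<^bsub>B\<^esub>, y) \<in> G0" for y
  proof -
    obtain a where "a \<in> carrier A" "(\<one>\<^bsub>B\<^esub>, y) = (i a, f a)" using y unfolding G0_def by (rule imageE)
    then have a: "a \<in> carrier A" "i a = \<one>\<^bsub>B\<^esub>" "y = f a" by auto
    then have "a = \<one>\<^bsub>A\<^esub>"
      using i(2) gi(1) A by (metis group.is_monoid group_hom.hom_one inj_onD monoid.one_closed)
    then show ?thesis using a gi(2) by (simp add: group_hom.hom_one)
  qed
  ultimately have "G0 \<in> \<A>" by (simp add: \<A>_def)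
  have "\<exists>M\<in>\<A>. \<forall>N\<in>\<A>. M \<subseteq> N \<longrightarrow> N = M"
  proof (rule subset_Zorn_nonempty)
    show "\<A> \<noteq> {}" using \<open>G0 \<in> \<A>\<close> by blast
    fix \<C> assume C: "\<C> \<noteq> {}" "subset.chain \<A> \<C>"
    then have CA: "\<C> \<subseteq> \<A>" and tot: "\<And>M N. M \<in> \<C> \<Longrightarrow> N \<in> \<C> \<Longrightarrow> M \<subseteq> N \<or> N \<subseteq> M"
      by (auto simp: subset_chain_def)
    have sub: "subgroup M ?P" if "M \<in> \<C>" for M using CA that by (auto simp: \<A>_def)
    have "subgroup (\<Union>\<C>) ?P"
    proof (rule P.subgroupI)
      show "\<Union>\<C> \<subseteq> carrier ?P" using sub subgroup.subset by blast
      show "\<Union>\<C> \<noteq> {}" using C(1) sub subgroup.one_closed by blast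
      show "inv\<^bsub>?P\<^esub> a \<in> \<Union>\<C>" if a: "a \<in> \<Union>\<C>" for a
      proof -
        obtain M where M: "M \<in> \<C>" "a \<in> M" using a by blast
        then show ?thesis using subgroup.m_inv_closed[OF sub[OF M(1)] M(2)] by blast
      qed
      show "a \<otimes>\<^bsub>?P\<^esub> b \<in> \<Union>\<C>" if ab: "a \<in> \<Union>\<C>" "b \<in> \<Union>\<C>" for a b
      proof -
        obtain M N where MN: "M \<in> \<C>" "a \<in> M" "N \<in> \<C>" "b \<in> N" using ab by blast
        then have "a \<otimes>\<^bsub>?P\<^esub> b \<in> M \<or> a \<otimes>\<^bsub>?P\<^esub> b \<in> N"
          using tot[OF MN(1,3)] subgroup.m_closed[OF sub[OF MN(1)]] subgroup.m_closed[OF sub[OF MN(3)]]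
          by (meson subsetD)
        then show ?thesis using MN by blast
      qed
    qed
    then show "\<Union>\<C> \<in> \<A>" using CA C(1) by (fastforce simp: \<A>_def)
  qed
  then obtain M where "M \<in> \<A>" and max: "\<And>N. N \<in> \<A> \<Longrightarrow> M \<subseteq> N \<Longrightarrow> N = M" by blast
  then have M: "subgroup M ?P" and G0M: "G0 \<subseteq> M" and fun_M: "\<And>y. (\<one>\<^bsub>B\<^esub>, y) \<in> M \<Longrightarrow> y = \<one>\<^bsub>D\<^esub>"
    by (auto simp: \<A>_def)
  interpret M: subgroup M ?P by fact
  have total: "\<exists>y. (b, y) \<in> M" if b: "b \<in> carrier B" for b
  proof -
    obtain z where z: "z \<in> carrier D" "\<And>(k::int) y. (b [^]\<^bsub>B\<^esub> k, y) \<in> M \<Longrightarrow> y = z [^]\<^bsub>D\<^esub> k"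
      using divisible_extend_step[OF B D div M fun_M b] by blast
    define K where "K = range (\<lambda>k::int. (b [^]\<^bsub>B\<^esub> k, z [^]\<^bsub>D\<^esub> k))"
    have "subgroup K ?P"
    proof (rule P.subgroupI)
      show "inv\<^bsub>?P\<^esub> a \<in> K" if a: "a \<in> K" for a
      proof -
        obtain k :: int where "a = (b [^]\<^bsub>B\<^esub> k, z [^]\<^bsub>D\<^esub> k)" using a by (auto simp: K_def)
        then have "inv\<^bsub>?P\<^esub> a = (b [^]\<^bsub>B\<^esub> (- k), z [^]\<^bsub>D\<^esub> (- k))"
          using b z B.is_group D.is_group by (simp add: B.int_pow_neg D.int_pow_neg)
        then show ?thesis by (auto simp: K_def)
      qed
      show "a \<otimes>\<^bsub>?P\<^esub> c \<in> K" if ac: "a \<in> K" "c \<in> K" for a c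
      proof -
        obtain k l :: int where "a = (b [^]\<^bsub>B\<^esub> k, z [^]\<^bsub>D\<^esub> k)" "c = (b [^]\<^bsub>B\<^esub> l, z [^]\<^bsub>D\<^esub> l)"
          using ac by (auto simp: K_def)
        then have "a \<otimes>\<^bsub>?P\<^esub> c = (b [^]\<^bsub>B\<^esub> (k + l), z [^]\<^bsub>D\<^esub> (k + l))"
          using b z by (simp add: B.int_pow_mult D.int_pow_mult)
        then show ?thesis by (auto simp: K_def)
      qed
    qed (use b z in \<open>auto simp: K_def\<close>)
    have oneK: "\<one>\<^bsub>?P\<^esub> \<in> K" and bzK: "(b, z) \<in> K"
      using \<open>subgroup K ?P\<close> subgroup.one_closed b z by (blast, auto simp: K_def intro: range_eqI[of _ _ 1])
    let ?N = "M <#>\<^bsub>?P\<^esub> K"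
    have N: "subgroup ?N ?P" by (rule P.mult_subgroups[OF M \<open>subgroup K ?P\<close>])
    have "m \<in> ?N" if "m \<in> M" for m
      unfolding set_mult_def using that oneK M.mem_carrier[OF that] P.r_one[OF M.mem_carrier[OF that]] by force
    then have MN: "M \<subseteq> ?N" by blast
    have "(b, z) \<in> ?N"
      unfolding set_mult_def using bzK M.one_closed b z P.l_one[of "(b, z)"] by force
    have "y = \<one>\<^bsub>D\<^esub>" if y: "(\<one>\<^bsub>B\<^esub>, y) \<in> ?N" for y
    proof -
      obtain a c and k :: int where ac: "(a, c) \<in> M"
        and eq: "\<one>\<^bsub>B\<^esub> = a \<otimes>\<^bsub>B\<^esub> b [^]\<^bsub>B\<^esub> k" "y = c \<otimes>\<^bsub>D\<^esub> z [^]\<^bsub>D\<^esub> k"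
        using y by (auto simp: set_mult_def K_def)
      have car: "a \<in> carrier B" "c \<in> carrier D" using M.mem_carrier[OF ac] by auto
      have "a = b [^]\<^bsub>B\<^esub> (- k)"
        using eq(1) car b by (simp add: B.int_pow_neg B.inv_equality[symmetric])
      then have "c = z [^]\<^bsub>D\<^esub> (- k)" using z(2) ac by blast
      then show ?thesis using eq(2) z(1) by (simp add: D.int_pow_neg)
    qed
    then have "?N \<in> \<A>" using N MN G0M by (auto simp: \<A>_def)
    then have "?N = M" using max MN by blast
    then show ?thesis using \<open>(b, z) \<in> ?N\<close> by auto
  qed
  have uniq: "y = y'" if "(b, y) \<in> M" "(b, y') \<in> M" for b y y'
  proof -
    have car: "b \<in> carrier B" "y \<in> carrier D" "y' \<in> carrier D"
      using M.mem_carrier[OF that(1)] M.mem_carrier[OF that(2)] by auto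
    have "(\<one>\<^bsub>B\<^esub>, y \<otimes>\<^bsub>D\<^esub> inv\<^bsub>D\<^esub> y') \<in> M"
      using M.m_closed[OF that(1) M.m_inv_closed[OF that(2)]] car B.is_group D.is_group by simp
    then have "y \<otimes>\<^bsub>D\<^esub> inv\<^bsub>D\<^esub> y' = \<one>\<^bsub>D\<^esub>" by (rule fun_M)
    then show ?thesis using car by (metis D.inv_closed D.inv_equality D.inv_inv)
  qed
  define g where "g b = (THE y. (b, y) \<in> M)" for b
  have gM: "(b, g b) \<in> M" if "b \<in> carrier B" for b
    unfolding g_def using total[OF that] uniq by (metis theI)
  have g_eq: "g b = y" if "(b, y) \<in> M" for b y
    using that uniq gM M.mem_carrier[OF that] by auto
  show ?thesis
  proof (intro bexI[of _ g] ballI homI)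
    show "g (i a) = f a" if "a \<in> carrier A" for a
      using that G0M by (intro g_eq) (auto simp: G0_def)
    show "g b \<in> carrier D" if "b \<in> carrier B" for b using M.mem_carrier[OF gM[OF that]] by simp
    show "g (b \<otimes>\<^bsub>B\<^esub> c) = g b \<otimes>\<^bsub>D\<^esub> g c" if "b \<in> carrier B" "c \<in> carrier B" for b c
      using M.m_closed[OF gM[OF that(1)] gM[OF that(2)]] by (intro g_eq) simp
  qed
qed

section \<open>Products of skyscraper sheaves\<close>

text \<open>For an index set \<open>T\<close> and base points \<open>b\<close>, the sections over \<open>U\<close> are the functions supported on
  the indices with base point in \<open>U\<close>. This is the product over \<open>T\<close> of skyscraper sheaves.\<close>

definition sky :: "'t set \<Rightarrow> ('t \<Rightarrow> 'x) \<Rightarrow> ('x, 't \<Rightarrow> 'a::ab_group_add) psh" where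
  "sky T b = \<lparr>
     sec = (\<lambda>U. \<lparr> carrier = {f. \<forall>c. f c \<noteq> 0 \<longrightarrow> c \<in> T \<and> b c \<in> U},
                 monoid.mult = (\<lambda>f g c. f c + g c), one = (\<lambda>c. 0) \<rparr>),
     res = (\<lambda>U V f c. if b c \<in> V then f c else 0) \<rparr>"

lemma carrier_sky: "f \<in> carrier (sec (sky T b) U) \<longleftrightarrow> (\<forall>c. f c \<noteq> 0 \<longrightarrow> c \<in> T \<and> b c \<in> U)"
  and mult_sky [simp]: "f \<otimes>\<^bsub>sec (sky T b) U\<^esub> g = (\<lambda>c. f c + g c)"
  and one_sky [simp]: "\<one>\<^bsub>sec (sky T b) U\<^esub> = (\<lambda>c. 0)"
  and res_sky [simp]: "res (sky T b) U V f = (\<lambda>c. if b c \<in> V then f c else 0)"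
  by (simp_all add: sky_def)

lemma comm_group_sky:
  fixes T :: "'t set" and b :: "'t \<Rightarrow> 'x"
  shows "comm_group (sec (sky T b :: ('x, 't \<Rightarrow> 'a::ab_group_add) psh) U)"
proof (rule comm_groupI)
  fix f :: "'t \<Rightarrow> 'a" assume "f \<in> carrier (sec (sky T b) U)"
  then show "\<exists>g\<in>carrier (sec (sky T b) U). g \<otimes>\<^bsub>sec (sky T b) U\<^esub> f = \<one>\<^bsub>sec (sky T b) U\<^esub>"
    by (intro bexI[of _ "\<lambda>c. - f c"]) (auto simp: carrier_sky)
next
  fix f g :: "'t \<Rightarrow> 'a" assume "f \<in> carrier (sec (sky T b) U)" "g \<in> carrier (sec (sky T b) U)"
  then show "f \<otimes>\<^bsub>sec (sky T b) U\<^esub> g \<in> carrier (sec (sky T b) U)"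
    by (simp add: carrier_sky) (metis add_0)
qed (auto simp: carrier_sky add_ac)

lemma inv_sky:
  assumes "f \<in> carrier (sec (sky T b) U)"
  shows "inv\<^bsub>sec (sky T b) U\<^esub> f = (\<lambda>c. - f c)"
proof -
  interpret comm_group "sec (sky T b) U" by (rule comm_group_sky)
  show ?thesis by (rule inv_equality) (use assms in \<open>auto simp: carrier_sky\<close>)
qed

lemma sheaf_sky:
  fixes T :: "'t set" and b :: "'t \<Rightarrow> 'x"
  shows "sheaf X (sky T b :: ('x, 't \<Rightarrow> 'a::ab_group_add) psh)"
proof (rule sheafI)
  show "presheaf X (sky T b)"
    unfolding presheaf_def by (auto simp: comm_group_sky carrier_sky hom_def fun_eq_iff)
next
  fix \<U> and s :: "'x set \<Rightarrow> 't \<Rightarrow> 'a"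
  assume s: "\<And>U. U \<in> \<U> \<Longrightarrow> s U \<in> carrier (sec (sky T b) U)"
    and e: "\<And>U V. U \<in> \<U> \<Longrightarrow> V \<in> \<U> \<Longrightarrow>
      res (sky T b) U (U \<inter> V) (s U) = res (sky T b) V (U \<inter> V) (s V)"
  define t where "t c = (if \<exists>U\<in>\<U>. b c \<in> U then s (SOME U. U \<in> \<U> \<and> b c \<in> U) c else 0)" for c
  have t: "t c = s U c" if U: "U \<in> \<U>" "b c \<in> U" for U c
  proof -
    define V where "V = (SOME U. U \<in> \<U> \<and> b c \<in> U)"
    have V: "V \<in> \<U>" "b c \<in> V" unfolding V_def using someI[of "\<lambda>U. U \<in> \<U> \<and> b c \<in> U" U] U by auto
    have "t c = s V c" using U by (auto simp: t_def V_def)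
    also have "\<dots> = s U c" using fun_cong[OF e[OF V(1) U(1)], of c] U V by simp
    finally show ?thesis .
  qed
  have "t \<in> carrier (sec (sky T b) (\<Union>\<U>))"
    unfolding carrier_sky
  proof (intro allI impI)
    fix c assume nz: "t c \<noteq> 0"
    then obtain U where U: "U \<in> \<U>" "b c \<in> U" by (auto simp: t_def split: if_splits)
    then show "c \<in> T \<and> b c \<in> \<Union>\<U>" using nz t[OF U] s[OF U(1)] by (auto simp: carrier_sky)
  qed
  moreover have "res (sky T b) (\<Union>\<U>) U t = s U" if "U \<in> \<U>" for U
    using t[OF that] s[OF that] by (fastforce simp: fun_eq_iff carrier_sky)
  ultimately show "\<exists>t\<in>carrier (sec (sky T b) (\<Union>\<U>)). \<forall>U\<in>\<U>. res (sky T b) (\<Union>\<U>) U t = s U"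
    by blast
next
  fix \<U> and s t :: "'t \<Rightarrow> 'a"
  assume st: "s \<in> carrier (sec (sky T b) (\<Union>\<U>))" "t \<in> carrier (sec (sky T b) (\<Union>\<U>))"
    and r: "\<And>U. U \<in> \<U> \<Longrightarrow> res (sky T b) (\<Union>\<U>) U s = res (sky T b) (\<Union>\<U>) U t"
  show "s = t"
  proof
    fix c show "s c = t c"
    proof (cases "\<exists>U\<in>\<U>. b c \<in> U")
      case True
      then obtain U where "U \<in> \<U>" "b c \<in> U" by blast
      then show ?thesis using fun_cong[OF r[of U], of c] by simp
    next
      case False
      then show ?thesis using st unfolding carrier_sky by (metis UnionE)
    qed
  qed
qed

text \<open>Flabbiness: sections over a smaller open set extend.\<close>

definition flabby :: "'x topology \<Rightarrow> ('x, 'u) psh \<Rightarrow> bool" where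
  "flabby X F \<longleftrightarrow> (\<forall>U V. openin X U \<and> openin X V \<and> V \<subseteq> U \<longrightarrow>
     (\<forall>s\<in>carrier (sec F V). \<exists>t\<in>carrier (sec F U). res F U V t = s))"

lemma flabby_sky: "flabby X (sky T b)"
  unfolding flabby_def
proof (intro allI impI ballI)
  fix U V s assume "openin X U \<and> openin X V \<and> V \<subseteq> U" "s \<in> carrier (sec (sky T b) V)"
  then show "\<exists>t\<in>carrier (sec (sky T b) U). res (sky T b) U V t = s"
    by (intro bexI[of _ s]) (auto simp: carrier_sky fun_eq_iff)
qed

lemma flabby_prod_psh: "flabby X F \<Longrightarrow> flabby X G \<Longrightarrow> flabby X (prod_psh F G)"
  unfolding flabby_def
proof (intro allI impI ballI)
  fix U V st
  assume F: "\<forall>U V. openin X U \<and> openin X V \<and> V \<subseteq> U \<longrightarrow> (\<forall>s\<in>carrier (sec F V). \<exists>t\<in>carrier (sec F U). res F U V t = s)"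
    and G: "\<forall>U V. openin X U \<and> openin X V \<and> V \<subseteq> U \<longrightarrow> (\<forall>s\<in>carrier (sec G V). \<exists>t\<in>carrier (sec G U). res G U V t = s)"
    and UV: "openin X U \<and> openin X V \<and> V \<subseteq> U" and st: "st \<in> carrier (sec (prod_psh F G) V)"
  obtain t1 where "t1\<in>carrier (sec F U)" "res F U V t1 = fst st" using F[rule_format, OF UV, of "fst st"] st by (auto simp: mem_Times_iff)
  moreover obtain t2 where "t2\<in>carrier (sec G U)" "res G U V t2 = snd st" using G[rule_format, OF UV, of "snd st"] st by (auto simp: mem_Times_iff)
  ultimately show "\<exists>t\<in>carrier (sec (prod_psh F G) U). res (prod_psh F G) U V t = st"
    by (intro bexI[of _ "(t1, t2)"]) auto
qed

text \<open>The lifting property that defines injectivity, for a sheaf with sections of any type.\<close>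

definition extends_homs :: "'u itself \<Rightarrow> 'x topology \<Rightarrow> ('x, 'w) psh \<Rightarrow> bool" where
  "extends_homs u X I \<longleftrightarrow> (\<forall>(A :: ('x, 'u) psh) (B :: ('x, 'u) psh) i f.
        sheaf X A \<and> sheaf X B \<and> sheaf_mono X A B i \<and> sheaf_hom X A I f \<longrightarrow>
        (\<exists>g. sheaf_hom X B I g \<and>
             (\<forall>U. openin X U \<longrightarrow> (\<forall>s \<in> carrier (sec A U). g U (i U s) = f U s))))"

lemma extends_homsD:
  fixes A B :: "('x, 'u) psh"
  assumes "extends_homs TYPE('u) X I" "sheaf X A" "sheaf X B" "sheaf_mono X A B i" "sheaf_hom X A I f"
  shows "\<exists>g. sheaf_hom X B I g \<and>
             (\<forall>U. openin X U \<longrightarrow> (\<forall>s \<in> carrier (sec A U). g U (i U s) = f U s))"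
  using assms(1)[unfolded extends_homs_def, THEN spec[of _ A], THEN spec[of _ B], THEN spec[of _ i],
      THEN spec[of _ f]] assms(2-) by simp

lemma injective_sheaf_iff: "injective_sheaf X (I :: ('x, 'u) psh) \<longleftrightarrow> sheaf X I \<and> extends_homs TYPE('u) X I"
  by (simp add: injective_sheaf_def extends_homs_def)

lemma DirProd_mult: "x \<otimes>\<^bsub>G \<times>\<times> H\<^esub> y = (fst x \<otimes>\<^bsub>G\<^esub> fst y, snd x \<otimes>\<^bsub>H\<^esub> snd y)"
  by (simp add: DirProd_def case_prod_unfold)

lemma extends_homs_prod_psh:
  assumes "extends_homs TYPE('u) X F" "extends_homs TYPE('u) X G"
  shows "extends_homs TYPE('u) X (prod_psh F G)"
  unfolding extends_homs_def
proof (intro allI impI)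
  fix A B :: "('a, 'u) psh" and i f
  assume *: "sheaf X A \<and> sheaf X B \<and> sheaf_mono X A B i \<and> sheaf_hom X A (prod_psh F G) f"
  then have AB: "sheaf X A" "sheaf X B" "sheaf_mono X A B i" by simp_all
  have f: "sheaf_hom X A F (\<lambda>U s. fst (f U s))" "sheaf_hom X A G (\<lambda>U s. snd (f U s))"
    using * by (auto simp: sheaf_hom_def hom_def Pi_iff mem_Times_iff DirProd_mult)
  obtain g where "sheaf_hom X B F g"
    "\<And>U s. openin X U \<Longrightarrow> s \<in> carrier (sec A U) \<Longrightarrow> g U (i U s) = fst (f U s)"
    using extends_homsD[OF assms(1) AB f(1)] by blast
  moreover obtain h where "sheaf_hom X B G h"
    "\<And>U s. openin X U \<Longrightarrow> s \<in> carrier (sec A U) \<Longrightarrow> h U (i U s) = snd (f U s)"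
    using extends_homsD[OF assms(2) AB f(2)] by blast
  ultimately show "\<exists>g. sheaf_hom X B (prod_psh F G) g \<and>
             (\<forall>U. openin X U \<longrightarrow> (\<forall>s \<in> carrier (sec A U). g U (i U s) = f U s))"
    by (intro exI[of _ "\<lambda>U s. (g U s, h U s)"]) (auto simp: sheaf_hom_def hom_def Pi_iff)
qed

lemma extends_homs_trans_psh:
  assumes F: "sheaf X F" and inv: "\<And>U s. openin X U \<Longrightarrow> s \<in> carrier (sec F U) \<Longrightarrow> e' (e s) = s"
    and ext: "extends_homs TYPE('u) X F"
  shows "extends_homs TYPE('u) X (trans_psh e e' F)"
  unfolding extends_homs_def
proof (intro allI impI)
  fix A B :: "('a, 'u) psh" and i f
  assume *: "sheaf X A \<and> sheaf X B \<and> sheaf_mono X A B i \<and> sheaf_hom X A (trans_psh e e' F) f"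
  then have f: "sheaf_hom X A (trans_psh e e' F) f" and AB: "sheaf X A" "sheaf X B" "sheaf_mono X A B i" by simp_all
  have "sheaf_hom X A F (\<lambda>U s. e' (f U s))"
    by (rule sheaf_hom_comp[OF f sheaf_hom_from_trans[where e = e and e' = e', OF F inv]])
  from extends_homsD[OF ext AB this]
  obtain g where g: "sheaf_hom X B F g"
    "\<And>U s. openin X U \<Longrightarrow> s \<in> carrier (sec A U) \<Longrightarrow> g U (i U s) = e' (f U s)"
    by blast
  have "e (e' (f U s)) = f U s" if "openin X U" "s \<in> carrier (sec A U)" for U s
    using sheaf_hom_closed[OF f that] that inv by (auto simp: sec_trans_psh)
  then show "\<exists>g. sheaf_hom X B (trans_psh e e' F) g \<and>
             (\<forall>U. openin X U \<longrightarrow> (\<forall>s \<in> carrier (sec A U). g U (i U s) = f U s))"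
    using sheaf_hom_comp[OF g(1) sheaf_hom_to_trans[where e = e and e' = e', OF F inv]] g(2)
    by (intro exI[of _ "\<lambda>U s. e (g U s)"]) auto
qed

text \<open>The additive group of a type as a multiplicatively written group.\<close>

definition add_grp :: "'a::ab_group_add monoid" where
  "add_grp = \<lparr> carrier = UNIV, monoid.mult = (+), one = 0 \<rparr>"

lemma comm_group_add_grp: "comm_group add_grp"
proof (rule comm_groupI)
  fix x :: 'a show "\<exists>y\<in>carrier add_grp. y \<otimes>\<^bsub>add_grp\<^esub> x = \<one>\<^bsub>add_grp\<^esub>"
    by (intro bexI[of _ "- x"]) (auto simp: add_grp_def)
qed (auto simp: add_grp_def add_ac)

text \<open>The additive group of the type is divisible; \<open>z [^]\<^bsub>add_grp\<^esub> n\<close> is the \<open>n\<close>-fold sum of \<open>z\<close>.\<close>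

definition divisible :: "'a::ab_group_add itself \<Rightarrow> bool" where
  "divisible a \<longleftrightarrow> (\<forall>(n::nat) (y::'a). n > 0 \<longrightarrow> (\<exists>z. z [^]\<^bsub>add_grp\<^esub> n = y))"

text \<open>A morphism into a product of skyscrapers is a family of homomorphisms out of the stalks at the
  base points, so it extends along monomorphisms when the values are divisible.\<close>

lemma extends_homs_sky:
  assumes fs: "finite_space X" and div: "divisible TYPE('a::ab_group_add)" and bT: "b ` T \<subseteq> topspace X"
  shows "extends_homs TYPE('u) X (sky T b :: ('x, 't \<Rightarrow> 'a) psh)"
  unfolding extends_homs_def
proof (intro allI impI)
  fix A B :: "('x, 'u) psh" and i f
  assume *: "sheaf X A \<and> sheaf X B \<and> sheaf_mono X A B i \<and> sheaf_hom X A (sky T b :: ('x, 't \<Rightarrow> 'a) psh) f"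
  then have A: "sheaf X A" and B: "sheaf X B" and i: "sheaf_hom X A B i"
    and inj: "\<And>U. openin X U \<Longrightarrow> inj_on (i U) (carrier (sec A U))"
    and f: "sheaf_hom X A (sky T b :: ('x, 't \<Rightarrow> 'a) psh) f" by (auto simp: sheaf_mono_def)
  have "\<exists>h. h \<in> hom (sec B (nb X (b c))) add_grp \<and>
      (\<forall>s\<in>carrier (sec A (nb X (b c))). h (i (nb X (b c)) s) = f (nb X (b c)) s c)" if "c \<in> T" for c
  proof -
    let ?N = "nb X (b c)"
    have N: "openin X ?N" using bT that openin_nb[OF fs] by blast
    have "\<exists>g\<in>hom (sec B ?N) (add_grp :: 'a monoid). \<forall>a\<in>carrier (sec A ?N). g (i ?N a) = f ?N a c"
    proof (rule divisible_extend[OF sh_comm_group[OF B N] comm_group_add_grp _ sh_group[OF A N]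
            sheaf_hom_hom[OF i N] inj[OF N]])
      show "\<exists>z\<in>carrier add_grp. z [^]\<^bsub>add_grp\<^esub> n = y" if "n > 0" for n :: nat and y :: 'a
        using div that by (simp add: divisible_def add_grp_def)
      show "(\<lambda>a. f ?N a c) \<in> hom (sec A ?N) add_grp"
        using sheaf_hom_mult[OF f N] by (auto simp: hom_def add_grp_def)
    qed
    then show ?thesis by blast
  qed
  then obtain h where h: "\<And>c. c \<in> T \<Longrightarrow> h c \<in> hom (sec B (nb X (b c))) add_grp"
    "\<And>c s. c \<in> T \<Longrightarrow> s\<in>carrier (sec A (nb X (b c))) \<Longrightarrow> h c (i (nb X (b c)) s) = f (nb X (b c)) s c"
    by metis
  define g where "g U s = (\<lambda>c. if c \<in> T \<and> b c \<in> U then h c (res B U (nb X (b c)) s) else 0)" for U s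
  have n: "openin X (nb X x)" "nb X x \<subseteq> U" if "x \<in> U" "openin X U" for x U
    using that fs nb_least openin_nb openin_subset by fast+
  note pA = sheaf_presheaf[OF A] and pB = sheaf_presheaf[OF B]
  have "sheaf_hom X B (sky T b) g"
  proof (rule sheaf_homI)
    fix U assume U: "openin X U"
    have "h c (s \<otimes>\<^bsub>sec B (nb X (b c))\<^esub> t) = h c s + h c t"
      if "c \<in> T" "s \<in> carrier (sec B (nb X (b c)))" "t \<in> carrier (sec B (nb X (b c)))" for c s t
      using hom_mult[OF h(1)[OF that(1)] that(2,3)] by (simp add: add_grp_def)
    then show "g U \<in> hom (sec B U) (sec (sky T b) U)"
      using n[OF _ U] U by (intro homI) (auto simp: carrier_sky g_def fun_eq_iff res_mult[OF pB] res_closed[OF pB])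
  qed (auto simp: g_def fun_eq_iff n res_res[OF pB])
  moreover have "g U (i U s) = f U s" if U: "openin X U" and s: "s \<in> carrier (sec A U)" for U s
  proof
    fix c
    have fU: "f U s \<in> carrier (sec (sky T b) U)" by (rule sheaf_hom_closed[OF f U s])
    show "g U (i U s) c = f U s c"
    proof (cases "c \<in> T \<and> b c \<in> U")
      case True
      note N = n[OF conjunct2[OF True] U]
      have "g U (i U s) c = h c (i (nb X (b c)) (res A U (nb X (b c)) s))"
        using True sheaf_hom_res[OF i U N s] by (simp add: g_def)
      also have "\<dots> = f (nb X (b c)) (res A U (nb X (b c)) s) c"
        using True h(2) res_closed[OF pA U N s] by blast
      also have "\<dots> = f U s c"
        using sheaf_hom_res[OF f U N s] nb_self[of "b c" X] openin_subset[OF U] True by auto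
      finally show ?thesis .
    next
      case False
      then show ?thesis using fU by (auto simp: g_def carrier_sky)
    qed
  qed
  ultimately show "\<exists>g. sheaf_hom X B (sky T b) g \<and>
             (\<forall>U. openin X U \<longrightarrow> (\<forall>s \<in> carrier (sec A U). g U (i U s) = f U s))" by blast
qed

subsection \<open>The divisible groups of rationals and of rationals modulo integers\<close>

lemma divisible_rat: "divisible TYPE(rat)"
  unfolding divisible_def
proof (intro allI impI)
  fix n :: nat and y :: rat assume "n > 0"
  interpret comm_group "add_grp :: rat monoid" by (rule comm_group_add_grp)
  have "z [^]\<^bsub>add_grp\<^esub> k = of_nat k * z" for z :: rat and k :: nat
    by (induction k) (auto simp: add_grp_def algebra_simps)
  then show "\<exists>z. z [^]\<^bsub>add_grp\<^esub> n = y" using \<open>n > 0\<close> by (intro exI[of _ "y / of_nat n"]) simp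
qed

text \<open>The group \<open>\<rat>/\<int>\<close>, as a type, with its projection \<open>mod_int\<close> from the rationals.\<close>

definition int_cong :: "rat \<Rightarrow> rat \<Rightarrow> bool" where
  "int_cong x y \<longleftrightarrow> x - y \<in> \<int>"

quotient_type ratz = rat / int_cong
proof (rule equivpI)
  show "symp int_cong" unfolding symp_def int_cong_def by (metis Ints_minus minus_diff_eq)
  show "transp int_cong" unfolding transp_def int_cong_def
    by (metis Ints_add add_diff_eq diff_add_cancel)
qed (auto simp: reflp_def int_cong_def)

instantiation ratz :: ab_group_add
begin

lift_definition zero_ratz :: ratz is 0 .

lift_definition plus_ratz :: "ratz \<Rightarrow> ratz \<Rightarrow> ratz" is "(+)"
  unfolding int_cong_def by (metis Ints_add add_diff_add)

lift_definition uminus_ratz :: "ratz \<Rightarrow> ratz" is "uminus"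
  unfolding int_cong_def by (metis Ints_minus minus_diff_eq minus_diff_minus)

definition minus_ratz :: "ratz \<Rightarrow> ratz \<Rightarrow> ratz" where
  "minus_ratz x y = x + - y"

instance
proof
  fix x y z :: ratz
  show "x + y + z = x + (y + z)" "x + y = y + x" "0 + x = x" "- x + x = 0"
    by (transfer; simp add: int_cong_def)+
  show "x - y = x + - y" by (fact minus_ratz_def)
qed

end

lift_definition mod_int :: "rat \<Rightarrow> ratz" is "\<lambda>x. x" .

lemma mod_int_add: "mod_int (x + y) = mod_int x + mod_int y"
  and mod_int_0: "mod_int 0 = 0"
  by (transfer; simp add: int_cong_def)+

lemma mod_int_eq_0: "mod_int x = 0 \<longleftrightarrow> x \<in> \<int>"
  by transfer (simp add: int_cong_def)

lemma mod_int_surj: "\<exists>x. mod_int x = y"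
proof transfer
  fix y show "\<exists>x. int_cong x y" by (rule exI[of _ y]) (simp add: int_cong_def)
qed

lemma divisible_ratz: "divisible TYPE(ratz)"
  unfolding divisible_def
proof (intro allI impI)
  fix n :: nat and y :: ratz assume "n > 0"
  interpret comm_group "add_grp :: ratz monoid" by (rule comm_group_add_grp)
  obtain x where x: "y = mod_int x" using mod_int_surj by metis
  have "mod_int z [^]\<^bsub>add_grp\<^esub> k = mod_int (of_nat k * z)" for z and k :: nat
    by (induction k) (auto simp: add_grp_def algebra_simps mod_int_add mod_int_0)
  then show "\<exists>z. z [^]\<^bsub>add_grp\<^esub> n = y"
    using \<open>n > 0\<close> x by (intro exI[of _ "mod_int (x / of_nat n)"]) simp
qed

lemma countable_ratz: "countable (UNIV :: ratz set)"
proof -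
  have "range mod_int = UNIV" using mod_int_surj by (metis surj_def)
  then show ?thesis by (metis countable_image countableI_type)
qed

section \<open>Cochains on strict chains\<close>

text \<open>The alternating sum \<open>delta c f = f (x\<^sub>1 \<dots> x\<^sub>n) - f (x\<^sub>0 x\<^sub>2 \<dots> x\<^sub>n) + \<dots>\<close> over the lists that arise
  from \<open>c = x\<^sub>0 \<dots> x\<^sub>n\<close> by deleting one entry.\<close>

primrec delta :: "'x list \<Rightarrow> ('x list \<Rightarrow> 'a::ab_group_add) \<Rightarrow> 'a" where
  "delta [] f = 0"
| "delta (x # c) f = f c - delta c (\<lambda>c'. f (x # c'))"

lemma delta_cong:
  "(\<And>ys y zs. c = ys @ y # zs \<Longrightarrow> f (ys @ zs) = g (ys @ zs)) \<Longrightarrow> delta c f = delta c g"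
proof (induction c arbitrary: f g)
  case (Cons x c)
  have "f c = g c" using Cons.prems[of "[]" x c] by simp
  moreover have "delta c (\<lambda>c'. f (x # c')) = delta c (\<lambda>c'. g (x # c'))"
    by (rule Cons.IH) (use Cons.prems[of "x # ys" for ys] in auto)
  ultimately show ?case by simp
qed simp

lemma delta_0: "delta c (\<lambda>c. 0) = 0"
  by (induction c) auto

lemma delta_zero:
  "(\<And>ys y zs. c = ys @ y # zs \<Longrightarrow> f (ys @ zs) = 0) \<Longrightarrow> delta c f = 0"
  using delta_cong[of c f "\<lambda>c. 0"] by (simp add: delta_0)

lemma delta_add: "delta c (\<lambda>c. f c + g c) = delta c f + delta c g"
  by (induction c arbitrary: f g) auto

lemma delta_diff: "delta c (\<lambda>c. f c - g c) = delta c f - delta c g"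
  by (induction c arbitrary: f g) auto

lemma delta_uminus: "delta c (\<lambda>c. - f c) = - delta c f"
  using delta_diff[of c "\<lambda>_. 0" f] by (simp add: delta_0)

lemma delta_additive:
  assumes "\<And>x y. \<phi> (x + y) = \<phi> x + \<phi> y"
  shows "delta c (\<lambda>c. \<phi> (f c)) = \<phi> (delta c f)"
proof -
  have 0: "\<phi> 0 = 0" using assms[of 0 0] by simp
  have "\<phi> (x - y) = \<phi> x - \<phi> y" for x y using assms[of "x - y" y] by simp
  then show ?thesis using 0 by (induction c arbitrary: f) auto
qed

lemma delta_delta: "delta c (\<lambda>c'. delta c' f) = 0"
  by (induction c arbitrary: f) (auto simp: delta_diff)

lemma delta_append_last:
  "f c = 0 \<Longrightarrow> delta (c @ [p]) f = delta c (\<lambda>c'. f (c' @ [p]))"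
  by (induction c arbitrary: f) auto

text \<open>Strictly increasing lists of points, i.e. the simplices of the order complex (together with
  the empty simplex).\<close>

definition schain :: "'x topology \<Rightarrow> 'x list \<Rightarrow> bool" where
  "schain X c \<longleftrightarrow> sorted_wrt (spec_less X) c \<and> set c \<subseteq> topspace X"

lemma schain_delete: "schain X (ys @ y # zs) \<Longrightarrow> schain X (ys @ zs)"
  by (auto simp: schain_def sorted_wrt_append)

lemma schain_distinct: "schain X c \<Longrightarrow> distinct c"
  by (induction c) (auto simp: schain_def spec_less_def)

lemma schain_last:
  assumes "schain X c" "z \<in> set c"
  shows "spec_le X z (last c)"
proof (cases c rule: rev_exhaust)
  case (snoc ys y)
  then show ?thesis using assms by (auto simp: schain_def sorted_wrt_append spec_less_def intro: spec_le_refl)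
qed (use assms in auto)

lemma schain_hd:
  assumes "schain X c" "z \<in> set c"
  shows "spec_le X (hd c) z"
proof (cases c)
  case (Cons y ys)
  then show ?thesis using assms by (auto simp: schain_def spec_less_def intro: spec_le_refl)
qed (use assms in auto)

lemma schain_subset: "schain X c \<Longrightarrow> openin X U \<Longrightarrow> c = [] \<or> hd c \<in> U \<Longrightarrow> set c \<subseteq> U"
  using schain_hd by (fastforce simp: spec_le_iff)

lemma schain_Cons:
  assumes "finite_space X" "schain X c" "x \<in> topspace X" "c \<noteq> [] \<Longrightarrow> spec_less X x (hd c)"
  shows "schain X (x # c)"
proof -
  have "spec_less X x z" if z: "z \<in> set c" for z
  proof -
    have c: "spec_less X x (hd c)" "spec_le X (hd c) z" using assms schain_hd z by (auto intro: assms(4))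
    then show ?thesis
      using spec_le_trans[of X x "hd c" z] spec_le_antisym[OF assms(1), of x "hd c"] by (auto simp: spec_less_def)
  qed
  then show ?thesis using assms by (auto simp: schain_def)
qed

text \<open>The nonempty chains of dimension \<open>n\<close>, i.e. with \<open>n + 1\<close> points, whose last point lies in \<open>S\<close>. Functions
  on them form the \<open>n\<close>-th term of the standard resolution of the sheaf \<open>\<int>\<^sub>S\<close>; the base point of a chain is its
  least element, so that the chains over an open set \<open>U\<close> are those contained in \<open>U\<close>. The degree ranges over
  the integers, and there are no chains in negative degrees.\<close>

definition smp :: "'x topology \<Rightarrow> 'x set \<Rightarrow> int \<Rightarrow> 'x list set" where
  "smp X S n = {c. schain X c \<and> c \<noteq> [] \<and> last c \<in> S \<and> int (length c) = n + 1}"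

abbreviation cochains :: "'x topology \<Rightarrow> 'x set \<Rightarrow> int \<Rightarrow> ('x, 'x list \<Rightarrow> 'a::ab_group_add) psh" where
  "cochains X S n \<equiv> sky (smp X S n) hd"

text \<open>The differential is the alternating sum over the faces of a chain \<open>x\<^sub>0 < \<dots> < x\<^sub>n\<^sub>+\<^sub>1\<close> with \<open>x\<^sub>n\<^sub>+\<^sub>1 \<in> S\<close>. The
  last face contributes only if \<open>x\<^sub>n \<in> S\<close>, in accordance with the map from the stalk of \<open>\<int>\<^sub>S\<close> at \<open>x\<^sub>n\<close> to the
  stalk at \<open>x\<^sub>n\<^sub>+\<^sub>1\<close>, which is zero if \<open>x\<^sub>n \<notin> S\<close>.\<close>

definition cdiff :: "'x topology \<Rightarrow> 'x set \<Rightarrow> int \<Rightarrow> 'x set \<Rightarrow> ('x list \<Rightarrow> 'a::ab_group_add) \<Rightarrow> 'x list \<Rightarrow> 'a" where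
  "cdiff X S n U f = (\<lambda>c. if c \<in> smp X S (n + 1) \<and> hd c \<in> U then delta c f else 0)"

text \<open>Order-convex sets; the locally closed subsets of a finite space are those of its subsets that are
  convex.\<close>

definition convex_pts :: "'x topology \<Rightarrow> 'x set \<Rightarrow> bool" where
  "convex_pts X S \<longleftrightarrow> (\<forall>a b c. a \<in> S \<and> c \<in> S \<and> spec_le X a b \<and> spec_le X b c \<longrightarrow> b \<in> S)"

lemma smp_neg: "n < 0 \<Longrightarrow> smp X S n = {}"
  by (auto simp: smp_def) (metis add_le_same_cancel2 length_0_conv linorder_not_less of_nat_0_le_iff
      of_nat_le_0_iff zle_add1_eq_le)

lemma smp_hd: "hd ` smp X S n \<subseteq> topspace X"
  by (auto simp: smp_def schain_def)

lemma cochains_eq_0: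
  assumes "f \<in> carrier (sec (cochains X S n) U)" "c \<notin> smp X S n \<or> hd c \<notin> U"
  shows "f c = 0"
  using assms by (auto simp: carrier_sky)

lemma cochains_neg: "n < 0 \<Longrightarrow> f \<in> carrier (sec (cochains X S n) U) \<Longrightarrow> f = (\<lambda>c. 0)"
  using cochains_eq_0[of f X S n U] by (auto simp: smp_neg)

lemma sheaf_hom_cdiff:
  "sheaf_hom X (cochains X S n :: ('x, 'x list \<Rightarrow> 'a::ab_group_add) psh) (cochains X S (n + 1)) (cdiff X S n)"
proof (rule sheaf_homI)
  fix U V and f :: "'x list \<Rightarrow> 'a"
  assume U: "openin X U" and V: "openin X V" "V \<subseteq> U" and f: "f \<in> carrier (sec (cochains X S n) U)"
  have "delta c (\<lambda>c. if hd c \<in> V then f c else 0) = delta c f"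
    if c: "c \<in> smp X S (n + 1)" "hd c \<in> V" for c
  proof (rule delta_cong)
    fix ys y zs assume ys: "c = ys @ y # zs"
    have "hd (ys @ zs) \<in> V" if nz: "f (ys @ zs) \<noteq> 0"
    proof -
      have "ys @ zs \<noteq> []" using cochains_eq_0[OF f] nz by (auto simp: smp_def)
      then have "hd (ys @ zs) \<in> set c" using hd_in_set[of "ys @ zs"] by (auto simp: ys)
      then show ?thesis using schain_subset[of X c V] c V by (auto simp: smp_def)
    qed
    then show "(if hd (ys @ zs) \<in> V then f (ys @ zs) else 0) = f (ys @ zs)" by auto
  qed
  then show "cdiff X S n V (res (cochains X S n) U V f) = res (cochains X S (n + 1)) U V (cdiff X S n U f)"
    using V by (auto simp: cdiff_def fun_eq_iff)
qed (auto intro!: homI simp: carrier_sky cdiff_def delta_add fun_eq_iff)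

lemma cdiff_closed:
  "openin X U \<Longrightarrow> f \<in> carrier (sec (cochains X S n) U) \<Longrightarrow> cdiff X S n U f \<in> carrier (sec (cochains X S (n + 1)) U)"
  using sheaf_hom_closed[OF sheaf_hom_cdiff] .

text \<open>The square of the differential vanishes; convexity ensures that the terms cut off by the condition
  on the last point do not contribute to the second alternating sum.\<close>

lemma cdiff_cdiff:
  assumes S: "convex_pts X S" and U: "openin X U" and f: "f \<in> carrier (sec (cochains X S n) U)"
  shows "cdiff X S (n + 1) U (cdiff X S n U f) = (\<lambda>c. 0)"
proof
  fix c
  show "cdiff X S (n + 1) U (cdiff X S n U f) c = 0"
  proof (cases "c \<in> smp X S (n + 1 + 1) \<and> hd c \<in> U")
    case True
    then have c: "schain X c" "last c \<in> S" "int (length c) = n + 3" "hd c \<in> U" by (auto simp: smp_def)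
    have "delta c (cdiff X S n U f) = delta c (\<lambda>c'. delta c' f)"
    proof (rule delta_cong)
      fix ys y zs assume cy: "c = ys @ y # zs"
      let ?c = "ys @ zs"
      have c': "schain X ?c" "int (length ?c) = n + 2" "set ?c \<subseteq> set c"
        using c cy schain_delete by auto
      have le: "spec_le X (last ?c) (last c)" if "?c \<noteq> []"
        using schain_last[OF c(1), of "last ?c"] last_in_set[OF that] c'(3) by blast
      show "cdiff X S n U f ?c = delta ?c f"
      proof (cases "?c \<in> smp X S (n + 1)")
        case True
        then have "hd ?c \<in> set c" using c'(3) hd_in_set[of ?c] by (auto simp: smp_def)
        then have "hd ?c \<in> U" using schain_subset[OF c(1) U] c(4) by blast
        then show ?thesis using True by (simp add: cdiff_def)
      next
        case False
        have "delta ?c f = 0"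
        proof (rule delta_zero, rule ccontr)
          fix us u vs assume u: "?c = us @ u # vs" and nz: "f (us @ vs) \<noteq> 0"
          then have "us @ vs \<in> smp X S n" using cochains_eq_0[OF f] by blast
          then have "last (us @ vs) \<in> S" "us @ vs \<noteq> []" by (auto simp: smp_def)
          moreover then have "spec_le X (last (us @ vs)) (last ?c)"
            using schain_last[OF c'(1), of "last (us @ vs)"] last_in_set[of "us @ vs"] u by auto
          ultimately have "last ?c \<in> S" using S le c(2) u unfolding convex_pts_def by (metis append_is_Nil_conv list.distinct(1))
          then have "?c \<in> smp X S (n + 1)" using c'(1,2) u by (auto simp: smp_def)
          then show False using False by blast
        qed
        then show ?thesis using False by (simp add: cdiff_def)
      qed
    qed
    then show ?thesis by (simp add: cdiff_def delta_delta)
  qed (auto simp: cdiff_def)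
qed

text \<open>On a smallest open neighbourhood the complex of cochains is exact in positive degrees: such a
  neighbourhood is a cone with apex \<open>x\<close>, and \<open>f \<mapsto> (c \<mapsto> f (x # c))\<close> is a contraction.\<close>

lemma cdiff_exact:
  fixes f :: "'x list \<Rightarrow> 'a::ab_group_add"
  assumes fs: "finite_space X" and x: "x \<in> topspace X" and n: "n > 0"
    and f: "f \<in> carrier (sec (cochains X S n) (nb X x))" and df: "cdiff X S n (nb X x) f = (\<lambda>c. 0)"
  shows "\<exists>g \<in> carrier (sec (cochains X S (n - 1)) (nb X x)). cdiff X S (n - 1) (nb X x) g = f"
proof -
  define h where "h = (\<lambda>c. if c = [] \<or> hd c = x then 0 else f (x # c))"
  have N: "openin X (nb X x)" by (rule openin_nb[OF fs x])
  have "h \<in> carrier (sec (cochains X S (n - 1)) (nb X x))"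
    unfolding carrier_sky
  proof (intro allI impI)
    fix c assume "h c \<noteq> 0"
    then have c: "c \<noteq> []" "f (x # c) \<noteq> 0" by (auto simp: h_def split: if_splits)
    then have xc: "x # c \<in> smp X S n" using cochains_eq_0[OF f] by blast
    then have "spec_less X x (hd c)" using c by (auto simp: smp_def schain_def)
    then show "c \<in> smp X S (n - 1) \<and> hd c \<in> nb X x"
      using xc c by (auto simp: smp_def schain_def nb_def spec_less_def)
  qed
  moreover have "cdiff X S (n - 1) (nb X x) h = f"
  proof
    fix c
    show "cdiff X S (n - 1) (nb X x) h c = f c"
    proof (cases "c \<in> smp X S n \<and> hd c \<in> nb X x")
      case True
      then have c: "schain X c" "c \<noteq> []" "last c \<in> S" "int (length c) = n + 1" "hd c \<in> nb X x"
        by (auto simp: smp_def)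
      have eq: "cdiff X S (n - 1) (nb X x) h c = delta c h" using True by (simp add: cdiff_def)
      show ?thesis
      proof (cases "hd c = x")
        case True
        then obtain c' where c': "c = x # c'" using c(2) by (cases c) auto
        have "c' \<noteq> []" using c(4) n c' by auto
        moreover have "x \<notin> set c'" using schain_distinct[OF c(1)] c' by simp
        ultimately have "h c' = f c" using c' hd_in_set by (fastforce simp: h_def)
        then show ?thesis using eq c' by (simp add: h_def delta_0)
      next
        case False
        have less: "spec_less X x (hd c)" using c(5) False by (auto simp: nb_def spec_less_def)
        have xc: "schain X (x # c)" using schain_Cons[OF fs c(1) x] less by blast
        have "x # c \<in> smp X S (n + 1)" using xc c by (auto simp: smp_def)
        then have "0 = delta (x # c) f" using fun_cong[OF df, of "x # c"] nb_self[OF x] by (simp add: cdiff_def)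
        also have "\<dots> = f c - delta c h"
        proof -
          have "delta c (\<lambda>c'. f (x # c')) = delta c h"
          proof (rule delta_cong)
            fix ys y zs assume ys: "c = ys @ y # zs"
            have "ys @ zs \<noteq> []" using c(4) n ys by auto
            moreover have "x \<notin> set (ys @ zs)" using schain_distinct[OF xc] ys by auto
            ultimately show "f (x # ys @ zs) = h (ys @ zs)" using hd_in_set[of "ys @ zs"] by (auto simp: h_def)
          qed
          then show ?thesis by simp
        qed
        finally show ?thesis using eq by simp
      qed
    next
      case False
      then show ?thesis using cochains_eq_0[OF f] by (auto simp: cdiff_def)
    qed
  qed
  ultimately show ?thesis by blast
qed

text \<open>Sections over \<open>U\<close> of the constant sheaf on \<open>S\<close> extended by zero, described by the order.\<close>

definition loc_const :: "'x topology \<Rightarrow> 'x set \<Rightarrow> 'x set \<Rightarrow> ('x \<Rightarrow> 'a::zero) \<Rightarrow> bool" where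
  "loc_const X S U u \<longleftrightarrow> (\<forall>x. x \<notin> S \<inter> U \<longrightarrow> u x = 0) \<and>
     (\<forall>y\<in>U. \<forall>z\<in>U \<inter> S. spec_le X y z \<longrightarrow> u y = u z)"

lemma carrier_int_sheaf_on:
  assumes fs: "finite_space X" and U: "openin X U"
  shows "f \<in> carrier (sec (int_sheaf_on X S) U) \<longleftrightarrow> loc_const X S U f"
proof
  assume "f \<in> carrier (sec (int_sheaf_on X S) U)"
  then have f0: "\<And>x. x \<notin> S \<inter> U \<Longrightarrow> f x = 0"
    and cont: "continuous_map (subtopology X (S \<inter> U)) (discrete_topology UNIV) f"
    and cl: "closedin (subtopology X U) {x \<in> U. f x \<noteq> 0}" by (auto simp: int_sheaf_on_def)
  have "f y = f z" if y: "y \<in> U" and z: "z \<in> U" "z \<in> S" and le: "spec_le X y z" for y z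
  proof (cases "y \<in> S")
    case True
    have "openin (subtopology X (S \<inter> U)) {w \<in> topspace (subtopology X (S \<inter> U)). f w \<in> {f y}}"
      using cont by (rule openin_continuous_map_preimage) simp
    then obtain T where T: "openin X T"
      "{w \<in> topspace (subtopology X (S \<inter> U)). f w \<in> {f y}} = T \<inter> (S \<inter> U)"
      by (auto simp: openin_subtopology)
    have "y \<in> T" using T(2) True y openin_subset[OF U] by auto
    then have "z \<in> T" using T(1) le by (auto simp: spec_le_iff)
    then have "z \<in> {w \<in> topspace (subtopology X (S \<inter> U)). f w \<in> {f y}}" using T(2) z by blast
    then show ?thesis by simp
  next
    case False
    have "f z = 0"
    proof (rule ccontr)
      assume "f z \<noteq> 0"
      obtain K where K: "closedin X K" "{x \<in> U. f x \<noteq> 0} = K \<inter> U"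
        using cl by (auto simp: closedin_subtopology)
      then have "z \<in> K" using z \<open>f z \<noteq> 0\<close> by auto
      moreover have "openin X (topspace X - K)" using K(1) by blast
      ultimately have "y \<in> K" using le by (auto simp: spec_le_iff)
      then show False using K(2) y f0 False by auto
    qed
    then show ?thesis using f0 False by simp
  qed
  then show "loc_const X S U f" using f0 by (auto simp: loc_const_def)
next
  assume "loc_const X S U f"
  then have f0: "\<And>x. x \<notin> S \<inter> U \<Longrightarrow> f x = 0"
    and eq: "\<And>y z. y \<in> U \<Longrightarrow> z \<in> U \<Longrightarrow> z \<in> S \<Longrightarrow> spec_le X y z \<Longrightarrow> f y = f z"
    unfolding loc_const_def by auto
  have "openin (subtopology X (S \<inter> U)) {w \<in> topspace (subtopology X (S \<inter> U)). f w \<in> V}" for V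
  proof -
    let ?T = "{w \<in> topspace X. \<exists>v\<in>S \<inter> U. f v \<in> V \<and> spec_le X v w}"
    have "openin X ?T" using fs by (auto simp: openin_iff_upper intro: spec_le_trans spec_le_topspace)
    moreover have "{w \<in> topspace (subtopology X (S \<inter> U)). f w \<in> V} = ?T \<inter> (S \<inter> U)"
      using eq openin_subset[OF U] by (auto intro: spec_le_refl)
    ultimately show ?thesis by (auto simp: openin_subtopology)
  qed
  then have "continuous_map (subtopology X (S \<inter> U)) (discrete_topology UNIV) f"
    by (simp add: continuous_map_def)
  moreover have "closedin (subtopology X U) {x \<in> U. f x \<noteq> 0}"
  proof -
    let ?T = "{w \<in> topspace X. \<exists>v\<in>U. f v = 0 \<and> spec_le X v w}"
    have "openin X ?T" using fs by (auto simp: openin_iff_upper intro: spec_le_trans spec_le_topspace)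
    then have "closedin X (topspace X - ?T)" by blast
    moreover have "f w = 0" if "w \<in> U" "v \<in> U" "f v = 0" "spec_le X v w" for v w
      using eq[of v w] f0[of w] that by force
    then have "w \<in> ?T \<longleftrightarrow> f w = 0" if "w \<in> U" for w
      using that openin_subset[OF U] spec_le_refl[of w X] by blast
    then have "{x \<in> U. f x \<noteq> 0} = (topspace X - ?T) \<inter> U"
      using openin_subset[OF U] by blast
    ultimately show ?thesis by (auto simp: closedin_subtopology)
  qed
  ultimately show "f \<in> carrier (sec (int_sheaf_on X S) U)" using f0 by (auto simp: int_sheaf_on_def)
qed

lemma mult_int_sheaf_on [simp]: "f \<otimes>\<^bsub>sec (int_sheaf_on X S) U\<^esub> g = (\<lambda>x. f x + g x)"
  and one_int_sheaf_on [simp]: "\<one>\<^bsub>sec (int_sheaf_on X S) U\<^esub> = (\<lambda>x. 0)"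
  and res_int_sheaf_on [simp]: "res (int_sheaf_on X S) U V f = (\<lambda>x. if x \<in> V then f x else 0)"
  by (simp_all add: int_sheaf_on_def)

text \<open>A function on points as a function on chains of length one.\<close>

definition aug :: "('x \<Rightarrow> 'a::zero) \<Rightarrow> 'x list \<Rightarrow> 'a" where
  "aug u c = (if length c = 1 then u (hd c) else 0)"

lemma aug_inj: "aug u = aug v \<Longrightarrow> u = v"
proof
  fix x assume "aug u = aug v"
  from fun_cong[OF this, of "[x]"] show "u x = v x" by (simp add: aug_def)
qed

lemma aug_0: "aug (\<lambda>x. 0) = (\<lambda>c. 0)"
  by (auto simp: aug_def)

lemma smp_0: "c \<in> smp X S 0 \<longleftrightarrow> (\<exists>y\<in>S \<inter> topspace X. c = [y])"
  by (auto simp: smp_def schain_def length_Suc_conv)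

text \<open>The cocycles of degree \<open>0\<close> are the sections of \<open>\<int>\<^sub>S\<close>.\<close>

lemma cdiff_0_iff:
  assumes "openin X U" "f \<in> carrier (sec (cochains X S 0) U)"
  shows "cdiff X S 0 U f = (\<lambda>c. 0) \<longleftrightarrow> loc_const X S U (\<lambda>x. f [x])"
proof
  assume d: "cdiff X S 0 U f = (\<lambda>c. 0)"
  have "f [y] = f [z]" if yz: "y \<in> U" "z \<in> U" "z \<in> S" "spec_le X y z" for y z
  proof (cases "y = z")
    case False
    then have "[y, z] \<in> smp X S 1"
      using yz by (auto simp: smp_def schain_def spec_less_def dest: spec_le_topspace)
    then show ?thesis using fun_cong[OF d, of "[y, z]"] yz by (simp add: cdiff_def)
  qed simp
  moreover have "f [x] = 0" if "x \<notin> S \<inter> U" for x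
    using cochains_eq_0[OF assms(2), of "[x]"] that by (auto simp: smp_0)
  ultimately show "loc_const X S U (\<lambda>x. f [x])" by (auto simp: loc_const_def)
next
  assume l: "loc_const X S U (\<lambda>x. f [x])"
  have "delta c f = 0" if c: "c \<in> smp X S 1" "hd c \<in> U" for c
  proof -
    obtain y z where yz: "c = [y, z]" using c by (auto simp: smp_def length_Suc_conv numeral_2_eq_2)
    then have "z \<in> S" "spec_le X y z" "y \<in> U" using c by (auto simp: smp_def schain_def spec_less_def)
    moreover then have "z \<in> U" using assms(1) by (auto simp: spec_le_iff)
    ultimately have "f [y] = f [z]" using l by (auto simp: loc_const_def)
    then show ?thesis using yz by simp
  qed
  then show "cdiff X S 0 U f = (\<lambda>c. 0)" by (auto simp: cdiff_def)
qed

lemma aug_closed: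
  assumes "openin X U" "loc_const X S U u"
  shows "aug u \<in> carrier (sec (cochains X S 0) U)"
  using assms openin_subset[OF assms(1)]
  by (fastforce simp: carrier_sky smp_0 aug_def loc_const_def length_Suc_conv split: if_splits)

lemma cdiff_aug:
  assumes "openin X U" "loc_const X S U u"
  shows "cdiff X S 0 U (aug u) = (\<lambda>c. 0)"
  using cdiff_0_iff[OF assms(1) aug_closed[OF assms]] assms(2) by (simp add: aug_def)

lemma cdiff_0_aug:
  assumes "openin X U" "f \<in> carrier (sec (cochains X S 0) U)" "cdiff X S 0 U f = (\<lambda>c. 0)"
  shows "\<exists>u. loc_const X S U u \<and> aug u = f"
proof (intro exI[of _ "\<lambda>x. f [x]"] conjI)
  show "loc_const X S U (\<lambda>x. f [x])" using cdiff_0_iff[OF assms(1,2)] assms(3) by blast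
  show "aug (\<lambda>x. f [x]) = f"
  proof
    fix c show "aug (\<lambda>x. f [x]) c = f c"
      using cochains_eq_0[OF assms(2), of c] by (auto simp: aug_def smp_0 length_Suc_conv)
  qed
qed

lemma countable_cochains:
  assumes fs: "finite_space X" and cnt: "countable (UNIV :: 'a::ab_group_add set)"
  shows "\<exists>T. countable T \<and> (\<forall>S n U. carrier (sec (cochains X S n :: ('x, 'x list \<Rightarrow> 'a) psh) U) \<subseteq> T)"
proof -
  define D where "D = {c. set c \<subseteq> topspace X \<and> distinct c}"
  have D: "finite D" unfolding D_def using fs by (intro finite_subset_distinct) (simp add: finite_space_def)
  define T where "T = (\<lambda>g c. if c \<in> D then g c else (0::'a)) ` PiE D (\<lambda>_. UNIV)"
  have "countable T" unfolding T_def using D cnt by (intro countable_image countable_PiE) auto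
  moreover have "f \<in> T" if f: "f \<in> carrier (sec (cochains X S n) U)" for S n U f
  proof -
    have "f c = 0" if "c \<notin> D" for c
      using cochains_eq_0[OF f, of c] that schain_distinct by (auto simp: smp_def D_def schain_def)
    then have "f = (\<lambda>c. if c \<in> D then restrict f D c else 0)" by auto
    moreover have "restrict f D \<in> PiE D (\<lambda>_. UNIV)" by simp
    ultimately show ?thesis unfolding T_def by (rule image_eqI)
  qed
  ultimately show ?thesis by blast
qed

section \<open>Injective sheaves are flabby\<close>

text \<open>A section \<open>s\<close> over \<open>V\<close> is a morphism out of \<open>\<int>\<^sub>V\<close>; it extends to \<open>\<int>\<^sub>U\<close>. Both sheaves are realised
  as kernels of the first differential on cochains.\<close>

lemma flabby_injective:
  fixes I :: "('x, 'u::infinite) psh"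
  assumes fs: "finite_space X" and I: "injective_sheaf X I"
  shows "flabby X I"
  unfolding flabby_def
proof (intro allI impI ballI)
  fix U V s
  assume UV: "openin X U \<and> openin X V \<and> V \<subseteq> U" and s: "s \<in> carrier (sec I V)"
  have shI: "sheaf X I" using I by (simp add: injective_sheaf_def)
  note pI = sheaf_presheaf[OF shI]
  define Z where "Z S = ker_psh (cochains X S 0) (cochains X S (0 + 1)) (cdiff X S 0 :: _ \<Rightarrow> ('x list \<Rightarrow> int) \<Rightarrow> _)" for S
  have Z: "sheaf X (Z S)" for S
    unfolding Z_def by (rule sheaf_ker_psh[OF sheaf_sky sheaf_sky sheaf_hom_cdiff])
  have Zin: "f \<in> carrier (sec (Z S) W) \<longleftrightarrow>
      f \<in> carrier (sec (cochains X S 0) W) \<and> loc_const X S W (\<lambda>x. f [x])" if "openin X W" for f S W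
    using cdiff_0_iff[OF that, of f S] by (auto simp: Z_def sec_ker_psh)
  have Zop: "f \<otimes>\<^bsub>sec (Z S) W\<^esub> g = (\<lambda>c. f c + g c)" "res (Z S) W W' f = (\<lambda>c. if hd c \<in> W' then f c else 0)" for f g S W W'
    by (auto simp: Z_def sec_ker_psh)
  have n: "openin X (nb X x)" "x \<in> nb X x" if "x \<in> topspace X" for x
    by (rule openin_nb[OF fs that], rule nb_self[OF that])
  have nV: "nb X x \<subseteq> V" "x \<in> topspace X" if "x \<in> V" for x
    using that UV nb_least openin_subset by fast+
  have VU: "f \<in> carrier (sec (Z U) W)" if W: "openin X W" and f: "f \<in> carrier (sec (Z V) W)" for W f
  proof -
    have f1: "f \<in> carrier (sec (cochains X V 0) W)" and f2: "loc_const X V W (\<lambda>x. f [x])" using f Zin[OF W] by auto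
    have "f \<in> carrier (sec (cochains X U 0) W)" using f1 UV by (fastforce simp: carrier_sky smp_0)
    moreover have "f [y] = f [z]" if yz: "y \<in> W" "z \<in> W" "z \<in> U" "spec_le X y z" for y z
    proof (cases "z \<in> V")
      case False
      then have "y \<notin> V" using UV yz(4) by (auto simp: spec_le_iff)
      then show ?thesis using f2 False by (auto simp: loc_const_def)
    qed (use f2 yz in \<open>auto simp: loc_const_def\<close>)
    ultimately show ?thesis using f2 UV Zin[OF W] by (auto simp: loc_const_def)
  qed
  have hom_VU: "sheaf_hom X (Z V) (Z U) (\<lambda>W f. f)"
    by (intro sheaf_homI homI) (auto simp: VU Zop)
  obtain T where T: "countable T" "\<And>U' S. carrier (sec (cochains X S 0 :: ('x, 'x list \<Rightarrow> int) psh) U') \<subseteq> T"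
    using countable_cochains[OF fs, where 'a = int] by auto
  define sx where "sx x = res I V (nb X x) s" for x
  have sx: "sx x \<in> carrier (sec I (nb X x))" if "x \<in> V" for x
    using res_closed[OF pI _ n(1)[OF nV(2)[OF that]] nV(1)[OF that] s] UV by (simp add: sx_def)
  \<comment> \<open>on stalks, the morphism from \<open>\<int>\<^sub>V\<close> that sends \<open>1\<close> to \<open>s\<close>\<close>
  define h where "h x f = (if x \<in> V then sx x [^]\<^bsub>sec I (nb X x)\<^esub> f [x] else \<one>\<^bsub>sec I (nb X x)\<^esub>)" for x and f :: "'x list \<Rightarrow> int"
  have "\<exists>g. sheaf_hom X (Z U) I g \<and>
     (\<forall>x\<in>topspace X. \<forall>f\<in>carrier (sec (Z V) (nb X x)). g (nb X x) f = h x f)"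
  proof (rule injective_extend[OF fs I Z Z hom_VU T(1)])
    show "carrier (sec (Z U) W) \<subseteq> T" if "openin X W" for W using T(2) Zin[OF that] by blast
    fix x assume x: "x \<in> topspace X"
    interpret G: comm_group "sec I (nb X x)" by (rule sh_comm_group[OF shI n(1)[OF x]])
    show "h x \<in> hom (sec (Z V) (nb X x)) (sec I (nb X x))"
      by (rule homI) (auto simp: h_def Zop sx G.int_pow_mult)
    fix y f assume y: "y \<in> nb X x" and f: "f \<in> carrier (sec (Z V) (nb X x))"
    have yX: "y \<in> topspace X" and le: "spec_le X x y" using y by (auto simp: nb_def dest: spec_le_topspace)
    have xy: "nb X y \<subseteq> nb X x" by (rule nb_mono[OF y])
    have l: "loc_const X V (nb X x) (\<lambda>x. f [x])" using f Zin[OF n(1)[OF x]] by blast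
    have eq: "f [x] = f [y]" if "y \<in> V" using l that y n(2)[OF x] le by (auto simp: loc_const_def)
    show "h y (res (Z V) (nb X x) (nb X y) f) = res I (nb X x) (nb X y) (h x f)"
    proof (cases "x \<in> V")
      case True
      then have yV: "y \<in> V" using le UV by (auto simp: spec_le_iff)
      have "res I (nb X x) (nb X y) (sx x) = sx y"
        unfolding sx_def using UV nV[OF True] n x yX xy s by (intro res_res[OF pI]) auto
      then show ?thesis
        using True yV eq n(2)[OF yX] hom_int_pow[OF res_hom[OF pI n(1)[OF x] n(1)[OF yX] xy] sx[OF True]
            sh_group[OF shI n(1)[OF x]] sh_group[OF shI n(1)[OF yX]]]
        by (simp add: h_def Zop)
    next
      case False
      then have "f [x] = 0" using l by (auto simp: loc_const_def)
      then have "h y (res (Z V) (nb X x) (nb X y) f) = \<one>\<^bsub>sec I (nb X y)\<^esub>"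
        using eq n(2)[OF yX] by (auto simp: h_def Zop int_pow_def nat_pow_def)
      then show ?thesis using False res_one[OF pI n(1)[OF x] n(1)[OF yX] xy] by (simp add: h_def)
    qed
  qed
  then obtain g where g: "sheaf_hom X (Z U) I g"
    "\<And>x f. x \<in> topspace X \<Longrightarrow> f \<in> carrier (sec (Z V) (nb X x)) \<Longrightarrow> g (nb X x) f = h x f" by blast
  define i where "i W = aug (\<lambda>x. if x \<in> W then 1 else (0::int))" for W :: "'x set"
  have i: "i W \<in> carrier (sec (Z S) W)" if "openin X W" "W \<subseteq> S" for S W
  proof -
    have l: "loc_const X S W (\<lambda>x. if x \<in> W then 1 else (0::int))" using that by (auto simp: loc_const_def)
    show ?thesis using aug_closed[OF that(1) l] l Zin[OF that(1)] by (simp add: i_def aug_def)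
  qed
  have U: "openin X U" and V: "openin X V" and sub: "V \<subseteq> U" using UV by auto
  define t where "t = g U (i U)"
  have t: "t \<in> carrier (sec I U)" unfolding t_def by (rule sheaf_hom_closed[OF g(1) U i[OF U order_refl]])
  have "res I U V t = s"
  proof (rule stalk_sep[OF fs shI V _ s])
    show "res I U V t \<in> carrier (sec I V)" by (rule res_closed[OF pI U V sub t])
    fix x assume x: "x \<in> V"
    then have xX: "x \<in> topspace X" and xU: "nb X x \<subseteq> U" using nV sub by auto
    have "res I V (nb X x) (res I U V t) = res I U (nb X x) t"
      using U V n(1)[OF xX] nV(1)[OF x] sub t by (rule res_res[OF pI])
    also have "\<dots> = g (nb X x) (res (Z U) U (nb X x) (i U))"
      unfolding t_def by (rule sheaf_hom_res[OF g(1) U n(1)[OF xX] xU i[OF U order_refl], symmetric])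
    also have "res (Z U) U (nb X x) (i U) = i (nb X x)" using xU by (auto simp: Zop i_def aug_def fun_eq_iff)
    also have "g (nb X x) (i (nb X x)) = h x (i (nb X x))" by (rule g(2)[OF xX i[OF n(1)[OF xX] nV(1)[OF x]]])
    also have "\<dots> = sx x"
      using x n(2)[OF xX] group.int_pow_1[OF sh_group[OF shI n(1)[OF xX]] sx[OF x]] by (simp add: h_def i_def aug_def)
    finally show "res I V (nb X x) (res I U V t) = res I V (nb X x) s" by (simp add: sx_def)
  qed
  then show "\<exists>t\<in>carrier (sec I U). res I U V t = s" using t by blast
qed

section \<open>Existence of injective resolutions\<close>

text \<open>Exactness may be checked on stalks.\<close>

lemma sheaf_exact_stalks:
  assumes fs: "finite_space X" and G: "sheaf X G" and H: "sheaf X H"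
    and \<phi>: "sheaf_hom X F G \<phi>" and \<psi>: "sheaf_hom X G H \<psi>"
    and zero: "\<And>U t. openin X U \<Longrightarrow> t \<in> carrier (sec F U) \<Longrightarrow> \<psi> U (\<phi> U t) = \<one>\<^bsub>sec H U\<^esub>"
    and exact: "\<And>x s. x \<in> topspace X \<Longrightarrow> s \<in> carrier (sec G (nb X x)) \<Longrightarrow>
      \<psi> (nb X x) s = \<one>\<^bsub>sec H (nb X x)\<^esub> \<Longrightarrow> s \<in> \<phi> (nb X x) ` carrier (sec F (nb X x))"
  shows "sheaf_exact X F G H \<phi> \<psi>"
  unfolding sheaf_exact_def
proof (intro allI impI ballI iffI)
  fix U s
  assume U: "openin X U" and s: "s \<in> carrier (sec G U)"
  note pG = sheaf_presheaf[OF G] and pH = sheaf_presheaf[OF H]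
  have n: "openin X (nb X x)" "nb X x \<subseteq> U" "x \<in> topspace X" "x \<in> nb X x" if "x \<in> U" "openin X U" for x U
    using that fs nb_least openin_nb openin_subset nb_self by fast+
  {
    fix x assume x: "x \<in> U" and k: "\<psi> U s = \<one>\<^bsub>sec H U\<^esub>"
    have "\<psi> (nb X x) (res G U (nb X x) s) = \<one>\<^bsub>sec H (nb X x)\<^esub>"
      using sheaf_hom_res[OF \<psi> U n(1,2)[OF x U] s] k res_one[OF pH U n(1,2)[OF x U]] by simp
    then have "res G U (nb X x) s \<in> \<phi> (nb X x) ` carrier (sec F (nb X x))"
      using exact[OF n(3)[OF x U]] res_closed[OF pG U n(1,2)[OF x U] s] by blast
    then show "\<exists>V. openin X V \<and> x \<in> V \<and> V \<subseteq> U \<and> res G U V s \<in> \<phi> V ` carrier (sec F V)"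
      using n[OF x U] by blast
  }
  {
    assume loc: "\<forall>x\<in>U. \<exists>V. openin X V \<and> x \<in> V \<and> V \<subseteq> U \<and> res G U V s \<in> \<phi> V ` carrier (sec F V)"
    have one: "\<one>\<^bsub>sec H U\<^esub> \<in> carrier (sec H U)"
      using sh_group[OF H U] by (simp add: group.is_monoid)
    show "\<psi> U s = \<one>\<^bsub>sec H U\<^esub>"
    proof (rule stalk_sep[OF fs H U sheaf_hom_closed[OF \<psi> U s] one])
      fix x assume x: "x \<in> U"
      obtain V t where V: "openin X V" "x \<in> V" "V \<subseteq> U" and t: "t \<in> carrier (sec F V)" "res G U V s = \<phi> V t"
        using loc x by (auto simp: image_iff)
      note nV = n[OF V(2,1)]
      have "res H U (nb X x) (\<psi> U s) = res H V (nb X x) (res H U V (\<psi> U s))"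
        using res_res[OF pH U V(1) nV(1,2) V(3) sheaf_hom_closed[OF \<psi> U s]] by simp
      also have "res H U V (\<psi> U s) = \<one>\<^bsub>sec H V\<^esub>"
        using sheaf_hom_res[OF \<psi> U V(1,3) s] t zero[OF V(1) t(1)] by simp
      also have "res H V (nb X x) \<one>\<^bsub>sec H V\<^esub> = \<one>\<^bsub>sec H (nb X x)\<^esub>" by (rule res_one[OF pH V(1) nV(1,2)])
      also have "\<dots> = res H U (nb X x) \<one>\<^bsub>sec H U\<^esub>" by (rule res_one[OF pH U n(1,2)[OF x U], symmetric])
      finally show "res H U (nb X x) (\<psi> U s) = res H U (nb X x) \<one>\<^bsub>sec H U\<^esub>" .
    qed
  }
qed

lemma cdiff_additive:
  assumes "\<And>x y. \<phi> (x + y) = \<phi> x + \<phi> y"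
  shows "cdiff X S n U (\<lambda>c. \<phi> (f c)) = (\<lambda>c. \<phi> (cdiff X S n U f c))"
proof -
  have "\<phi> 0 = 0" using assms[of 0 0] by simp
  then show ?thesis by (auto simp: cdiff_def fun_eq_iff delta_additive[of \<phi>, OF assms])
qed

lemma cdiff_add: "cdiff X S n U (\<lambda>c. f c + g c) = (\<lambda>c. cdiff X S n U f c + cdiff X S n U g c)"
  and cdiff_diff: "cdiff X S n U (\<lambda>c. f c - g c) = (\<lambda>c. cdiff X S n U f c - cdiff X S n U g c)"
  and cdiff_uminus: "cdiff X S n U (\<lambda>c. - f c) = (\<lambda>c. - cdiff X S n U f c)"
  and cdiff_0: "cdiff X S n U (\<lambda>c. 0) = (\<lambda>c. 0)"
  by (auto simp: cdiff_def fun_eq_iff delta_add delta_diff delta_uminus delta_0)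

lemma carrier_sky_iff: "f \<in> carrier (sec (sky T b) U) \<longleftrightarrow> (\<forall>c. c \<notin> T \<or> b c \<notin> U \<longrightarrow> f c = 0)"
  unfolding carrier_sky by blast

lemma cochains_add:
  "f \<in> carrier (sec (cochains X S n) U) \<Longrightarrow> g \<in> carrier (sec (cochains X S n) U) \<Longrightarrow>
   (\<lambda>c. f c + g c) \<in> carrier (sec (cochains X S n) U)"
  "f \<in> carrier (sec (cochains X S n) U) \<Longrightarrow> g \<in> carrier (sec (cochains X S n) U) \<Longrightarrow>
   (\<lambda>c. f c - g c) \<in> carrier (sec (cochains X S n) U)"
  "f \<in> carrier (sec (cochains X S n) U) \<Longrightarrow> (\<lambda>c. - f c) \<in> carrier (sec (cochains X S n) U)"
  "(\<lambda>c. 0) \<in> carrier (sec (cochains X S n) U)"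
  unfolding carrier_sky_iff by auto

lemma cochains_mod_int:
  "f \<in> carrier (sec (cochains X S n) U) \<Longrightarrow> (\<lambda>c. mod_int (f c)) \<in> carrier (sec (cochains X S n) U)"
  unfolding carrier_sky_iff by (auto simp: mod_int_0)

text \<open>From the resolution \<open>0 \<rightarrow> \<int> \<rightarrow> \<rat> \<rightarrow> \<rat>/\<int> \<rightarrow> 0\<close> by divisible groups one obtains an injective resolution
  of \<open>\<int>\<^sub>S\<close>: the total complex of the cochains with values in \<open>\<rat>\<close> and in \<open>\<rat>/\<int>\<close>.\<close>

text \<open>The objects, the differential and the augmentation of this total complex; the second component
  carries the cochains with values in \<open>\<rat>/\<int>\<close>.\<close>

definition res_obj :: "'x topology \<Rightarrow> 'x set \<Rightarrow> int \<Rightarrow> ('x, ('x list \<Rightarrow> rat) \<times> ('x list \<Rightarrow> ratz)) psh" where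
  "res_obj X S n = prod_psh (cochains X S n) (cochains X S (n - 1))"

definition res_diff :: "'x topology \<Rightarrow> 'x set \<Rightarrow> int \<Rightarrow> 'x set \<Rightarrow>
    ('x list \<Rightarrow> rat) \<times> ('x list \<Rightarrow> ratz) \<Rightarrow> ('x list \<Rightarrow> rat) \<times> ('x list \<Rightarrow> ratz)" where
  "res_diff X S n U ab =
     (cdiff X S n U (fst ab), \<lambda>c. mod_int (fst ab c) - cdiff X S (n - 1) U (snd ab) c)"

definition res_aug :: "('x \<Rightarrow> int) \<Rightarrow> ('x list \<Rightarrow> rat) \<times> ('x list \<Rightarrow> ratz)" where
  "res_aug u = (aug (\<lambda>x. of_int (u x)), \<lambda>c. 0)"

lemma carrier_res_obj:
  "ab \<in> carrier (sec (res_obj X S n) U) \<longleftrightarrow>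
     fst ab \<in> carrier (sec (cochains X S n) U) \<and> snd ab \<in> carrier (sec (cochains X S (n - 1)) U)"
  and one_res_obj: "\<one>\<^bsub>sec (res_obj X S n) U\<^esub> = (\<lambda>c. 0, \<lambda>c. 0)"
  by (auto simp: res_obj_def mem_Times_iff)

lemma sheaf_res_obj: "sheaf X (res_obj X S n)"
  unfolding res_obj_def by (intro sheaf_prod_psh sheaf_sky)

lemma res_diff_closed:
  assumes "openin X U" "ab \<in> carrier (sec (res_obj X S n) U)"
  shows "res_diff X S n U ab \<in> carrier (sec (res_obj X S (n + 1)) U)"
proof -
  have "cdiff X S (n - 1) U (snd ab) \<in> carrier (sec (cochains X S n) U)"
    using cdiff_closed[OF assms(1), of "snd ab" S "n - 1"] assms(2) by (simp add: carrier_res_obj)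
  with assms(2) show ?thesis
    unfolding carrier_res_obj res_diff_def
    by (simp add: cdiff_closed[OF assms(1)] cochains_add(2)[OF cochains_mod_int])
qed

lemma sheaf_hom_res_diff: "sheaf_hom X (res_obj X S n) (res_obj X S (n + 1)) (res_diff X S n)"
proof (rule sheaf_homI)
  fix U assume U: "openin X U"
  show "res_diff X S n U \<in> hom (sec (res_obj X S n) U) (sec (res_obj X S (n + 1)) U)"
    by (rule homI) (auto simp: res_diff_closed U, auto simp: res_obj_def res_diff_def DirProd_mult cdiff_add mod_int_add fun_eq_iff)
next
  fix U V ab
  assume U: "openin X U" "openin X V" "V \<subseteq> U" and ab: "ab \<in> carrier (sec (res_obj X S n) U)"
  have a: "fst ab \<in> carrier (sec (cochains X S n) U)" and b: "snd ab \<in> carrier (sec (cochains X S (n - 1)) U)"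
    using ab by (auto simp: carrier_res_obj)
  show "res_diff X S n V (res (res_obj X S n) U V ab) = res (res_obj X S (n + 1)) U V (res_diff X S n U ab)"
    using sheaf_hom_res[OF sheaf_hom_cdiff U a] sheaf_hom_res[OF sheaf_hom_cdiff U b] U(3)
    by (auto simp: res_obj_def res_diff_def fun_eq_iff mod_int_0)
qed

lemma res_diff_res_diff:
  assumes S: "convex_pts X S" and U: "openin X U" and ab: "ab \<in> carrier (sec (res_obj X S n) U)"
  shows "res_diff X S (n + 1) U (res_diff X S n U ab) = (\<lambda>c. 0, \<lambda>c. 0)"
proof -
  have a: "fst ab \<in> carrier (sec (cochains X S n) U)" and b: "snd ab \<in> carrier (sec (cochains X S (n - 1)) U)"
    using ab by (auto simp: carrier_res_obj)
  show ?thesis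
    using cdiff_cdiff[OF S U a] cdiff_cdiff[OF S U b]
    by (simp add: res_diff_def cdiff_diff cdiff_additive[of mod_int, OF mod_int_add])
qed

lemma loc_const_map: "loc_const X S U u \<Longrightarrow> \<phi> 0 = 0 \<Longrightarrow> loc_const X S U (\<lambda>x. \<phi> (u x))"
  unfolding loc_const_def by metis

lemma loc_const_lift:
  assumes S: "convex_pts X S" and x: "x \<in> topspace X" and v: "loc_const X S (nb X x) v"
  shows "\<exists>w. loc_const X S (nb X x) w \<and> (\<lambda>y. mod_int (w y)) = v"
proof -
  obtain r where r: "mod_int r = v x" using mod_int_surj by blast
  define w where "w y = (if x \<in> S \<and> y \<in> S \<inter> nb X x then r else 0)" for y
  have vx: "v y = v x" if "y \<in> S \<inter> nb X x" for y
    using v that nb_self[OF x] unfolding loc_const_def nb_def by auto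
  have "loc_const X S (nb X x) w"
    unfolding loc_const_def
  proof (intro conjI allI ballI impI)
    fix y z assume yz: "y \<in> nb X x" "z \<in> nb X x \<inter> S" "spec_le X y z"
    have "y \<in> S" if "x \<in> S" using S that yz unfolding convex_pts_def nb_def by blast
    then show "w y = w z" using yz by (auto simp: w_def)
  qed (auto simp: w_def)
  moreover have "mod_int (w y) = v y" for y
  proof (cases "y \<in> S \<inter> nb X x")
    case True
    moreover have "v x = 0" if "x \<notin> S" using v that by (simp add: loc_const_def)
    ultimately show ?thesis using vx[OF True] r by (auto simp: w_def mod_int_0)
  next
    case False
    then have "v y = 0" using v unfolding loc_const_def by blast
    then show ?thesis using False by (auto simp: w_def mod_int_0)
  qed
  ultimately show ?thesis by blast
qed

text \<open>A cocycle \<open>(a, b)\<close> is first changed into one with \<open>a = 0\<close>; then \<open>b\<close> is a cocycle with values in \<open>\<rat>/\<int>\<close>, which is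
  a coboundary or, in degree \<open>0\<close>, a locally constant function that lifts to \<open>\<rat>\<close>.\<close>

lemma res_diff_exact:
  assumes fs: "finite_space X" and S: "convex_pts X S" and x: "x \<in> topspace X" and n: "n > 0"
    and ab: "ab \<in> carrier (sec (res_obj X S n) (nb X x))" and d: "res_diff X S n (nb X x) ab = (\<lambda>c. 0, \<lambda>c. 0)"
  shows "ab \<in> res_diff X S (n - 1) (nb X x) ` carrier (sec (res_obj X S (n - 1)) (nb X x))"
proof -
  let ?N = "nb X x"
  have N: "openin X ?N" by (rule openin_nb[OF fs x])
  obtain a b where eq: "ab = (a, b)" by (cases ab)
  have a: "a \<in> carrier (sec (cochains X S n) ?N)" and b: "b \<in> carrier (sec (cochains X S (n - 1)) ?N)"
    and da: "cdiff X S n ?N a = (\<lambda>c. 0)" and db: "cdiff X S (n - 1) ?N b = (\<lambda>c. mod_int (a c))"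
    using ab d by (auto simp: eq carrier_res_obj res_diff_def fun_eq_iff)
  obtain a' where a': "a' \<in> carrier (sec (cochains X S (n - 1)) ?N)" "cdiff X S (n - 1) ?N a' = a"
    using cdiff_exact[OF fs x n a da] by blast
  define b' where "b' = (\<lambda>c. b c - mod_int (a' c))"
  have b': "b' \<in> carrier (sec (cochains X S (n - 1)) ?N)"
    unfolding b'_def by (rule cochains_add(2)[OF b cochains_mod_int[OF a'(1)]])
  have db': "cdiff X S (n - 1) ?N b' = (\<lambda>c. 0)"
    by (simp add: b'_def cdiff_diff cdiff_additive[of mod_int, OF mod_int_add] db a'(2))
  show ?thesis
  proof (cases "n - 1 > 0")
    case True
    obtain b'' where b'': "b'' \<in> carrier (sec (cochains X S (n - 1 - 1)) ?N)" "cdiff X S (n - 1 - 1) ?N b'' = b'"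
      using cdiff_exact[OF fs x True b' db'] by blast
    show ?thesis
    proof (rule image_eqI)
      show "ab = res_diff X S (n - 1) ?N (a', \<lambda>c. - b'' c)"
        using a'(2) b''(2) by (simp add: eq res_diff_def cdiff_uminus b'_def)
      show "(a', \<lambda>c. - b'' c) \<in> carrier (sec (res_obj X S (n - 1)) ?N)"
        using a'(1) cochains_add(3)[OF b''(1)] by (simp add: carrier_res_obj)
    qed
  next
    case False
    then have n1: "n = 1" using n by simp
    obtain v where v: "loc_const X S ?N v" "aug v = b'" using cdiff_0_aug[OF N, of b' S] b' db' n1 by auto
    obtain w where w: "loc_const X S ?N w" "(\<lambda>y. mod_int (w y)) = v" using loc_const_lift[OF S x v(1)] by blast
    have "mod_int (aug w c) = b' c" for c using w(2) v(2) by (auto simp: aug_def mod_int_0)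
    then have "b = (\<lambda>c. mod_int (a' c + aug w c))" by (simp add: b'_def mod_int_add)
    moreover have "cdiff X S 0 ?N (\<lambda>c. a' c + aug w c) = a"
      using a'(2) n1 cdiff_aug[OF N w(1)] by (simp add: cdiff_add)
    ultimately have *: "ab = res_diff X S (n - 1) ?N (\<lambda>c. a' c + aug w c, \<lambda>c. 0)"
      by (simp add: eq res_diff_def n1 cdiff_0)
    have "(\<lambda>c. a' c + aug w c, \<lambda>c. 0) \<in> carrier (sec (res_obj X S (n - 1)) ?N)"
      using cochains_add(1)[OF a'(1)[unfolded n1] , of "aug w"] aug_closed[OF N w(1)] n1
      by (simp add: carrier_res_obj cochains_add(4))
    then show ?thesis using * by blast
  qed
qed

lemma res_aug_closed:
  "openin X U \<Longrightarrow> loc_const X S U u \<Longrightarrow> res_aug u \<in> carrier (sec (res_obj X S 0) U)"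
  using aug_closed[OF _ loc_const_map[of X S U u rat_of_int]] by (simp add: res_aug_def carrier_res_obj cochains_add(4))

lemma res_diff_aug:
  assumes "openin X U" "loc_const X S U u"
  shows "res_diff X S 0 U (res_aug u) = (\<lambda>c. 0, \<lambda>c. 0)"
proof -
  have "mod_int (aug (\<lambda>x. rat_of_int (u x)) c) = 0" for c
    by (auto simp: aug_def mod_int_eq_0)
  then show ?thesis
    using cdiff_aug[OF assms(1) loc_const_map[OF assms(2), of rat_of_int]]
    by (simp add: res_diff_def res_aug_def cdiff_0)
qed

lemma res_diff_0_exact:
  assumes U: "openin X U" and ab: "ab \<in> carrier (sec (res_obj X S 0) U)"
    and d: "res_diff X S 0 U ab = (\<lambda>c. 0, \<lambda>c. 0)"
  shows "\<exists>u. loc_const X S U u \<and> ab = res_aug u"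
proof -
  obtain a b where eq: "ab = (a, b)" by (cases ab)
  have a: "a \<in> carrier (sec (cochains X S 0) U)" and b: "b = (\<lambda>c. 0)"
    using ab cochains_neg[of "-1" b X S U] by (auto simp: eq carrier_res_obj)
  have da: "cdiff X S 0 U a = (\<lambda>c. 0)" and ma: "\<And>c. mod_int (a c) = 0"
    using d by (auto simp: eq res_diff_def b cdiff_0 fun_eq_iff)
  obtain v where v: "loc_const X S U v" "aug v = a" using cdiff_0_aug[OF U a da] by blast
  have "v x \<in> \<int>" for x using ma[of "[x]"] v(2) by (auto simp: aug_def mod_int_eq_0)
  then have iv: "of_int \<lfloor>v x\<rfloor> = v x" for x by (metis Ints_cases floor_of_int)
  have "loc_const X S U (\<lambda>x. \<lfloor>v x\<rfloor>)" by (rule loc_const_map[OF v(1)]) simp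
  moreover have "ab = res_aug (\<lambda>x. \<lfloor>v x\<rfloor>)" using v(2) by (simp add: eq b res_aug_def iv)
  ultimately show ?thesis by blast
qed

lemma ex_injective_resolution:
  fixes X :: "'x topology"
  assumes fs: "finite_space X" and S: "convex_pts X S"
  shows "\<exists>R :: ('x, 'x \<Rightarrow> int, 'u::infinite) resolution. injective_resolution X (int_sheaf_on X S) R"
proof -
  obtain T1 where T1: "countable T1" "\<And>S n U. carrier (sec (cochains X S n :: ('x, 'x list \<Rightarrow> rat) psh) U) \<subseteq> T1"
    using countable_cochains[OF fs, where 'a = rat] by auto
  obtain T2 where T2: "countable T2" "\<And>S n U. carrier (sec (cochains X S n :: ('x, 'x list \<Rightarrow> ratz) psh) U) \<subseteq> T2"
    using countable_cochains[OF fs, where 'a = ratz] countable_ratz by auto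
  obtain e :: "_ \<Rightarrow> 'u" and e' where ee: "\<And>s. s \<in> T1 \<times> T2 \<Longrightarrow> e' (e s) = s"
    using countable_code[OF countable_SIGMA[OF T1(1) T2(1)]] by blast
  have inv: "e' (e ab) = ab" if "ab \<in> carrier (sec (res_obj X S n) U)" for n U ab
    using that subsetD[OF T1(2)] subsetD[OF T2(2)] by (intro ee) (auto simp: carrier_res_obj mem_Times_iff)
  let ?I = "\<lambda>n. trans_psh e e' (res_obj X S n)"
  let ?d = "\<lambda>n U s. e (res_diff X S n U (e' s))"
  let ?a = "\<lambda>U u. e (res_aug u)"
  define R :: "('x, 'x \<Rightarrow> int, 'u) resolution" where "R = \<lparr>robj = ?I, rdiff = ?d, raug = ?a\<rparr>"
  have sh: "sheaf X (?I n)" for n by (rule sheaf_trans_psh[where e' = e' and e = e, OF sheaf_res_obj inv])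
  have inj: "injective_sheaf X (?I n)" for n
    unfolding injective_sheaf_iff
  proof
    have "extends_homs TYPE('u) X (res_obj X S n)"
      unfolding res_obj_def
      by (intro extends_homs_prod_psh extends_homs_sky fs divisible_rat divisible_ratz smp_hd)
    from extends_homs_trans_psh[where e' = e' and e = e, OF sheaf_res_obj _ this]
    show "extends_homs TYPE('u) X (?I n)" using inv by blast
  qed (rule sh)
  have dh: "sheaf_hom X (?I n) (?I (n + 1)) (?d n)" for n
    by (rule sheaf_hom_comp[OF sheaf_hom_comp[OF sheaf_hom_from_trans[where e' = e' and e = e, OF sheaf_res_obj inv]
            sheaf_hom_res_diff] sheaf_hom_to_trans[where e' = e' and e = e, OF sheaf_res_obj inv]])
  have dd: "?d (n + 1) U (?d n U s) = \<one>\<^bsub>sec (?I (n + 2)) U\<^esub>"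
    if U: "openin X U" and s: "s \<in> carrier (sec (?I n) U)" for n U s
  proof -
    obtain ab where ab: "ab \<in> carrier (sec (res_obj X S n) U)" "s = e ab" using s by (auto simp: sec_trans_psh)
    then show ?thesis
      using res_diff_res_diff[OF S U ab(1)] by (simp add: inv[OF ab(1)] inv[OF res_diff_closed[OF U ab(1)]]
          sec_trans_psh one_res_obj)
  qed
  have lc: "u \<in> carrier (sec (int_sheaf_on X S) U) \<longleftrightarrow> loc_const X S U u" if "openin X U" for u U
    by (rule carrier_int_sheaf_on[OF fs that])
  have ah: "sheaf_hom X (int_sheaf_on X S) (?I 0) ?a"
  proof (rule sheaf_homI)
    fix U assume U: "openin X U"
    have "res_aug (\<lambda>x. u x + v x) = res_aug u \<otimes>\<^bsub>sec (res_obj X S 0) U\<^esub> res_aug v" for u v :: "'x \<Rightarrow> int"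
      by (auto simp: res_obj_def res_aug_def aug_def fun_eq_iff)
    then show "?a U \<in> hom (sec (int_sheaf_on X S) U) (sec (?I 0) U)"
      by (intro homI) (auto simp: lc[OF U] sec_trans_psh inv[OF res_aug_closed[OF U]] res_aug_closed[OF U])
  next
    fix U V u assume U: "openin X U" "openin X V" "V \<subseteq> U" and u: "u \<in> carrier (sec (int_sheaf_on X S) U)"
    have "res_aug (\<lambda>x. if x \<in> V then u x else 0) = res (res_obj X S 0) U V (res_aug u)"
      by (auto simp: res_obj_def res_aug_def aug_def fun_eq_iff)
    then show "?a V (res (int_sheaf_on X S) U V u) = res (?I 0) U V (?a U u)"
      using u by (simp add: sec_trans_psh lc[OF U(1)] inv[OF res_aug_closed[OF U(1)]])
  qed
  have am: "sheaf_mono X (int_sheaf_on X S) (?I 0) ?a"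
    unfolding sheaf_mono_def
  proof (intro conjI ah allI impI inj_onI)
    fix U and u v :: "'x \<Rightarrow> int"
    assume U: "openin X U" and uv: "u \<in> carrier (sec (int_sheaf_on X S) U)" "v \<in> carrier (sec (int_sheaf_on X S) U)"
      and eq: "?a U u = ?a U v"
    then have "e' (e (res_aug u)) = e' (e (res_aug v))" by simp
    then have "res_aug u = res_aug v" using uv by (simp add: lc[OF U] inv[OF res_aug_closed[OF U]])
    then have "(\<lambda>x. rat_of_int (u x)) = (\<lambda>x. rat_of_int (v x))" by (auto simp: res_aug_def dest: aug_inj)
    then show "u = v" by (auto simp: fun_eq_iff)
  qed
  have e0: "sheaf_exact X (int_sheaf_on X S) (?I 0) (?I 1) ?a (?d 0)"
  proof (rule sheaf_exact_stalks[OF fs sh sh ah])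
    show "sheaf_hom X (?I 0) (?I 1) (?d 0)" using dh[of 0] by simp
    show "?d 0 U (?a U u) = \<one>\<^bsub>sec (?I 1) U\<^esub>" if U: "openin X U" "u \<in> carrier (sec (int_sheaf_on X S) U)" for U u
      using U(2) lc[OF U(1)] by (simp add: inv[OF res_aug_closed[OF U(1)]] res_diff_aug[OF U(1)] sec_trans_psh one_res_obj)
    fix x s assume x: "x \<in> topspace X" and s: "s \<in> carrier (sec (?I 0) (nb X x))"
      and k: "?d 0 (nb X x) s = \<one>\<^bsub>sec (?I 1) (nb X x)\<^esub>"
    have N: "openin X (nb X x)" by (rule openin_nb[OF fs x])
    obtain ab where ab: "ab \<in> carrier (sec (res_obj X S 0) (nb X x))" "s = e ab" using s by (auto simp: sec_trans_psh)
    have c: "res_diff X S 0 (nb X x) ab \<in> carrier (sec (res_obj X S 1) (nb X x))"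
      using res_diff_closed[OF N ab(1)] by simp
    have o: "(\<lambda>c. 0, \<lambda>c. 0) \<in> carrier (sec (res_obj X S 1) (nb X x))"
      by (simp add: carrier_res_obj cochains_add(4))
    have "e' (e (res_diff X S 0 (nb X x) ab)) = e' (e (\<lambda>c. 0, \<lambda>c. 0))"
      using k ab by (simp add: sec_trans_psh one_res_obj inv[OF ab(1)])
    then have "res_diff X S 0 (nb X x) ab = (\<lambda>c. 0, \<lambda>c. 0)" unfolding inv[OF c] inv[OF o] .
    then obtain u where "loc_const X S (nb X x) u" "ab = res_aug u" using res_diff_0_exact[OF N ab(1)] by blast
    then show "s \<in> ?a (nb X x) ` carrier (sec (int_sheaf_on X S) (nb X x))" using ab(2) lc[OF N] by auto
  qed
  have en: "sheaf_exact X (?I n) (?I (n + 1)) (?I (n + 2)) (?d n) (?d (n + 1))" if n: "n \<ge> 0" for n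
  proof (rule sheaf_exact_stalks[OF fs sh sh dh])
    show "sheaf_hom X (?I (n + 1)) (?I (n + 2)) (?d (n + 1))" using dh[of "n + 1"] by (simp add: add.assoc)
    show "?d (n + 1) U (?d n U s) = \<one>\<^bsub>sec (?I (n + 2)) U\<^esub>" if "openin X U" "s \<in> carrier (sec (?I n) U)" for U s
      by (rule dd[OF that])
    fix x s assume x: "x \<in> topspace X" and s: "s \<in> carrier (sec (?I (n + 1)) (nb X x))"
      and k: "?d (n + 1) (nb X x) s = \<one>\<^bsub>sec (?I (n + 2)) (nb X x)\<^esub>"
    have N: "openin X (nb X x)" by (rule openin_nb[OF fs x])
    obtain ab where ab: "ab \<in> carrier (sec (res_obj X S (n + 1)) (nb X x))" "s = e ab" using s by (auto simp: sec_trans_psh)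
    have c: "res_diff X S (n + 1) (nb X x) ab \<in> carrier (sec (res_obj X S (n + 2)) (nb X x))"
      using res_diff_closed[OF N ab(1)] by (simp add: add.assoc)
    have o: "(\<lambda>c. 0, \<lambda>c. 0) \<in> carrier (sec (res_obj X S (n + 2)) (nb X x))"
      by (simp add: carrier_res_obj cochains_add(4))
    have "e' (e (res_diff X S (n + 1) (nb X x) ab)) = e' (e (\<lambda>c. 0, \<lambda>c. 0))"
      using k ab by (simp add: sec_trans_psh one_res_obj inv[OF ab(1)])
    then have "res_diff X S (n + 1) (nb X x) ab = (\<lambda>c. 0, \<lambda>c. 0)" unfolding inv[OF c] inv[OF o] .
    from res_diff_exact[OF fs S x _ ab(1) this] n
    obtain cd where cd: "cd \<in> carrier (sec (res_obj X S n) (nb X x))" "ab = res_diff X S n (nb X x) cd" by auto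
    then show "s \<in> ?d n (nb X x) ` carrier (sec (?I n) (nb X x))"
      using ab(2) by (auto simp: sec_trans_psh inv[OF cd(1)] intro!: image_eqI[of _ _ "e cd"])
  qed
  have "trivial_group (sec (?I n) U)" if n: "n < 0" and U: "openin X U" for n U
    unfolding trivial_group_def
  proof
    show "group (sec (?I n) U)" by (rule sh_group[OF sh U])
    have "ab = (\<lambda>c. 0, \<lambda>c. 0)" if "ab \<in> carrier (sec (res_obj X S n) U)" for ab
      using that cochains_neg[of n "fst ab" X S U] cochains_neg[of "n - 1" "snd ab" X S U] n
      by (auto simp: carrier_res_obj prod_eq_iff)
    moreover have "(\<lambda>c. 0, \<lambda>c. 0) \<in> carrier (sec (res_obj X S n) U)"
      by (simp add: carrier_res_obj cochains_add(4))
    ultimately have "carrier (sec (res_obj X S n) U) = {(\<lambda>c. 0, \<lambda>c. 0)}" by blast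
    then show "carrier (sec (?I n) U) = {\<one>\<^bsub>sec (?I n) U\<^esub>}" by (simp add: sec_trans_psh one_res_obj)
  qed
  then have "injective_resolution X (int_sheaf_on X S) R"
    unfolding injective_resolution_def R_def using inj dh am e0 en by simp
  then show ?thesis by blast
qed

section \<open>Exact complexes of flabby sheaves\<close>

lemma ex_minimal_point:
  assumes fs: "finite_space X" and U: "openin X U" "U \<noteq> {}"
  shows "\<exists>x\<in>U. openin X (U - {x})"
proof -
  have fin: "finite U" using fs openin_subset[OF U(1)] by (auto simp: finite_space_def intro: finite_subset)
  have finN: "finite (nb X y)" for y
    using fs nb_topspace(1)[of _ X y] by (auto simp: finite_space_def intro: finite_subset)
  \<comment> \<open>a point whose smallest open neighbourhood has the most elements is minimal\<close>
  obtain x where x: "x \<in> U" "\<And>y. y \<in> U \<Longrightarrow> card (nb X y) \<le> card (nb X x)"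
  proof -
    have "Max ((\<lambda>y. card (nb X y)) ` U) \<in> (\<lambda>y. card (nb X y)) ` U" using fin U(2) by simp
    then obtain x where "x \<in> U" "card (nb X x) = Max ((\<lambda>y. card (nb X y)) ` U)" by auto
    then show thesis using that fin by simp
  qed
  have "y = x" if "y \<in> U" "spec_le X y x" for y
  proof -
    have "nb X x \<subseteq> nb X y" using that(2) by (intro nb_mono) (simp add: nb_def)
    then have "nb X x = nb X y" using x(2)[OF that(1)] finN card_seteq by metis
    then show ?thesis using nb_inj[OF fs] spec_le_topspace[OF that(2)] by metis
  qed
  then have "openin X (U - {x})"
    using U(1) by (auto simp: openin_iff_upper[OF fs])
  then show ?thesis using x(1) by blast
qed

text \<open>A complex of flabby sheaves that is exact on stalks is exact on sections over every open set.
  This is a Mayer-Vietoris induction: a minimal point \<open>x\<close> of \<open>U\<close> gives the open cover of \<open>U\<close> by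
  \<open>U - {x}\<close> and \<open>nb X x\<close>, whose intersection is \<open>nb X x - {x}\<close>.\<close>

lemma flabby_complex_exact:
  fixes K :: "int \<Rightarrow> ('x, 'w) psh"
  assumes fs: "finite_space X" and sh: "\<And>n. sheaf X (K n)" and fl: "\<And>n. flabby X (K n)"
    and d: "\<And>n. sheaf_hom X (K n) (K (n + 1)) (d n)"
    and dd: "\<And>n U z. openin X U \<Longrightarrow> z \<in> carrier (sec (K n) U) \<Longrightarrow> d (n + 1) U (d n U z) = \<one>\<^bsub>sec (K (n + 2)) U\<^esub>"
    and stalk: "\<And>n x z. x \<in> topspace X \<Longrightarrow> z \<in> carrier (sec (K n) (nb X x)) \<Longrightarrow>
       d n (nb X x) z = \<one>\<^bsub>sec (K (n + 1)) (nb X x)\<^esub> \<Longrightarrow>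
       \<exists>y\<in>carrier (sec (K (n - 1)) (nb X x)). d (n - 1) (nb X x) y = z"
    and U: "openin X U" and z: "z \<in> carrier (sec (K n) U)" and dz: "d n U z = \<one>\<^bsub>sec (K (n + 1)) U\<^esub>"
  shows "\<exists>y\<in>carrier (sec (K (n - 1)) U). d (n - 1) U y = z"
  using U z dz
proof (induction "card U" arbitrary: U n z rule: less_induct)
  case less
  note U = less.prems(1) and z = less.prems(2) and dz = less.prems(3)
  define m where "m = n - 1"
  define k where "k = n - 2"
  have dm: "sheaf_hom X (K m) (K n) (d m)" using d[of m] by (simp add: m_def)
  have dk: "sheaf_hom X (K k) (K m) (d k)" using d[of k] by (simp add: m_def k_def)
  have dn: "sheaf_hom X (K n) (K (n + 1)) (d n)" by (rule d)
  have ddk: "d m W (d k W y) = \<one>\<^bsub>sec (K n) W\<^esub>" if "openin X W" "y \<in> carrier (sec (K k) W)" for W y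
    using dd[OF that] by (simp add: m_def k_def)
  note p = sheaf_presheaf[OF sh]
  have fin: "finite U" using fs openin_subset[OF U] by (auto simp: finite_space_def intro: finite_subset)
  show ?case
  proof (cases "U = {}")
    case True
    have one: "\<one>\<^bsub>sec (K m) U\<^esub> \<in> carrier (sec (K m) U)"
      using sh_group[OF sh U] by (simp add: group.is_monoid)
    have "d m U \<one>\<^bsub>sec (K m) U\<^esub> = z"
      by (rule stalk_sep[OF fs sh U sheaf_hom_closed[OF dm U one] z]) (simp add: True)
    then show ?thesis using one by (auto simp: m_def)
  next
    case False
    obtain x where x: "x \<in> U" and V: "openin X (U - {x})" using ex_minimal_point[OF fs U False] by blast
    define V where "V = U - {x}"
    define N where "N = nb X x"
    define L where "L = N - {x}"
    have xX: "x \<in> topspace X" using x openin_subset[OF U] by blast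
    have oV: "openin X V" and VU: "V \<subseteq> U" using V by (auto simp: V_def)
    have oN: "openin X N" unfolding N_def by (rule openin_nb[OF fs xX])
    have NU: "N \<subseteq> U" unfolding N_def by (rule nb_least[OF U x])
    have xN: "x \<in> N" unfolding N_def by (rule nb_self[OF xX])
    have L_eq: "L = V \<inter> N" using NU by (auto simp: L_def V_def)
    have oL: "openin X L" unfolding L_eq by (rule openin_Int[OF oV oN])
    have LV: "L \<subseteq> V" and LN: "L \<subseteq> N" by (auto simp: L_eq)
    have VN: "V \<union> N = U" using VU NU xN by (auto simp: V_def)
    have cV: "card V < card U" using card_Diff1_less[OF fin x] by (simp add: V_def)
    have "card L \<le> card V" using LV fin VU by (meson card_mono finite_subset)
    then have cL: "card L < card U" using cV by simp
    have rz: "d n W (res (K n) U W z) = \<one>\<^bsub>sec (K (n + 1)) W\<^esub>" if "openin X W" "W \<subseteq> U" for W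
      using sheaf_hom_res[OF dn U that z] res_one[OF p U that] dz by simp
    obtain a where a: "a \<in> carrier (sec (K m) V)" "d m V a = res (K n) U V z"
      using less.hyps[OF cV oV res_closed[OF p U oV VU z] rz[OF oV VU]] by (auto simp: m_def)
    obtain b where b: "b \<in> carrier (sec (K m) N)" "d m N b = res (K n) U N z"
      using stalk[OF xX, of "res (K n) U N z" n] res_closed[OF p U oN NU z] rz[OF oN NU]
      unfolding N_def m_def by blast
    interpret M: comm_group "sec (K m) L" by (rule sh_comm_group[OF sh oL])
    interpret NL: comm_group "sec (K n) L" by (rule sh_comm_group[OF sh oL])
    interpret MV: comm_group "sec (K m) V" by (rule sh_comm_group[OF sh oV])
    interpret NV: comm_group "sec (K n) V" by (rule sh_comm_group[OF sh oV])
    define aL where "aL = res (K m) V L a"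
    define bL where "bL = res (K m) N L b"
    have aL: "aL \<in> carrier (sec (K m) L)" unfolding aL_def by (rule res_closed[OF p oV oL LV a(1)])
    have bL: "bL \<in> carrier (sec (K m) L)" unfolding bL_def by (rule res_closed[OF p oN oL LN b(1)])
    have daL: "d m L aL = res (K n) U L z"
      unfolding aL_def using sheaf_hom_res[OF dm oV oL LV a(1)] a(2) res_res[OF p U oV oL LV VU z] by simp
    have dbL: "d m L bL = res (K n) U L z"
      unfolding bL_def using sheaf_hom_res[OF dm oN oL LN b(1)] b(2) res_res[OF p U oN oL LN NU z] by simp
    \<comment> \<open>the preimages \<open>a\<close> and \<open>b\<close> of \<open>z\<close> differ on \<open>L\<close> by a cocycle, hence by the coboundary of some \<open>c\<close>; an extension
      of \<open>c\<close> to \<open>V\<close> is used to correct \<open>a\<close> so that it glues with \<open>b\<close>\<close>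
    define w where "w = aL \<otimes>\<^bsub>sec (K m) L\<^esub> inv\<^bsub>sec (K m) L\<^esub> bL"
    have w: "w \<in> carrier (sec (K m) L)" using aL bL by (simp add: w_def)
    have "d m L w = \<one>\<^bsub>sec (K n) L\<^esub>"
      using aL bL daL dbL sheaf_hom_closed[OF dm oL bL]
      by (simp add: w_def sheaf_hom_mult[OF dm oL] sheaf_hom_inv[OF dm sh sh oL])
    then obtain c where c: "c \<in> carrier (sec (K k) L)" "d k L c = w"
      using less.hyps[OF cL oL w] by (auto simp: m_def k_def)
    obtain c' where c': "c' \<in> carrier (sec (K k) V)" "res (K k) V L c' = c"
      using fl[of k] oV oL LV c(1) unfolding flabby_def by blast
    define e where "e = d k V c'"
    have e: "e \<in> carrier (sec (K m) V)" unfolding e_def by (rule sheaf_hom_closed[OF dk oV c'(1)])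
    have eL: "res (K m) V L e = w"
      unfolding e_def using sheaf_hom_res[OF dk oV oL LV c'(1)] c' c(2) by simp
    define a' where "a' = a \<otimes>\<^bsub>sec (K m) V\<^esub> inv\<^bsub>sec (K m) V\<^esub> e"
    have a': "a' \<in> carrier (sec (K m) V)" using a(1) e by (simp add: a'_def)
    have da': "d m V a' = res (K n) U V z"
      using a e ddk[OF oV c'(1)] res_closed[OF p U oV VU z]
      by (simp add: a'_def e_def[symmetric] sheaf_hom_mult[OF dm oV] sheaf_hom_inv[OF dm sh sh oV])
    have "res (K m) V L a' = aL \<otimes>\<^bsub>sec (K m) L\<^esub> inv\<^bsub>sec (K m) L\<^esub> w"
      using a(1) e eL by (simp add: a'_def res_mult[OF p oV oL LV] res_inv[OF p oV oL LV] aL_def)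
    also have "\<dots> = bL"
      using aL bL by (simp add: w_def M.inv_mult M.m_assoc[symmetric])
    finally have glue: "res (K m) V L a' = res (K m) N L b" by (simp add: bL_def)
    let ?U = "\<lambda>i. if i then V else N"
    have "\<exists>!y. y \<in> carrier (sec (K m) U) \<and> (\<forall>i\<in>UNIV. res (K m) U (?U i) y = (if i then a' else b))"
    proof (rule sheaf_glue[OF sh])
      show "res (K m) (?U i) (?U i \<inter> ?U j) (if i then a' else b) = res (K m) (?U j) (?U i \<inter> ?U j) (if j then a' else b)" for i j
        using glue by (cases i; cases j) (auto simp: L_eq Int_commute)
      show "(\<Union>i. ?U i) = U" using VN by (auto split: if_splits)
    qed (use oV oN a' b in auto)
    then obtain y where y: "y \<in> carrier (sec (K m) U)" and yr: "\<And>i. res (K m) U (?U i) y = (if i then a' else b)" by blast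
    have yV: "res (K m) U V y = a'" and yN: "res (K m) U N y = b" using yr[of True] yr[of False] by auto
    have "d m U y = z"
    proof (rule sheaf_sep[OF sh, of UNIV ?U])
      show "(\<Union>i. ?U i) = U" using VN by (auto split: if_splits)
      show "res (K n) U (?U i) (d m U y) = res (K n) U (?U i) z" for i
        using sheaf_hom_res[OF dm U oV VU y] sheaf_hom_res[OF dm U oN NU y] yV yN da' b(2) by (cases i) auto
    qed (use oV oN z sheaf_hom_closed[OF dm U y] in auto)
    then show ?thesis using y by (auto simp: m_def)
  qed
qed

section \<open>Comparison of cochains with an injective resolution\<close>

lemma sheaf_exact_zero:
  assumes "sheaf_exact X F G H \<phi> \<psi>" "presheaf X G" "sheaf_hom X F G \<phi>" "openin X U" "t \<in> carrier (sec F U)"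
  shows "\<psi> U (\<phi> U t) = \<one>\<^bsub>sec H U\<^esub>"
proof -
  have c: "\<phi> U t \<in> carrier (sec G U)" by (rule sheaf_hom_closed[OF assms(3-5)])
  have "\<exists>V. openin X V \<and> x \<in> V \<and> V \<subseteq> U \<and> res G U V (\<phi> U t) \<in> \<phi> V ` carrier (sec F V)" if "x \<in> U" for x
    using res_id[OF assms(2,4) c] assms(4,5) that by (intro exI[of _ U]) auto
  then show ?thesis using assms(1)[unfolded sheaf_exact_def, rule_format, OF assms(4) c] by blast
qed

lemma sheaf_exact_stalk:
  assumes "sheaf_exact X F G H \<phi> \<psi>" "presheaf X G" "finite_space X" "x \<in> topspace X"
    "s \<in> carrier (sec G (nb X x))" "\<psi> (nb X x) s = \<one>\<^bsub>sec H (nb X x)\<^esub>"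
  shows "\<exists>t\<in>carrier (sec F (nb X x)). \<phi> (nb X x) t = s"
proof -
  have N: "openin X (nb X x)" by (rule openin_nb[OF assms(3,4)])
  have "\<forall>y\<in>nb X x. \<exists>V. openin X V \<and> y \<in> V \<and> V \<subseteq> nb X x \<and> res G (nb X x) V s \<in> \<phi> V ` carrier (sec F V)"
    using assms(1)[unfolded sheaf_exact_def, rule_format, OF N assms(5)] assms(6) by blast
  from bspec[OF this nb_self[OF assms(4)]] obtain V
    where V: "openin X V" "x \<in> V" "V \<subseteq> nb X x" "res G (nb X x) V s \<in> \<phi> V ` carrier (sec F V)" by blast
  then have "V = nb X x" using nb_least[OF V(1,2)] by blast
  then show ?thesis using V(4) res_id[OF assms(2) N assms(5)] by auto
qed

text \<open>An injective resolution \<open>I\<close> of \<open>\<int>\<^sub>S\<close>, together with the complex \<open>G\<close> of integer cochains.\<close>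

locale int_resolution =
  fixes X :: "'x topology" and S :: "'x set" and R :: "('x, 'x \<Rightarrow> int, 'u::infinite) resolution"
  assumes fs: "finite_space X" and S: "convex_pts X S"
    and R: "injective_resolution X (int_sheaf_on X S) R"
begin

abbreviation I where "I \<equiv> robj R"
abbreviation dI where "dI \<equiv> rdiff R"
abbreviation G :: "int \<Rightarrow> ('x, 'x list \<Rightarrow> int) psh" where "G n \<equiv> cochains X S n"
abbreviation dG :: "int \<Rightarrow> 'x set \<Rightarrow> ('x list \<Rightarrow> int) \<Rightarrow> 'x list \<Rightarrow> int" where "dG n \<equiv> cdiff X S n"

lemma inj_I: "injective_sheaf X (I n)"
  and neg_I: "n < 0 \<Longrightarrow> openin X U \<Longrightarrow> trivial_group (sec (I n) U)"
  and hom_dI: "sheaf_hom X (I n) (I (n + 1)) (dI n)"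
  and mono_aug: "sheaf_mono X (int_sheaf_on X S) (I 0) (raug R)"
  and exact_0: "sheaf_exact X (int_sheaf_on X S) (I 0) (I 1) (raug R) (dI 0)"
  and exact_n: "n \<ge> 0 \<Longrightarrow> sheaf_exact X (I n) (I (n + 1)) (I (n + 2)) (dI n) (dI (n + 1))"
  using R by (auto simp: injective_resolution_def)

lemma sheaf_I: "sheaf X (I n)"
  using inj_I by (simp add: injective_sheaf_def)

lemmas psh_I = sheaf_presheaf[OF sheaf_I]

lemma flabby_I: "flabby X (I n)"
  by (rule flabby_injective[OF fs inj_I])

lemma one_I: "openin X U \<Longrightarrow> \<one>\<^bsub>sec (I n) U\<^esub> \<in> carrier (sec (I n) U)"
  using sh_group[OF sheaf_I] by (simp add: group.is_monoid)

lemma neg_I_eq: "n < 0 \<Longrightarrow> openin X U \<Longrightarrow> s \<in> carrier (sec (I n) U) \<Longrightarrow> s = \<one>\<^bsub>sec (I n) U\<^esub>"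
  using neg_I by (fastforce simp: trivial_group_def)

lemma hom_aug: "sheaf_hom X (int_sheaf_on X S) (I 0) (raug R)"
  and inj_aug: "openin X U \<Longrightarrow> inj_on (raug R U) (carrier (sec (int_sheaf_on X S) U))"
  using mono_aug by (auto simp: sheaf_mono_def)

lemma carrier_Z: "openin X U \<Longrightarrow> u \<in> carrier (sec (int_sheaf_on X S) U) \<longleftrightarrow> loc_const X S U u"
  by (rule carrier_int_sheaf_on[OF fs])

lemma aug_I_closed: "openin X U \<Longrightarrow> loc_const X S U u \<Longrightarrow> raug R U u \<in> carrier (sec (I 0) U)"
  using sheaf_hom_closed[OF hom_aug] carrier_Z by blast

lemma dI_aug: "openin X U \<Longrightarrow> loc_const X S U u \<Longrightarrow> dI 0 U (raug R U u) = \<one>\<^bsub>sec (I 1) U\<^esub>"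
  using sheaf_exact_zero[OF exact_0 psh_I hom_aug] carrier_Z by blast

lemma dI_dI:
  assumes U: "openin X U" and s: "s \<in> carrier (sec (I n) U)"
  shows "dI (n + 1) U (dI n U s) = \<one>\<^bsub>sec (I (n + 2)) U\<^esub>"
proof (cases "n \<ge> 0")
  case True
  then show ?thesis using sheaf_exact_zero[OF exact_n psh_I hom_dI U s] by simp
next
  case False
  then have "s = \<one>\<^bsub>sec (I n) U\<^esub>" using neg_I_eq[OF _ U s] by simp
  then show ?thesis
    using sheaf_hom_one[OF hom_dI sheaf_I sheaf_I U, of n] sheaf_hom_one[OF hom_dI sheaf_I sheaf_I U, of "n + 1"]
    by (simp add: add.assoc)
qed

lemma dG_dG: "openin X U \<Longrightarrow> g \<in> carrier (sec (G n) U) \<Longrightarrow> dG (n + 1) U (dG n U g) = (\<lambda>c. 0)"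
  by (rule cdiff_cdiff[OF S])

lemma open_nb: "x \<in> topspace X \<Longrightarrow> openin X (nb X x)"
  by (rule openin_nb[OF fs])

text \<open>By injectivity, a compatible family of homomorphisms on the stalks of the cocycles extends to all
  cochains.\<close>

lemma extend_from_cocycles:
  assumes h: "\<And>x f. x \<in> topspace X \<Longrightarrow> f \<in> carrier (sec (G n) (nb X x)) \<Longrightarrow> dG n (nb X x) f = (\<lambda>c. 0) \<Longrightarrow>
        h x f \<in> carrier (sec (I n) (nb X x))"
    and h_add: "\<And>x f g. x \<in> topspace X \<Longrightarrow>
        f \<in> carrier (sec (G n) (nb X x)) \<Longrightarrow> dG n (nb X x) f = (\<lambda>c. 0) \<Longrightarrow>
        g \<in> carrier (sec (G n) (nb X x)) \<Longrightarrow> dG n (nb X x) g = (\<lambda>c. 0) \<Longrightarrow>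
        h x (\<lambda>c. f c + g c) = h x f \<otimes>\<^bsub>sec (I n) (nb X x)\<^esub> h x g"
    and h_res: "\<And>x y f. x \<in> topspace X \<Longrightarrow> y \<in> nb X x \<Longrightarrow>
        f \<in> carrier (sec (G n) (nb X x)) \<Longrightarrow> dG n (nb X x) f = (\<lambda>c. 0) \<Longrightarrow>
        h y (\<lambda>c. if hd c \<in> nb X y then f c else 0) = res (I n) (nb X x) (nb X y) (h x f)"
  shows "\<exists>\<phi>. sheaf_hom X (G n) (I n) \<phi> \<and> (\<forall>x\<in>topspace X. \<forall>f\<in>carrier (sec (G n) (nb X x)).
           dG n (nb X x) f = (\<lambda>c. 0) \<longrightarrow> \<phi> (nb X x) f = h x f)"
proof -
  let ?Z = "ker_psh (G n) (G (n + 1)) (dG n)"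
  have Z: "sheaf X ?Z" by (rule sheaf_ker_psh[OF sheaf_sky sheaf_sky sheaf_hom_cdiff])
  have ZG: "sheaf_hom X ?Z (G n) (\<lambda>U f. f)"
    by (intro sheaf_homI homI) (auto simp: sec_ker_psh)
  obtain T where T: "countable T" "\<And>U n. carrier (sec (G n) U) \<subseteq> T"
    using countable_cochains[OF fs, where 'a = int] by auto
  have "\<exists>g. sheaf_hom X (G n) (I n) g \<and>
     (\<forall>x\<in>topspace X. \<forall>f\<in>carrier (sec ?Z (nb X x)). g (nb X x) f = h x f)"
  proof (rule injective_extend[OF fs inj_I Z sheaf_sky ZG T])
    show "h x \<in> hom (sec ?Z (nb X x)) (sec (I n) (nb X x))" if "x \<in> topspace X" for x
      by (rule homI) (auto simp: sec_ker_psh h h_add that)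
    show "h y (res ?Z (nb X x) (nb X y) f) = res (I n) (nb X x) (nb X y) (h x f)"
      if "x \<in> topspace X" "y \<in> nb X x" "f \<in> carrier (sec ?Z (nb X x))" for x y f
      using h_res[OF that(1,2), of f] that(3) by (simp add: sec_ker_psh)
  qed
  then show ?thesis by (auto simp: sec_ker_psh)
qed

text \<open>The condition on the \<open>n\<close>-th component of a comparison map that allows the construction of the next one:
  cocycles are mapped to cocycles on stalks.\<close>

definition cocycle_map :: "int \<Rightarrow> ('x set \<Rightarrow> ('x list \<Rightarrow> int) \<Rightarrow> 'u) \<Rightarrow> bool" where
  "cocycle_map n \<phi> \<longleftrightarrow> sheaf_hom X (G n) (I n) \<phi> \<and> (\<forall>x\<in>topspace X. \<forall>f\<in>carrier (sec (G n) (nb X x)).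
      dG n (nb X x) f = (\<lambda>c. 0) \<longrightarrow> dI n (nb X x) (\<phi> (nb X x) f) = \<one>\<^bsub>sec (I (n + 1)) (nb X x)\<^esub>)"

lemma ex_comparison_0:
  "\<exists>\<phi>. cocycle_map 0 \<phi> \<and> (\<forall>x\<in>topspace X. \<forall>u. loc_const X S (nb X x) u \<longrightarrow> \<phi> (nb X x) (aug u) = raug R (nb X x) u)"
proof -
  let ?h = "\<lambda>x f. raug R (nb X x) (\<lambda>y. f [y])"
  have lc: "loc_const X S (nb X x) (\<lambda>y. f [y])"
    if "x \<in> topspace X" "f \<in> carrier (sec (G 0) (nb X x))" "dG 0 (nb X x) f = (\<lambda>c. 0)" for x f
    using cdiff_0_iff[OF open_nb[OF that(1)] that(2)] that(3) by blast
  have "\<exists>\<phi>. sheaf_hom X (G 0) (I 0) \<phi> \<and> (\<forall>x\<in>topspace X. \<forall>f\<in>carrier (sec (G 0) (nb X x)).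
           dG 0 (nb X x) f = (\<lambda>c. 0) \<longrightarrow> \<phi> (nb X x) f = ?h x f)"
  proof (rule extend_from_cocycles)
    fix x f assume x: "x \<in> topspace X" and f: "f \<in> carrier (sec (G 0) (nb X x))" "dG 0 (nb X x) f = (\<lambda>c. 0)"
    show "?h x f \<in> carrier (sec (I 0) (nb X x))" by (rule aug_I_closed[OF open_nb[OF x] lc[OF x f]])
    {
      fix g assume g: "g \<in> carrier (sec (G 0) (nb X x))" "dG 0 (nb X x) g = (\<lambda>c. 0)"
      show "?h x (\<lambda>c. f c + g c) = ?h x f \<otimes>\<^bsub>sec (I 0) (nb X x)\<^esub> ?h x g"
        using sheaf_hom_mult[OF hom_aug open_nb[OF x], of "\<lambda>y. f [y]" "\<lambda>y. g [y]"] lc[OF x f] lc[OF x g]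
        by (simp add: carrier_Z[OF open_nb[OF x]])
    }
    {
      fix y assume y: "y \<in> nb X x"
      have yX: "y \<in> topspace X" using y by (rule nb_topspace(1))
      show "?h y (\<lambda>c. if hd c \<in> nb X y then f c else 0) = res (I 0) (nb X x) (nb X y) (?h x f)"
        using sheaf_hom_res[OF hom_aug open_nb[OF x] open_nb[OF yX] nb_mono[OF y], of "\<lambda>y. f [y]"] lc[OF x f]
        by (simp add: carrier_Z[OF open_nb[OF x]])
    }
  qed
  then obtain \<phi> where \<phi>: "sheaf_hom X (G 0) (I 0) \<phi>"
    "\<And>x f. x\<in>topspace X \<Longrightarrow> f\<in>carrier (sec (G 0) (nb X x)) \<Longrightarrow> dG 0 (nb X x) f = (\<lambda>c. 0) \<Longrightarrow> \<phi> (nb X x) f = ?h x f"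
    by blast
  have "cocycle_map 0 \<phi>"
    unfolding cocycle_map_def
  proof (intro conjI \<phi>(1) ballI impI)
    fix x f assume x: "x \<in> topspace X" and f: "f \<in> carrier (sec (G 0) (nb X x))" "dG 0 (nb X x) f = (\<lambda>c. 0)"
    show "dI 0 (nb X x) (\<phi> (nb X x) f) = \<one>\<^bsub>sec (I (0 + 1)) (nb X x)\<^esub>"
      using dI_aug[OF open_nb[OF x] lc[OF x f]] \<phi>(2)[OF x f] by simp
  qed
  moreover have "\<phi> (nb X x) (aug u) = raug R (nb X x) u" if "x \<in> topspace X" "loc_const X S (nb X x) u" for x u
    using \<phi>(2)[OF that(1) aug_closed[OF open_nb[OF that(1)] that(2)] cdiff_aug[OF open_nb[OF that(1)] that(2)]]
    by (simp add: aug_def)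
  ultimately show ?thesis by blast
qed

lemma ex_comparison_Suc:
  assumes n: "n \<ge> 0" and \<phi>: "cocycle_map n \<phi>"
  shows "\<exists>\<psi>. cocycle_map (n + 1) \<psi> \<and> (\<forall>x\<in>topspace X. \<forall>f\<in>carrier (sec (G n) (nb X x)).
           \<psi> (nb X x) (dG n (nb X x) f) = dI n (nb X x) (\<phi> (nb X x) f))"
proof -
  have hom: "sheaf_hom X (G n) (I n) \<phi>" using \<phi> by (simp add: cocycle_map_def)
  let ?l = "\<lambda>x t. dI n (nb X x) (\<phi> (nb X x) t)"
  have l: "?l x t \<in> carrier (sec (I (n + 1)) (nb X x))"
    if "x \<in> topspace X" "t \<in> carrier (sec (G n) (nb X x))" for x t
    by (intro sheaf_hom_closed[OF hom_dI] sheaf_hom_closed[OF hom] open_nb that)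
  have l_add: "?l x (\<lambda>c. s c + t c) = ?l x s \<otimes>\<^bsub>sec (I (n + 1)) (nb X x)\<^esub> ?l x t"
    if "x \<in> topspace X" "s \<in> carrier (sec (G n) (nb X x))" "t \<in> carrier (sec (G n) (nb X x))" for x s t
    using sheaf_hom_mult[OF hom open_nb[OF that(1)] that(2,3)]
      sheaf_hom_mult[OF hom_dI open_nb[OF that(1)], of "\<phi> (nb X x) s" n "\<phi> (nb X x) t"]
      sheaf_hom_closed[OF hom open_nb[OF that(1)]] that by simp
  have l_eq: "?l x s = ?l x t"
    if x: "x \<in> topspace X" and s: "s \<in> carrier (sec (G n) (nb X x))" and t: "t \<in> carrier (sec (G n) (nb X x))"
      and eq: "dG n (nb X x) s = dG n (nb X x) t" for x s t
  proof -
    let ?r = "\<lambda>c. s c - t c"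
    have r: "?r \<in> carrier (sec (G n) (nb X x))" by (rule cochains_add(2)[OF s t])
    have "dG n (nb X x) ?r = (\<lambda>c. 0)" using eq by (simp add: cdiff_diff)
    then have "?l x ?r = \<one>\<^bsub>sec (I (n + 1)) (nb X x)\<^esub>" using \<phi> x r by (simp add: cocycle_map_def)
    then show ?thesis
      using l_add[OF x r t] l[OF x t] monoid.l_one[OF group.is_monoid[OF sh_group[OF sheaf_I open_nb[OF x]]]] by simp
  qed
  \<comment> \<open>a cocycle \<open>d t\<close> is mapped to the differential of the image of \<open>t\<close>, independently of the choice of \<open>t\<close>\<close>
  define h where "h x f = ?l x (SOME t. t \<in> carrier (sec (G n) (nb X x)) \<and> dG n (nb X x) t = f)" for x f
  have h_eq: "h x f = ?l x t"
    if x: "x \<in> topspace X" and t: "t \<in> carrier (sec (G n) (nb X x))" and eq: "dG n (nb X x) t = f" for x f t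
  proof -
    let ?P = "\<lambda>t. t \<in> carrier (sec (G n) (nb X x)) \<and> dG n (nb X x) t = f"
    have "?P (SOME t. ?P t)" using t eq by (intro someI[of ?P t]) simp
    then show ?thesis unfolding h_def using l_eq[OF x _ t] eq by blast
  qed
  have lift: "\<exists>t\<in>carrier (sec (G n) (nb X x)). dG n (nb X x) t = f"
    if "x \<in> topspace X" "f \<in> carrier (sec (G (n + 1)) (nb X x))" "dG (n + 1) (nb X x) f = (\<lambda>c. 0)" for x f
    using cdiff_exact[OF fs that(1) _ that(2,3)] n by simp
  have "\<exists>\<psi>. sheaf_hom X (G (n + 1)) (I (n + 1)) \<psi> \<and> (\<forall>x\<in>topspace X. \<forall>f\<in>carrier (sec (G (n + 1)) (nb X x)).
           dG (n + 1) (nb X x) f = (\<lambda>c. 0) \<longrightarrow> \<psi> (nb X x) f = h x f)"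
  proof (rule extend_from_cocycles)
    fix x f assume x: "x \<in> topspace X"
      and f: "f \<in> carrier (sec (G (n + 1)) (nb X x))" "dG (n + 1) (nb X x) f = (\<lambda>c. 0)"
    obtain t where t: "t\<in>carrier (sec (G n) (nb X x))" "dG n (nb X x) t = f" using lift[OF x f] by blast
    show "h x f \<in> carrier (sec (I (n + 1)) (nb X x))" using h_eq[OF x t] l[OF x t(1)] by simp
    {
      fix g assume g: "g \<in> carrier (sec (G (n + 1)) (nb X x))" "dG (n + 1) (nb X x) g = (\<lambda>c. 0)"
      obtain s where s: "s\<in>carrier (sec (G n) (nb X x))" "dG n (nb X x) s = g" using lift[OF x g] by blast
      have "h x (\<lambda>c. f c + g c) = ?l x (\<lambda>c. t c + s c)"
        by (rule h_eq[OF x cochains_add(1)[OF t(1) s(1)]]) (simp add: cdiff_add s t)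
      then show "h x (\<lambda>c. f c + g c) = h x f \<otimes>\<^bsub>sec (I (n + 1)) (nb X x)\<^esub> h x g"
        using l_add[OF x t(1) s(1)] h_eq[OF x t] h_eq[OF x s] by simp
    }
    {
      fix y assume y: "y \<in> nb X x"
      have yX: "y \<in> topspace X" using y by (rule nb_topspace(1))
      note oo = open_nb[OF x] open_nb[OF yX] nb_mono[OF y]
      have tr: "res (G n) (nb X x) (nb X y) t \<in> carrier (sec (G n) (nb X y))"
        by (rule res_closed[OF sheaf_presheaf[OF sheaf_sky] oo t(1)])
      have "h y (res (G (n + 1)) (nb X x) (nb X y) f) = ?l y (res (G n) (nb X x) (nb X y) t)"
        by (rule h_eq[OF yX tr]) (use sheaf_hom_res[OF sheaf_hom_cdiff oo t(1)] t(2) in simp)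
      also have "\<dots> = res (I (n + 1)) (nb X x) (nb X y) (?l x t)"
        using sheaf_hom_res[OF hom oo t(1)] sheaf_hom_res[OF hom_dI oo sheaf_hom_closed[OF hom oo(1) t(1)]] by simp
      finally show "h y (\<lambda>c. if hd c \<in> nb X y then f c else 0) = res (I (n + 1)) (nb X x) (nb X y) (h x f)"
        using h_eq[OF x t] by simp
    }
  qed
  then obtain \<psi> where \<psi>: "sheaf_hom X (G (n + 1)) (I (n + 1)) \<psi>"
    "\<And>x f. x\<in>topspace X \<Longrightarrow> f\<in>carrier (sec (G (n + 1)) (nb X x)) \<Longrightarrow>
       dG (n + 1) (nb X x) f = (\<lambda>c. 0) \<Longrightarrow> \<psi> (nb X x) f = h x f" by blast
  have comm: "\<psi> (nb X x) (dG n (nb X x) t) = ?l x t"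
    if x: "x\<in>topspace X" and t: "t\<in>carrier (sec (G n) (nb X x))" for x t
    using \<psi>(2)[OF x cdiff_closed[OF open_nb[OF x] t] dG_dG[OF open_nb[OF x] t]] h_eq[OF x t refl] by simp
  have "cocycle_map (n + 1) \<psi>"
    unfolding cocycle_map_def
  proof (intro conjI \<psi>(1) ballI impI)
    fix x f assume x: "x \<in> topspace X"
      and f: "f \<in> carrier (sec (G (n + 1)) (nb X x))" "dG (n + 1) (nb X x) f = (\<lambda>c. 0)"
    obtain t where t: "t\<in>carrier (sec (G n) (nb X x))" "dG n (nb X x) t = f" using lift[OF x f] by blast
    show "dI (n + 1) (nb X x) (\<psi> (nb X x) f) = \<one>\<^bsub>sec (I (n + 1 + 1)) (nb X x)\<^esub>"
      using comm[OF x t(1)] t(2) dI_dI[OF open_nb[OF x] sheaf_hom_closed[OF hom open_nb[OF x] t(1)]]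
      by (simp add: add.assoc)
  qed
  then show ?thesis using comm by blast
qed

lemma ex_comparison:
  "\<exists>\<Phi>. (\<forall>n. sheaf_hom X (G n) (I n) (\<Phi> n)) \<and>
     (\<forall>n U g. openin X U \<longrightarrow> g \<in> carrier (sec (G n) U) \<longrightarrow> \<Phi> (n + 1) U (dG n U g) = dI n U (\<Phi> n U g)) \<and>
     (\<forall>U u. openin X U \<longrightarrow> loc_const X S U u \<longrightarrow> \<Phi> 0 U (aug u) = raug R U u)"
proof -
  define P where "P k \<phi> \<longleftrightarrow> cocycle_map (int k) \<phi> \<and> (k = 0 \<longrightarrow>
      (\<forall>x\<in>topspace X. \<forall>u. loc_const X S (nb X x) u \<longrightarrow> \<phi> (nb X x) (aug u) = raug R (nb X x) u))" for k \<phi>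
  define Q where "Q k \<phi> \<psi> \<longleftrightarrow> (\<forall>x\<in>topspace X. \<forall>f\<in>carrier (sec (G (int k)) (nb X x)).
           \<psi> (nb X x) (dG (int k) (nb X x) f) = dI (int k) (nb X x) (\<phi> (nb X x) f))"
    for k and \<phi> \<psi> :: "'x set \<Rightarrow> ('x list \<Rightarrow> int) \<Rightarrow> 'u"
  have "\<exists>f. \<forall>k. P k (f k) \<and> Q k (f k) (f (Suc k))"
  proof (rule dependent_nat_choice)
    show "\<exists>\<phi>. P 0 \<phi>" using ex_comparison_0 by (simp add: P_def)
    show "\<exists>\<psi>. P (Suc k) \<psi> \<and> Q k \<phi> \<psi>" if "P k \<phi>" for k \<phi>
      using ex_comparison_Suc[of "int k" \<phi>] that by (simp add: P_def Q_def add.commute)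
  qed
  then obtain f where P: "\<And>k. P k (f k)" and Q: "\<And>k. Q k (f k) (f (Suc k))" by blast
  \<comment> \<open>in negative degrees the map is trivial\<close>
  define \<Phi> where "\<Phi> n = (if n < 0 then (\<lambda>U g. \<one>\<^bsub>sec (I n) U\<^esub>) else f (nat n))" for n
  have hom: "sheaf_hom X (G n) (I n) (\<Phi> n)" for n
  proof (cases "n < 0")
    case True
    show ?thesis
    proof (intro sheaf_homI homI)
      fix U g g' assume U: "openin X U"
      show "\<Phi> n U (g \<otimes>\<^bsub>sec (G n) U\<^esub> g') = \<Phi> n U g \<otimes>\<^bsub>sec (I n) U\<^esub> \<Phi> n U g'"
        using one_I[OF U] True monoid.l_one[OF group.is_monoid[OF sh_group[OF sheaf_I U]]] by (simp add: \<Phi>_def)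
    qed (use True one_I in \<open>auto simp: \<Phi>_def res_one[OF psh_I]\<close>)
  next
    case False
    then show ?thesis using P[of "nat n"] by (simp add: \<Phi>_def P_def cocycle_map_def)
  qed
  have comm: "\<Phi> (n + 1) U (dG n U g) = dI n U (\<Phi> n U g)"
    if U: "openin X U" and g: "g \<in> carrier (sec (G n) U)" for n U g
  proof (cases "n < 0")
    case True
    then have "g = (\<lambda>c. 0)" using cochains_neg g by blast
    then show ?thesis
      using True sheaf_hom_one[OF hom sheaf_sky sheaf_I U, of "n + 1"] sheaf_hom_one[OF hom_dI sheaf_I sheaf_I U, of n]
      by (simp add: cdiff_0 \<Phi>_def)
  next
    case False
    show ?thesis
    proof (rule stalk_sep[OF fs sheaf_I U])
      show "\<Phi> (n + 1) U (dG n U g) \<in> carrier (sec (I (n + 1)) U)"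
        by (intro sheaf_hom_closed[OF hom] cdiff_closed U g)
      show "dI n U (\<Phi> n U g) \<in> carrier (sec (I (n + 1)) U)"
        by (intro sheaf_hom_closed[OF hom_dI] sheaf_hom_closed[OF hom] U g)
      fix x assume x: "x \<in> U"
      then have xX: "x \<in> topspace X" using openin_subset[OF U] by blast
      note oo = U open_nb[OF xX] nb_least[OF U x]
      let ?g = "res (G n) U (nb X x) g"
      have "res (I (n + 1)) U (nb X x) (\<Phi> (n + 1) U (dG n U g)) = \<Phi> (n + 1) (nb X x) (dG n (nb X x) ?g)"
        using sheaf_hom_res[OF hom oo cdiff_closed[OF U g]] sheaf_hom_res[OF sheaf_hom_cdiff oo g] by simp
      also have "\<dots> = dI n (nb X x) (\<Phi> n (nb X x) ?g)"
        using Q[of "nat n"] False xX res_closed[OF sheaf_presheaf[OF sheaf_sky] oo g]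
        by (simp add: Q_def \<Phi>_def nat_add_distrib del: res_sky)
      also have "\<dots> = res (I (n + 1)) U (nb X x) (dI n U (\<Phi> n U g))"
        using sheaf_hom_res[OF hom oo g] sheaf_hom_res[OF hom_dI oo sheaf_hom_closed[OF hom U g]] by simp
      finally show "res (I (n + 1)) U (nb X x) (\<Phi> (n + 1) U (dG n U g)) = res (I (n + 1)) U (nb X x) (dI n U (\<Phi> n U g))" .
    qed
  qed
  have "\<Phi> 0 U (aug u) = raug R U u" if U: "openin X U" and u: "loc_const X S U u" for U u
  proof (rule stalk_sep[OF fs sheaf_I U])
    show "\<Phi> 0 U (aug u) \<in> carrier (sec (I 0) U)" by (intro sheaf_hom_closed[OF hom] aug_closed U u)
    show "raug R U u \<in> carrier (sec (I 0) U)" by (rule aug_I_closed[OF U u])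
    fix x assume x: "x \<in> U"
    then have xX: "x \<in> topspace X" using openin_subset[OF U] by blast
    note oo = U open_nb[OF xX] nb_least[OF U x]
    let ?u = "\<lambda>y. if y \<in> nb X x then u y else 0"
    have u': "loc_const X S (nb X x) ?u" using u oo(3) unfolding loc_const_def by auto
    have "res (G 0) U (nb X x) (aug u) = aug ?u" by (auto simp: aug_def fun_eq_iff)
    then show "res (I 0) U (nb X x) (\<Phi> 0 U (aug u)) = res (I 0) U (nb X x) (raug R U u)"
      using sheaf_hom_res[OF hom oo aug_closed[OF U u]] sheaf_hom_res[OF hom_aug oo, of u] u carrier_Z[OF U]
        P[of 0] xX u' by (simp add: P_def \<Phi>_def)
  qed
  then show ?thesis using hom comm by blast
qed

end

context int_resolution
begin

text \<open>A comparison map is a morphism of complexes over \<open>\<int>\<^sub>S\<close> from the cochains to the injective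
  resolution that induces isomorphisms on the cohomology of the sections over every open set.\<close>

definition comparison :: "(int \<Rightarrow> 'x set \<Rightarrow> ('x list \<Rightarrow> int) \<Rightarrow> 'u) \<Rightarrow> bool" where
  "comparison \<Phi> \<longleftrightarrow> (\<forall>n. sheaf_hom X (G n) (I n) (\<Phi> n)) \<and>
     (\<forall>n U g. openin X U \<longrightarrow> g \<in> carrier (sec (G n) U) \<longrightarrow> \<Phi> (n + 1) U (dG n U g) = dI n U (\<Phi> n U g)) \<and>
     (\<forall>U u. openin X U \<longrightarrow> loc_const X S U u \<longrightarrow> \<Phi> 0 U (aug u) = raug R U u) \<and>
     (\<forall>n U z. openin X U \<longrightarrow> z \<in> carrier (sec (I n) U) \<longrightarrow> dI n U z = \<one>\<^bsub>sec (I (n + 1)) U\<^esub> \<longrightarrow>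
        (\<exists>g\<in>carrier (sec (G n) U). \<exists>s\<in>carrier (sec (I (n - 1)) U).
           dG n U g = (\<lambda>c. 0) \<and> z = \<Phi> n U g \<otimes>\<^bsub>sec (I n) U\<^esub> dI (n - 1) U s)) \<and>
     (\<forall>n U g s. openin X U \<longrightarrow> g \<in> carrier (sec (G n) U) \<longrightarrow> dG n U g = (\<lambda>c. 0) \<longrightarrow>
        s \<in> carrier (sec (I (n - 1)) U) \<longrightarrow> \<Phi> n U g = dI (n - 1) U s \<longrightarrow>
        (\<exists>g'\<in>carrier (sec (G (n - 1)) U). dG (n - 1) U g' = g))"

lemma
  assumes "comparison \<Phi>" "openin X U"
  shows comparison_hom: "sheaf_hom X (G n) (I n) (\<Phi> n)"
    and comparison_comm: "g \<in> carrier (sec (G n) U) \<Longrightarrow> \<Phi> (n + 1) U (dG n U g) = dI n U (\<Phi> n U g)"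
    and comparison_aug: "loc_const X S U u \<Longrightarrow> \<Phi> 0 U (aug u) = raug R U u"
    and comparison_surj: "z \<in> carrier (sec (I n) U) \<Longrightarrow> dI n U z = \<one>\<^bsub>sec (I (n + 1)) U\<^esub> \<Longrightarrow>
        \<exists>g\<in>carrier (sec (G n) U). \<exists>s\<in>carrier (sec (I (n - 1)) U).
           dG n U g = (\<lambda>c. 0) \<and> z = \<Phi> n U g \<otimes>\<^bsub>sec (I n) U\<^esub> dI (n - 1) U s"
    and comparison_inj: "g \<in> carrier (sec (G n) U) \<Longrightarrow> dG n U g = (\<lambda>c. 0) \<Longrightarrow>
        s \<in> carrier (sec (I (n - 1)) U) \<Longrightarrow> \<Phi> n U g = dI (n - 1) U s \<Longrightarrow>
        \<exists>g'\<in>carrier (sec (G (n - 1)) U). dG (n - 1) U g' = g"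
  using assms by (simp_all add: comparison_def)

text \<open>The mapping cone of a morphism of complexes over \<open>\<int>\<^sub>S\<close> consists of flabby sheaves and is exact
  on stalks, hence exact on sections.\<close>

lemma ex_comparison_quasi_iso: "\<exists>\<Phi>. comparison \<Phi>"
proof -
  obtain \<Phi> where hom: "\<And>n. sheaf_hom X (G n) (I n) (\<Phi> n)"
    and comm: "\<And>n U g. openin X U \<Longrightarrow> g \<in> carrier (sec (G n) U) \<Longrightarrow> \<Phi> (n + 1) U (dG n U g) = dI n U (\<Phi> n U g)"
    and augm: "\<And>U u. openin X U \<Longrightarrow> loc_const X S U u \<Longrightarrow> \<Phi> 0 U (aug u) = raug R U u"
    using ex_comparison by blast
  \<comment> \<open>the mapping cone of \<open>\<Phi>\<close>\<close>
  define K where "K n = prod_psh (G (n + 1)) (I n)" for n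
  define dK where "dK n U gs = ((\<lambda>c. - dG (n + 1) U (fst gs) c),
      \<Phi> (n + 1) U (fst gs) \<otimes>\<^bsub>sec (I (n + 1)) U\<^esub> dI n U (snd gs))" for n U gs
  have K_in: "gs \<in> carrier (sec (K n) U) \<longleftrightarrow> fst gs \<in> carrier (sec (G (n + 1)) U) \<and> snd gs \<in> carrier (sec (I n) U)" for gs n U
    by (auto simp: K_def mem_Times_iff)
  have K_one: "\<one>\<^bsub>sec (K n) U\<^esub> = ((\<lambda>c. 0), \<one>\<^bsub>sec (I n) U\<^esub>)" for n U by (simp add: K_def)
  have shK: "sheaf X (K n)" for n unfolding K_def by (intro sheaf_prod_psh sheaf_sky sheaf_I)
  have flK: "flabby X (K n)" for n unfolding K_def by (intro flabby_prod_psh flabby_sky flabby_I)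
  have \<Phi>c: "\<Phi> n U g \<in> carrier (sec (I n) U)" if "openin X U" "g \<in> carrier (sec (G n) U)" for n U g
    by (rule sheaf_hom_closed[OF hom that])
  have dIc: "dI n U s \<in> carrier (sec (I (n + 1)) U)" if "openin X U" "s \<in> carrier (sec (I n) U)" for n U s
    by (rule sheaf_hom_closed[OF hom_dI that])
  have cg: "comm_group (sec (I n) U)" if "openin X U" for n U by (rule sh_comm_group[OF sheaf_I that])
  have mon: "monoid (sec (I n) U)" if "openin X U" for n U using cg[OF that] by (simp add: comm_group_def group.is_monoid)
  have \<Phi>0: "\<Phi> n U (\<lambda>c. 0) = \<one>\<^bsub>sec (I n) U\<^esub>" if "openin X U" for n U
    using sheaf_hom_one[OF hom sheaf_sky sheaf_I that] by simp
  have dI1: "dI n U \<one>\<^bsub>sec (I n) U\<^esub> = \<one>\<^bsub>sec (I (n + 1)) U\<^esub>" if "openin X U" for n U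
    by (rule sheaf_hom_one[OF hom_dI sheaf_I sheaf_I that])
  have \<Phi>add: "\<Phi> n U (\<lambda>c. f c + g c) = \<Phi> n U f \<otimes>\<^bsub>sec (I n) U\<^esub> \<Phi> n U g"
    if "openin X U" "f \<in> carrier (sec (G n) U)" "g \<in> carrier (sec (G n) U)" for n U f g
    using sheaf_hom_mult[OF hom that] by simp
  have \<Phi>min: "\<Phi> n U (\<lambda>c. - g c) = inv\<^bsub>sec (I n) U\<^esub> \<Phi> n U g"
    if "openin X U" "g \<in> carrier (sec (G n) U)" for n U g
    using sheaf_hom_inv[OF hom sheaf_sky sheaf_I that] by (simp add: inv_sky[OF that(2)])
  have dKhom: "sheaf_hom X (K n) (K (n + 1)) (dK n)" for n
  proof (rule sheaf_homI)
    fix U assume U: "openin X U"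
    interpret J: comm_group "sec (I n) U" by (rule cg[OF U])
    interpret J1: comm_group "sec (I (n + 1)) U" by (rule cg[OF U])
    show "dK n U \<in> hom (sec (K n) U) (sec (K (n + 1)) U)"
    proof (rule homI)
      fix gs assume "gs \<in> carrier (sec (K n) U)"
      then have "fst gs \<in> carrier (sec (G (n + 1)) U)" "snd gs \<in> carrier (sec (I n) U)" by (simp_all add: K_in)
      then show "dK n U gs \<in> carrier (sec (K (n + 1)) U)"
        unfolding K_in dK_def fst_conv snd_conv
        by (intro conjI cochains_add(3) cdiff_closed U monoid.m_closed[OF mon[OF U]] \<Phi>c dIc)
    next
      fix gs ht assume "gs \<in> carrier (sec (K n) U)" "ht \<in> carrier (sec (K n) U)"
      then have c: "fst gs \<in> carrier (sec (G (n + 1)) U)" "snd gs \<in> carrier (sec (I n) U)"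
        "fst ht \<in> carrier (sec (G (n + 1)) U)" "snd ht \<in> carrier (sec (I n) U)" by (simp_all add: K_in)
      have "gs \<otimes>\<^bsub>sec (K n) U\<^esub> ht = (\<lambda>c. fst gs c + fst ht c, snd gs \<otimes>\<^bsub>sec (I n) U\<^esub> snd ht)"
        by (simp add: K_def DirProd_mult)
      then show "dK n U (gs \<otimes>\<^bsub>sec (K n) U\<^esub> ht) = dK n U gs \<otimes>\<^bsub>sec (K (n + 1)) U\<^esub> dK n U ht"
        using c \<Phi>c[OF U c(1)] \<Phi>c[OF U c(3)] dIc[OF U c(2)] dIc[OF U c(4)]
        by (simp add: K_def DirProd_mult dK_def cdiff_add \<Phi>add[OF U] sheaf_hom_mult[OF hom_dI U] J1.m_ac)
    qed
  next
    fix U V gs assume U: "openin X U" "openin X V" "V \<subseteq> U" and gs: "gs \<in> carrier (sec (K n) U)"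
    have c: "fst gs \<in> carrier (sec (G (n + 1)) U)" "snd gs \<in> carrier (sec (I n) U)"
      using gs by (simp_all add: K_in)
    show "dK n V (res (K n) U V gs) = res (K (n + 1)) U V (dK n U gs)"
      using sheaf_hom_res[OF hom U c(1)] sheaf_hom_res[OF hom_dI U c(2)] sheaf_hom_res[OF sheaf_hom_cdiff U c(1)]
      by (simp add: dK_def K_def res_mult[OF psh_I U \<Phi>c[OF U(1) c(1)] dIc[OF U(1) c(2)]] fun_eq_iff)
  qed
  have dKdK: "dK (n + 1) U (dK n U gs) = \<one>\<^bsub>sec (K (n + 2)) U\<^esub>"
    if U: "openin X U" and gs: "gs \<in> carrier (sec (K n) U)" for n U gs
  proof -
    have c: "fst gs \<in> carrier (sec (G (n + 1)) U)" "snd gs \<in> carrier (sec (I n) U)"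
      using gs by (simp_all add: K_in)
    interpret J2: comm_group "sec (I (n + 2)) U" by (rule cg[OF U])
    have d: "dG (n + 1) U (fst gs) \<in> carrier (sec (G (n + 2)) U)"
      using cdiff_closed[OF U c(1)] by (simp add: add.assoc)
    have "\<Phi> (n + 2) U (dG (n + 1) U (fst gs)) = dI (n + 1) U (\<Phi> (n + 1) U (fst gs))"
      using comm[OF U c(1)] by (simp add: add.assoc)
    moreover have "dI (n + 1) U (\<Phi> (n + 1) U (fst gs)) \<in> carrier (sec (I (n + 2)) U)"
      using dIc[OF U \<Phi>c[OF U c(1)]] by (simp add: add.assoc)
    moreover have "dI (n + 1) U (\<Phi> (n + 1) U (fst gs) \<otimes>\<^bsub>sec (I (n + 1)) U\<^esub> dI n U (snd gs)) =
       dI (n + 1) U (\<Phi> (n + 1) U (fst gs)) \<otimes>\<^bsub>sec (I (n + 2)) U\<^esub> \<one>\<^bsub>sec (I (n + 2)) U\<^esub>"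
      using sheaf_hom_mult[OF hom_dI U \<Phi>c[OF U c(1)] dIc[OF U c(2)]] dI_dI[OF U c(2)] by (simp add: add.assoc)
    ultimately show ?thesis
      using dG_dG[OF U c(1)] \<Phi>min[OF U d] by (simp add: dK_def K_one cdiff_uminus add.assoc)
  qed
  have stalk: "\<exists>gs'\<in>carrier (sec (K (n - 1)) (nb X x)). dK (n - 1) (nb X x) gs' = gs"
    if x: "x \<in> topspace X" and gs: "gs \<in> carrier (sec (K n) (nb X x))"
      and k: "dK n (nb X x) gs = \<one>\<^bsub>sec (K (n + 1)) (nb X x)\<^esub>" for n x gs
  proof -
    define N where "N = nb X x"
    have N: "openin X N" unfolding N_def by (rule open_nb[OF x])
    obtain g s where eq: "gs = (g, s)" by (cases gs)
    have c: "g \<in> carrier (sec (G (n + 1)) N)" "s \<in> carrier (sec (I n) N)"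
      using gs by (simp_all add: K_in eq N_def)
    have dg: "dG (n + 1) N g = (\<lambda>c. 0)"
      and ds: "\<Phi> (n + 1) N g \<otimes>\<^bsub>sec (I (n + 1)) N\<^esub> dI n N s = \<one>\<^bsub>sec (I (n + 1)) N\<^esub>"
      using k by (simp_all add: dK_def K_one eq N_def fun_eq_iff)
    interpret J: comm_group "sec (I n) N" by (rule cg[OF N])
    interpret J1: comm_group "sec (I (n + 1)) N" by (rule cg[OF N])
    have sol: "\<exists>gs'\<in>carrier (sec (K (n - 1)) (nb X x)). dK (n - 1) (nb X x) gs' = gs"
      if "g' \<in> carrier (sec (G n) N)" "s' \<in> carrier (sec (I (n - 1)) N)" "\<And>c. dG n N g' c = - g c"
        "\<Phi> n N g' \<otimes>\<^bsub>sec (I n) N\<^esub> dI (n - 1) N s' = s" for g' s'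
      using that by (intro bexI[of _ "(g', s')"]) (simp_all add: K_in dK_def eq N_def)
    show ?thesis
    proof (cases "n \<ge> 0")
      case False
      have s1: "s = \<one>\<^bsub>sec (I n) N\<^esub>" using neg_I_eq[OF _ N c(2)] False by simp
      have "g = (\<lambda>c. 0)"
      proof (cases "n = -1")
        case True
        then have g: "g \<in> carrier (sec (G 0) N)" "dG 0 N g = (\<lambda>c. 0)" using c dg by auto
        obtain u where u: "loc_const X S N u" "aug u = g" using cdiff_0_aug[OF N g] by blast
        have "raug R N u = \<one>\<^bsub>sec (I 0) N\<^esub>"
          using ds dI1[OF N, of n] augm[OF N u(1)] u(2) \<Phi>c[OF N g(1)] monoid.r_one[OF mon[OF N]] True s1 by simp
        moreover have "raug R N (\<lambda>x. 0) = \<one>\<^bsub>sec (I 0) N\<^esub>"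
          using augm[OF N, of "\<lambda>x. 0"] \<Phi>0[OF N] by (simp add: loc_const_def aug_0)
        ultimately have "u = (\<lambda>x. 0)"
          using inj_onD[OF inj_aug[OF N], of u "\<lambda>x. 0"] u(1) by (simp add: carrier_Z[OF N] loc_const_def)
        then show ?thesis using u(2) by (auto simp: aug_def)
      next
        case ne: False
        then show ?thesis using cochains_neg[OF _ c(1)] False by simp
      qed
      then show ?thesis
        by (intro sol[of "\<lambda>c. 0" "\<one>\<^bsub>sec (I (n - 1)) N\<^esub>"])
          (use s1 one_I[OF N] dI1[OF N, of "n - 1"] \<Phi>0[OF N] in \<open>auto simp: cochains_add(4) cdiff_0\<close>)
    next
      case True
      have n1: "n + 1 > 0" using True by simp
      have "\<exists>g0\<in>carrier (sec (G (n + 1 - 1)) N). dG (n + 1 - 1) N g0 = g"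
        unfolding N_def by (rule cdiff_exact[OF fs x n1]) (use c dg in \<open>auto simp: N_def\<close>)
      then obtain g0 where g0: "g0 \<in> carrier (sec (G n) N)" "dG n N g0 = g" by auto
      define g1 where "g1 = (\<lambda>c. - g0 c)"
      have g1: "g1 \<in> carrier (sec (G n) N)" "dG n N g1 = (\<lambda>c. - g c)"
        using cochains_add(3)[OF g0(1)] g0(2) by (simp_all add: g1_def cdiff_uminus)
      define t where "t = s \<otimes>\<^bsub>sec (I n) N\<^esub> inv\<^bsub>sec (I n) N\<^esub> \<Phi> n N g1"
      have t: "t \<in> carrier (sec (I n) N)" using c(2) \<Phi>c[OF N g1(1)] by (simp add: t_def)
      have st: "\<Phi> n N g1 \<otimes>\<^bsub>sec (I n) N\<^esub> t = s"
        using c(2) \<Phi>c[OF N g1(1)] by (simp add: t_def J.m_lcomm)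
      have "dI n N (\<Phi> n N g1) = inv\<^bsub>sec (I (n + 1)) N\<^esub> \<Phi> (n + 1) N g"
        using comm[OF N g1(1)] g1(2) \<Phi>min[OF N c(1)] by simp
      then have dt: "dI n N t = \<one>\<^bsub>sec (I (n + 1)) N\<^esub>"
        using c \<Phi>c[OF N g1(1)] \<Phi>c[OF N c(1)] dIc[OF N c(2)] ds
        by (simp add: t_def sheaf_hom_mult[OF hom_dI N] sheaf_hom_inv[OF hom_dI sheaf_I sheaf_I N] J1.m_comm)
      show ?thesis
      proof (cases "n = 0")
        case True
        obtain u where u: "u \<in> carrier (sec (int_sheaf_on X S) N)" "raug R N u = t"
          using sheaf_exact_stalk[OF exact_0 psh_I fs x, of t] t dt True by (auto simp: N_def)
        have lu: "loc_const X S N u" using u(1) carrier_Z[OF N] by simp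
        have au: "aug u \<in> carrier (sec (G n) N)" using aug_closed[OF N lu] True by simp
        have \<Phi>u: "\<Phi> n N (aug u) = t" using augm[OF N lu] u(2) True by simp
        show ?thesis
        proof (rule sol[of "\<lambda>c. g1 c + aug u c" "\<one>\<^bsub>sec (I (n - 1)) N\<^esub>"])
          show "(\<lambda>c. g1 c + aug u c) \<in> carrier (sec (G n) N)" by (rule cochains_add(1)[OF g1(1) au])
          show "dG n N (\<lambda>c. g1 c + aug u c) c = - g c" for c
            using g1(2) cdiff_aug[OF N lu] True by (simp add: cdiff_add)
          have "\<Phi> n N (\<lambda>c. g1 c + aug u c) = s" using \<Phi>add[OF N g1(1) au] \<Phi>u st by simp
          then show "\<Phi> n N (\<lambda>c. g1 c + aug u c) \<otimes>\<^bsub>sec (I n) N\<^esub> dI (n - 1) N \<one>\<^bsub>sec (I (n - 1)) N\<^esub> = s"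
            using dI1[OF N, of "n - 1"] c(2) by simp
        qed (rule one_I[OF N])
      next
        case False
        then have n1: "n - 1 \<ge> 0" using True by simp
        have "\<exists>s'\<in>carrier (sec (I (n - 1)) (nb X x)). dI (n - 1) (nb X x) s' = t"
          by (rule sheaf_exact_stalk[OF exact_n[OF n1] psh_I fs x]) (use t dt in \<open>simp_all add: N_def add.commute\<close>)
        then obtain s' where "s' \<in> carrier (sec (I (n - 1)) N)" "dI (n - 1) N s' = t" by (auto simp: N_def)
        then show ?thesis using st g1 by (intro sol[of g1 s']) auto
      qed
    qed
  qed
  note ex = flabby_complex_exact[of X K dK, OF fs shK flK dKhom dKdK stalk]
  have surj: "\<exists>g\<in>carrier (sec (G n) U). \<exists>s\<in>carrier (sec (I (n - 1)) U).
           dG n U g = (\<lambda>c. 0) \<and> z = \<Phi> n U g \<otimes>\<^bsub>sec (I n) U\<^esub> dI (n - 1) U s"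
    if U: "openin X U" and z: "z \<in> carrier (sec (I n) U)" "dI n U z = \<one>\<^bsub>sec (I (n + 1)) U\<^esub>" for n U z
  proof -
    have "\<exists>y\<in>carrier (sec (K (n - 1)) U). dK (n - 1) U y = (\<lambda>c. 0, z)"
    proof (rule ex[OF _ _ _ _ _ U])
      show "(\<lambda>c. 0, z) \<in> carrier (sec (K n) U)" using z by (simp add: K_in cochains_add(4))
      show "dK n U (\<lambda>c. 0, z) = \<one>\<^bsub>sec (K (n + 1)) U\<^esub>"
        using z(2) monoid.l_one[OF mon[OF U] one_I[OF U]] monoid.one_closed[OF mon[OF U]]
        by (simp add: dK_def K_one cdiff_0 \<Phi>0[OF U] monoid.l_one[OF mon[OF U]])
    qed
    then obtain g s where "g \<in> carrier (sec (G n) U)" "s \<in> carrier (sec (I (n - 1)) U)"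
       "dK (n - 1) U (g, s) = (\<lambda>c. 0, z)" by (auto simp: K_in)
    then show ?thesis by (intro bexI[of _ g] bexI[of _ s]) (auto simp: dK_def fun_eq_iff)
  qed
  have inj: "\<exists>g'\<in>carrier (sec (G (n - 1)) U). dG (n - 1) U g' = g"
    if U: "openin X U" and g: "g \<in> carrier (sec (G n) U)" "dG n U g = (\<lambda>c. 0)"
      and s: "s \<in> carrier (sec (I (n - 1)) U)" and eq: "\<Phi> n U g = dI (n - 1) U s" for n U g s
  proof -
    interpret J: comm_group "sec (I n) U" by (rule cg[OF U])
    interpret J': comm_group "sec (I (n - 1)) U" by (rule cg[OF U])
    have "\<exists>y\<in>carrier (sec (K (n - 1 - 1)) U). dK (n - 1 - 1) U y = (g, inv\<^bsub>sec (I (n - 1)) U\<^esub> s)"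
    proof (rule ex[OF _ _ _ _ _ U])
      show "(g, inv\<^bsub>sec (I (n - 1)) U\<^esub> s) \<in> carrier (sec (K (n - 1)) U)" using g s by (simp add: K_in)
      have "dI (n - 1) U (inv\<^bsub>sec (I (n - 1)) U\<^esub> s) = inv\<^bsub>sec (I n) U\<^esub> (dI (n - 1) U s)"
        using sheaf_hom_inv[OF hom_dI sheaf_I sheaf_I U s] by simp
      then show "dK (n - 1) U (g, inv\<^bsub>sec (I (n - 1)) U\<^esub> s) = \<one>\<^bsub>sec (K (n - 1 + 1)) U\<^esub>"
        using g(2) eq \<Phi>c[OF U g(1)] by (simp add: dK_def K_one)
    qed
    then obtain g' where g': "g' \<in> carrier (sec (G (n - 1)) U)" "(\<lambda>c. - dG (n - 1) U g' c) = g"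
      by (auto simp: K_in dK_def)
    show ?thesis
      using cochains_add(3)[OF g'(1)] g'(2) by (intro bexI[of _ "\<lambda>c. - g' c"]) (simp_all add: cdiff_uminus)
  qed
  show ?thesis unfolding comparison_def
    by (intro exI[of _ \<Phi>] conjI allI impI) ((rule hom comm augm surj inj; assumption)+)
qed

lemma sections_exact_iff:
  assumes U: "openin X U"
  shows "(\<forall>z\<in>carrier (sec (I n) U). dI n U z = \<one>\<^bsub>sec (I (n + 1)) U\<^esub> \<longrightarrow> (\<exists>s\<in>carrier (sec (I (n - 1)) U). dI (n - 1) U s = z))
     \<longleftrightarrow> (\<forall>g\<in>carrier (sec (G n) U). dG n U g = (\<lambda>c. 0) \<longrightarrow> (\<exists>g'\<in>carrier (sec (G (n - 1)) U). dG (n - 1) U g' = g))"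
    (is "?L \<longleftrightarrow> ?R")
proof -
  obtain \<Phi> where c: "comparison \<Phi>" using ex_comparison_quasi_iso by blast
  note hom = comparison_hom[OF c U] and comm = comparison_comm[OF c U]
    and surj = comparison_surj[OF c U] and inj = comparison_inj[OF c U]
  have \<Phi>c: "\<Phi> n U g \<in> carrier (sec (I n) U)" if "g \<in> carrier (sec (G n) U)" for n g
    by (rule sheaf_hom_closed[OF hom U that])
  have \<Phi>0: "\<Phi> n U (\<lambda>c. 0) = \<one>\<^bsub>sec (I n) U\<^esub>" for n
    using sheaf_hom_one[OF hom sheaf_sky sheaf_I U] by simp
  show ?thesis
  proof
    assume L: ?L
    show ?R
    proof (intro ballI impI)
      fix g assume g: "g \<in> carrier (sec (G n) U)" "dG n U g = (\<lambda>c. 0)"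
      have "dI n U (\<Phi> n U g) = \<one>\<^bsub>sec (I (n + 1)) U\<^esub>" using comm[OF g(1)] g(2) \<Phi>0 by simp
      then obtain s where "s\<in>carrier (sec (I (n - 1)) U)" "dI (n - 1) U s = \<Phi> n U g" using L \<Phi>c[OF g(1)] by blast
      then show "\<exists>g'\<in>carrier (sec (G (n - 1)) U). dG (n - 1) U g' = g" using inj[OF g] by metis
    qed
  next
    assume Rr: ?R
    show ?L
    proof (intro ballI impI)
      fix z assume z: "z \<in> carrier (sec (I n) U)" "dI n U z = \<one>\<^bsub>sec (I (n + 1)) U\<^esub>"
      obtain g s where gs: "g\<in>carrier (sec (G n) U)" "s\<in>carrier (sec (I (n - 1)) U)"
           "dG n U g = (\<lambda>c. 0)" "z = \<Phi> n U g \<otimes>\<^bsub>sec (I n) U\<^esub> dI (n - 1) U s" using surj[OF z] by blast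
      obtain g' where g': "g'\<in>carrier (sec (G (n - 1)) U)" "dG (n - 1) U g' = g" using Rr gs by blast
      have "\<Phi> n U g = dI (n - 1) U (\<Phi> (n - 1) U g')" using comm[OF g'(1)] g'(2) by simp
      then have "z = dI (n - 1) U (\<Phi> (n - 1) U g' \<otimes>\<^bsub>sec (I (n - 1)) U\<^esub> s)"
        using gs(4) sheaf_hom_mult[OF hom_dI U \<Phi>c[OF g'(1)] gs(2)] by simp
      then show "\<exists>s\<in>carrier (sec (I (n - 1)) U). dI (n - 1) U s = z"
        using monoid.m_closed[OF group.is_monoid[OF sh_group[OF sheaf_I U]] \<Phi>c[OF g'(1)] gs(2)] by blast
    qed
  qed
qed

text \<open>The cocycles of degree \<open>0\<close> over an open set come from the sections of \<open>\<int>\<^sub>S\<close>.\<close>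

lemma global_sections_0:
  assumes U: "openin X U" and z: "z \<in> carrier (sec (I 0) U)" "dI 0 U z = \<one>\<^bsub>sec (I 1) U\<^esub>"
  shows "\<exists>u. loc_const X S U u \<and> z = raug R U u"
proof -
  obtain \<Phi> where c: "comparison \<Phi>" using ex_comparison_quasi_iso by blast
  note hom = comparison_hom[OF c U] and augm = comparison_aug[OF c U] and surj = comparison_surj[OF c U]
  obtain g s where gs: "g\<in>carrier (sec (G 0) U)" "s\<in>carrier (sec (I (- 1)) U)"
     "dG 0 U g = (\<lambda>c. 0)" "z = \<Phi> 0 U g \<otimes>\<^bsub>sec (I 0) U\<^esub> dI (- 1) U s" using surj[of z 0] z by auto
  have "s = \<one>\<^bsub>sec (I (- 1)) U\<^esub>" using neg_I_eq[OF _ U gs(2)] by simp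
  then have "dI (- 1) U s = \<one>\<^bsub>sec (I 0) U\<^esub>" using sheaf_hom_one[OF hom_dI sheaf_I sheaf_I U, of "- 1"] by simp
  then have "z = \<Phi> 0 U g"
    using gs(4) monoid.r_one[OF group.is_monoid[OF sh_group[OF sheaf_I U]] sheaf_hom_closed[OF hom U gs(1)]] by simp
  moreover obtain u where "loc_const X S U u" "aug u = g" using cdiff_0_aug[OF U gs(1,3)] by blast
  ultimately show ?thesis using augm by blast
qed

end

section \<open>Cochain complexes\<close>

text \<open>Cochain complexes of abelian groups; the record type itself imposes no laws.\<close>

definition valid_cochain :: "'a cochain \<Rightarrow> bool" where
  "valid_cochain C \<longleftrightarrow> (\<forall>n. comm_group (grp C n) \<and> diff C n \<in> hom (grp C n) (grp C (n + 1)) \<and>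
     (\<forall>x\<in>carrier (grp C n). diff C (n + 1) (diff C n x) = \<one>\<^bsub>grp C (n + 2)\<^esub>))"

context
  fixes C :: "'a cochain"
  assumes C: "valid_cochain C"
begin

lemma valid_comm_group: "comm_group (grp C n)"
  and valid_diff: "diff C n \<in> hom (grp C n) (grp C (n + 1))"
  and valid_diff_diff: "x \<in> carrier (grp C n) \<Longrightarrow> diff C (n + 1) (diff C n x) = \<one>\<^bsub>grp C (n + 2)\<^esub>"
  using C by (simp_all add: valid_cochain_def)

lemma valid_group: "group (grp C n)"
  using valid_comm_group by (simp add: comm_group_def)

lemma diff_closed: "x \<in> carrier (grp C n) \<Longrightarrow> diff C n x \<in> carrier (grp C (n + 1))"
  by (rule hom_in_carrier[OF valid_diff])

lemma diff_pred_closed: "x \<in> carrier (grp C (n - 1)) \<Longrightarrow> diff C (n - 1) x \<in> carrier (grp C n)"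
  using diff_closed[of x "n - 1"] by simp

lemma diff_mult: "x \<in> carrier (grp C n) \<Longrightarrow> y \<in> carrier (grp C n) \<Longrightarrow>
    diff C n (x \<otimes>\<^bsub>grp C n\<^esub> y) = diff C n x \<otimes>\<^bsub>grp C (n + 1)\<^esub> diff C n y"
  by (rule hom_mult[OF valid_diff])

lemma diff_inv: "x \<in> carrier (grp C n) \<Longrightarrow> diff C n (inv\<^bsub>grp C n\<^esub> x) = inv\<^bsub>grp C (n + 1)\<^esub> (diff C n x)"
  by (rule hom_inv_eq[OF valid_diff valid_group valid_group])

lemma diff_pred_diff: "x \<in> carrier (grp C (n - 1)) \<Longrightarrow> diff C n (diff C (n - 1) x) = \<one>\<^bsub>grp C (n + 1)\<^esub>"
  using valid_diff_diff[of x "n - 1"] by (simp add: add.commute)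

lemma cocycles_iff: "z \<in> cocycles C n \<longleftrightarrow> z \<in> carrier (grp C n) \<and> diff C n z = \<one>\<^bsub>grp C (n + 1)\<^esub>"
  by (auto simp: cocycles_def kernel_def)

lemma coboundaries_iff: "z \<in> coboundaries C n \<longleftrightarrow> (\<exists>y\<in>carrier (grp C (n - 1)). diff C (n - 1) y = z)"
  by (auto simp: coboundaries_def)

lemma subgroup_cocycles: "subgroup (cocycles C n) (grp C n)"
  unfolding cocycles_def
  by (rule group_hom.subgroup_kernel) (simp add: group_hom_def group_hom_axioms_def valid_group valid_diff)

lemma coboundaries_subset: "coboundaries C n \<subseteq> cocycles C n"
  by (auto simp: coboundaries_iff cocycles_iff diff_pred_closed diff_pred_diff)

lemma subgroup_coboundaries: "subgroup (coboundaries C n) (grp C n)"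
proof -
  have "diff C (n - 1) \<in> hom (grp C (n - 1)) (grp C n)" using valid_diff[of "n - 1"] by simp
  then show ?thesis
    unfolding coboundaries_def
    by (intro group_hom.img_is_subgroup) (simp add: group_hom_def group_hom_axioms_def valid_group)
qed

lemma comm_group_cocycles: "comm_group ((grp C n)\<lparr>carrier := cocycles C n\<rparr>)"
  by (rule comm_group_subgroup[OF valid_comm_group subgroup_cocycles])

lemma subgroup_coboundaries_cocycles: "subgroup (coboundaries C n) ((grp C n)\<lparr>carrier := cocycles C n\<rparr>)"
  using group.subgroup_incl[OF valid_group subgroup_coboundaries subgroup_cocycles coboundaries_subset] .

text \<open>The cohomology class of a cocycle.\<close>

definition cls :: "int \<Rightarrow> 'a \<Rightarrow> 'a set" where
  "cls n z = coboundaries C n #>\<^bsub>grp C n\<^esub> z"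

lemma carrier_cohom: "carrier (cohom C n) = cls n ` cocycles C n"
  by (auto simp: cohom_def FactGroup_def RCOSETS_def cls_def r_coset_def)

lemma one_cohom: "\<one>\<^bsub>cohom C n\<^esub> = coboundaries C n"
  by (simp add: cohom_def FactGroup_def)

lemma group_cohom: "group (cohom C n)"
  unfolding cohom_def
  using comm_group.abelian_FactGroup[OF comm_group_cocycles subgroup_coboundaries_cocycles]
  by (simp add: comm_group_def)

lemma mult_cls:
  assumes "z \<in> cocycles C n" "w \<in> cocycles C n"
  shows "cls n z \<otimes>\<^bsub>cohom C n\<^esub> cls n w = cls n (z \<otimes>\<^bsub>grp C n\<^esub> w)"
proof -
  interpret G: comm_group "grp C n" by (rule valid_comm_group)
  have n: "coboundaries C n \<lhd> grp C n"
    using G.normal_iff_subgroup subgroup_coboundaries by blast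
  have "z \<in> carrier (grp C n)" "w \<in> carrier (grp C n)" using assms by (auto simp: cocycles_iff)
  then have "cls n z <#>\<^bsub>grp C n\<^esub> cls n w = cls n (z \<otimes>\<^bsub>grp C n\<^esub> w)"
    unfolding cls_def by (rule normal.rcos_sum[OF n])
  then show ?thesis by (simp add: cohom_def FactGroup_def set_mult_def)
qed

lemma cls_eq_iff:
  assumes "z \<in> cocycles C n" "w \<in> cocycles C n"
  shows "cls n z = cls n w \<longleftrightarrow> z \<otimes>\<^bsub>grp C n\<^esub> inv\<^bsub>grp C n\<^esub> w \<in> coboundaries C n"
proof -
  interpret G: comm_group "grp C n" by (rule valid_comm_group)
  have c: "z \<in> carrier (grp C n)" "w \<in> carrier (grp C n)" using assms by (auto simp: cocycles_iff)
  note B = subgroup_coboundaries[of n]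
  show ?thesis
  proof
    assume "cls n z = cls n w"
    then have "z \<in> cls n w" using G.rcos_self[OF c(1) B] by (simp add: cls_def)
    then obtain b where b: "b \<in> coboundaries C n" "z = b \<otimes>\<^bsub>grp C n\<^esub> w" by (auto simp: cls_def r_coset_def)
    then have "z \<otimes>\<^bsub>grp C n\<^esub> inv\<^bsub>grp C n\<^esub> w = b" using c subgroup.mem_carrier[OF B b(1)] by (simp add: G.m_assoc)
    then show "z \<otimes>\<^bsub>grp C n\<^esub> inv\<^bsub>grp C n\<^esub> w \<in> coboundaries C n" using b by simp
  next
    assume b: "z \<otimes>\<^bsub>grp C n\<^esub> inv\<^bsub>grp C n\<^esub> w \<in> coboundaries C n"
    have "z = (z \<otimes>\<^bsub>grp C n\<^esub> inv\<^bsub>grp C n\<^esub> w) \<otimes>\<^bsub>grp C n\<^esub> w" using c by (simp add: G.m_assoc)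
    then have "z \<in> cls n w" using b unfolding cls_def r_coset_def by blast
    then show "cls n z = cls n w"
      using G.repr_independence[OF _ c(2) B] by (simp add: cls_def)
  qed
qed

lemma acyclic_cochain_iff:
  "acyclic_cochain C \<longleftrightarrow> (\<forall>n. \<forall>z\<in>carrier (grp C n). diff C n z = \<one>\<^bsub>grp C (n + 1)\<^esub> \<longrightarrow>
      (\<exists>y\<in>carrier (grp C (n - 1)). diff C (n - 1) y = z))"
proof -
  have "trivial_group (cohom C n) \<longleftrightarrow> cocycles C n \<subseteq> coboundaries C n" for n
  proof -
    interpret G: comm_group "grp C n" by (rule valid_comm_group)
    have one: "\<one>\<^bsub>grp C n\<^esub> \<in> cocycles C n" by (rule subgroup.one_closed[OF subgroup_cocycles])
    have cls1: "cls n \<one>\<^bsub>grp C n\<^esub> = coboundaries C n"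
      unfolding cls_def using G.coset_mult_one[OF subgroup.subset[OF subgroup_coboundaries]] .
    have eq: "cls n z = coboundaries C n \<longleftrightarrow> z \<in> coboundaries C n" if "z \<in> cocycles C n" for z
      using cls_eq_iff[OF that one] cls1 that by (simp add: cocycles_iff)
    have "trivial_group (cohom C n) \<longleftrightarrow> cls n ` cocycles C n = {coboundaries C n}"
      by (simp add: trivial_group_def group_cohom carrier_cohom one_cohom)
    also have "\<dots> \<longleftrightarrow> cocycles C n \<subseteq> coboundaries C n"
      using eq one by (auto simp: image_iff)
    finally show ?thesis .
  qed
  then show ?thesis
    unfolding acyclic_cochain_def subset_iff cocycles_iff coboundaries_iff by blast
qed

end

text \<open>A morphism of complexes is a quasi-isomorphism iff it is injective and surjective on cohomology,
  stated for cocycles.\<close>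

lemma quasi_iso_iff:
  assumes C: "valid_cochain C" and D: "valid_cochain D" and f: "chain_map C D f"
  shows "quasi_iso C D f \<longleftrightarrow> (\<forall>n.
     (\<forall>z\<in>cocycles C n. f n z \<in> coboundaries D n \<longrightarrow> z \<in> coboundaries C n) \<and>
     (\<forall>w\<in>cocycles D n. \<exists>z\<in>cocycles C n. w \<otimes>\<^bsub>grp D n\<^esub> inv\<^bsub>grp D n\<^esub> f n z \<in> coboundaries D n))"
proof -
  have hom: "f n \<in> hom (grp C n) (grp D n)" and comm: "x \<in> carrier (grp C n) \<Longrightarrow> f (n + 1) (diff C n x) = diff D n (f n x)" for n x
    using f by (auto simp: chain_map_def)
  have fc: "f n z \<in> carrier (grp D n)" if "z \<in> carrier (grp C n)" for n z by (rule hom_in_carrier[OF hom that])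
  have f1: "f n \<one>\<^bsub>grp C n\<^esub> = \<one>\<^bsub>grp D n\<^esub>" for n by (rule hom_one[OF hom valid_group[OF C] valid_group[OF D]])
  have fZ: "f n z \<in> cocycles D n" if "z \<in> cocycles C n" for n z
    using that comm[of z n] f1[of "n + 1"] fc by (simp add: cocycles_iff[OF C] cocycles_iff[OF D])
  have fB: "f n z \<in> coboundaries D n" if "z \<in> coboundaries C n" for n z
  proof -
    obtain y where y: "y \<in> carrier (grp C (n - 1))" "diff C (n - 1) y = z"
      using \<open>z \<in> coboundaries C n\<close> coboundaries_iff[OF C] by blast
    then have "f n z = diff D (n - 1) (f (n - 1) y)" using comm[OF y(1)] by simp
    then show ?thesis using fc[OF y(1)] unfolding coboundaries_iff[OF D] by metis
  qed
  have map: "cohom_map C D f n (cls C n z) = cls D n (f n z)" if z: "z \<in> cocycles C n" for n z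
  proof -
    interpret G: comm_group "grp D n" by (rule valid_comm_group[OF D])
    note BC = subgroup_coboundaries[OF C, of n] and BD = subgroup_coboundaries[OF D, of n]
    have zc: "z \<in> carrier (grp C n)" using z cocycles_iff[OF C] by blast
    have "f n ` cls C n z = (\<lambda>b. f n b \<otimes>\<^bsub>grp D n\<^esub> f n z) ` coboundaries C n"
    proof -
      have "f n (b \<otimes>\<^bsub>grp C n\<^esub> z) = f n b \<otimes>\<^bsub>grp D n\<^esub> f n z" if "b \<in> coboundaries C n" for b
        using hom_mult[OF hom subgroup.mem_carrier[OF BC that] zc] .
      moreover have "cls C n z = (\<lambda>b. b \<otimes>\<^bsub>grp C n\<^esub> z) ` coboundaries C n"
        by (auto simp: cls_def[OF C] r_coset_def)
      ultimately show ?thesis by (simp add: image_image)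
    qed
    then have "cohom_map C D f n (cls C n z) =
      {b \<otimes>\<^bsub>grp D n\<^esub> (f n b' \<otimes>\<^bsub>grp D n\<^esub> f n z) | b b'. b \<in> coboundaries D n \<and> b' \<in> coboundaries C n}"
      by (auto simp: cohom_map_def set_mult_def)
    also have "\<dots> = cls D n (f n z)"
    proof
      show "{b \<otimes>\<^bsub>grp D n\<^esub> (f n b' \<otimes>\<^bsub>grp D n\<^esub> f n z) | b b'. b \<in> coboundaries D n \<and> b' \<in> coboundaries C n} \<subseteq> cls D n (f n z)"
      proof (clarsimp simp: cls_def[OF D] r_coset_def)
        fix b b' assume b: "b \<in> coboundaries D n" "b' \<in> coboundaries C n"
        have "b \<otimes>\<^bsub>grp D n\<^esub> (f n b' \<otimes>\<^bsub>grp D n\<^esub> f n z) = (b \<otimes>\<^bsub>grp D n\<^esub> f n b') \<otimes>\<^bsub>grp D n\<^esub> f n z"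
          using subgroup.mem_carrier[OF BD] b fB fc[OF zc] by (simp add: G.m_assoc)
        then show "\<exists>h\<in>coboundaries D n. b \<otimes>\<^bsub>grp D n\<^esub> (f n b' \<otimes>\<^bsub>grp D n\<^esub> f n z) = h \<otimes>\<^bsub>grp D n\<^esub> f n z"
          using subgroup.m_closed[OF BD b(1) fB[OF b(2)]] by blast
      qed
      show "cls D n (f n z) \<subseteq> {b \<otimes>\<^bsub>grp D n\<^esub> (f n b' \<otimes>\<^bsub>grp D n\<^esub> f n z) | b b'. b \<in> coboundaries D n \<and> b' \<in> coboundaries C n}"
      proof (clarsimp simp: cls_def[OF D] r_coset_def)
        fix b assume b: "b \<in> coboundaries D n"
        have "b \<otimes>\<^bsub>grp D n\<^esub> f n z = b \<otimes>\<^bsub>grp D n\<^esub> (f n \<one>\<^bsub>grp C n\<^esub> \<otimes>\<^bsub>grp D n\<^esub> f n z)"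
          using fc[OF zc] f1 by simp
        then show "\<exists>ba b'. b \<otimes>\<^bsub>grp D n\<^esub> f n z = ba \<otimes>\<^bsub>grp D n\<^esub> (f n b' \<otimes>\<^bsub>grp D n\<^esub> f n z) \<and> ba \<in> coboundaries D n \<and> b' \<in> coboundaries C n"
          using b subgroup.one_closed[OF BC] by blast
      qed
    qed
    finally show ?thesis .
  qed
  have mZ: "z \<otimes>\<^bsub>grp C n\<^esub> w \<in> cocycles C n" "inv\<^bsub>grp C n\<^esub> z \<in> cocycles C n" if "z \<in> cocycles C n" "w \<in> cocycles C n" for z w n
    using subgroup.m_closed[OF subgroup_cocycles[OF C]] subgroup.m_inv_closed[OF subgroup_cocycles[OF C]] that by blast+
  have Zc: "z \<in> carrier (grp C n)" if "z \<in> cocycles C n" for z n using that cocycles_iff[OF C] by blast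
  have h: "cohom_map C D f n \<in> hom (cohom C n) (cohom D n)" for n
  proof (rule homI)
    fix K assume "K \<in> carrier (cohom C n)"
    then show "cohom_map C D f n K \<in> carrier (cohom D n)"
      using map fZ by (auto simp: carrier_cohom[OF C] carrier_cohom[OF D])
  next
    fix K L assume "K \<in> carrier (cohom C n)" "L \<in> carrier (cohom C n)"
    then obtain z w where "z \<in> cocycles C n" "K = cls C n z" "w \<in> cocycles C n" "L = cls C n w"
      by (auto simp: carrier_cohom[OF C])
    then show "cohom_map C D f n (K \<otimes>\<^bsub>cohom C n\<^esub> L) = cohom_map C D f n K \<otimes>\<^bsub>cohom D n\<^esub> cohom_map C D f n L"
      by (simp add: mult_cls[OF C] mult_cls[OF D] map mZ fZ hom_mult[OF hom] Zc)
  qed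
  have inj: "inj_on (cohom_map C D f n) (carrier (cohom C n)) \<longleftrightarrow>
     (\<forall>z\<in>cocycles C n. f n z \<in> coboundaries D n \<longrightarrow> z \<in> coboundaries C n)" for n
  proof
    interpret GC: comm_group "grp C n" by (rule valid_comm_group[OF C])
    interpret GD: comm_group "grp D n" by (rule valid_comm_group[OF D])
    have one: "\<one>\<^bsub>grp C n\<^esub> \<in> cocycles C n" by (rule subgroup.one_closed[OF subgroup_cocycles[OF C]])
    {
      assume i: "inj_on (cohom_map C D f n) (carrier (cohom C n))"
      show "\<forall>z\<in>cocycles C n. f n z \<in> coboundaries D n \<longrightarrow> z \<in> coboundaries C n"
      proof (intro ballI impI)
        fix z assume z: "z \<in> cocycles C n" and b: "f n z \<in> coboundaries D n"
        have "cls D n (f n z) = cls D n (f n \<one>\<^bsub>grp C n\<^esub>)"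
          using cls_eq_iff[OF D fZ[OF z] fZ[OF one]] f1 fc[OF Zc[OF z]] b by simp
        then have "cls C n z = cls C n \<one>\<^bsub>grp C n\<^esub>"
          using z one by (intro inj_onD[OF i]) (simp_all add: map carrier_cohom[OF C])
        then show "z \<in> coboundaries C n" using cls_eq_iff[OF C z one] Zc[OF z] by simp
      qed
    }
    {
      assume i: "\<forall>z\<in>cocycles C n. f n z \<in> coboundaries D n \<longrightarrow> z \<in> coboundaries C n"
      show "inj_on (cohom_map C D f n) (carrier (cohom C n))"
      proof (rule inj_onI)
        fix K L assume "K \<in> carrier (cohom C n)" "L \<in> carrier (cohom C n)"
          and eq: "cohom_map C D f n K = cohom_map C D f n L"
        then obtain z w where zw: "z \<in> cocycles C n" "K = cls C n z" "w \<in> cocycles C n" "L = cls C n w"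
          by (auto simp: carrier_cohom[OF C])
        have "f n z \<otimes>\<^bsub>grp D n\<^esub> inv\<^bsub>grp D n\<^esub> f n w \<in> coboundaries D n"
          using eq zw map cls_eq_iff[OF D fZ[OF zw(1)] fZ[OF zw(3)]] by simp
        then have "f n (z \<otimes>\<^bsub>grp C n\<^esub> inv\<^bsub>grp C n\<^esub> w) \<in> coboundaries D n"
          using Zc[OF zw(1)] Zc[OF zw(3)] hom_inv_eq[OF hom GC.is_group GD.is_group] by (simp add: hom_mult[OF hom])
        then have "z \<otimes>\<^bsub>grp C n\<^esub> inv\<^bsub>grp C n\<^esub> w \<in> coboundaries C n"
          using i mZ(1)[OF zw(1) mZ(2)[OF zw(3) zw(3)]] by blast
        then show "K = L" using zw(2,4) cls_eq_iff[OF C zw(1,3)] by simp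
      qed
    }
  qed
  have surj: "cohom_map C D f n ` carrier (cohom C n) = carrier (cohom D n) \<longleftrightarrow>
     (\<forall>w\<in>cocycles D n. \<exists>z\<in>cocycles C n. w \<otimes>\<^bsub>grp D n\<^esub> inv\<^bsub>grp D n\<^esub> f n z \<in> coboundaries D n)" for n
  proof -
    have im: "cohom_map C D f n ` carrier (cohom C n) = (\<lambda>z. cls D n (f n z)) ` cocycles C n"
      unfolding carrier_cohom[OF C] image_image using map by (rule image_cong[OF refl])
    have sub: "(\<lambda>z. cls D n (f n z)) ` cocycles C n \<subseteq> cls D n ` cocycles D n" using fZ by auto
    have "cohom_map C D f n ` carrier (cohom C n) = carrier (cohom D n) \<longleftrightarrow>
       cls D n ` cocycles D n \<subseteq> (\<lambda>z. cls D n (f n z)) ` cocycles C n"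
      unfolding im carrier_cohom[OF D] using sub by (simp add: set_eq_subset)
    also have "\<dots> \<longleftrightarrow> (\<forall>w\<in>cocycles D n. \<exists>z\<in>cocycles C n. cls D n w = cls D n (f n z))"
      by (simp add: image_subset_iff image_iff)
    also have "\<dots> \<longleftrightarrow>
       (\<forall>w\<in>cocycles D n. \<exists>z\<in>cocycles C n. w \<otimes>\<^bsub>grp D n\<^esub> inv\<^bsub>grp D n\<^esub> f n z \<in> coboundaries D n)"
      by (intro ball_cong bex_cong refl) (simp add: cls_eq_iff[OF D _ fZ])
    finally show ?thesis .
  qed
  show ?thesis
    unfolding quasi_iso_def iso_def bij_betw_def using f h inj surj by auto
qed

text \<open>In a short exact sequence \<open>0 \<rightarrow> A \<rightarrow> B \<rightarrow> C \<rightarrow> 0\<close> of complexes, the map \<open>A \<rightarrow> B\<close> is a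
  quasi-isomorphism iff \<open>C\<close> is acyclic.\<close>

lemma quasi_iso_iff_quotient_acyclic:
  assumes A: "valid_cochain A" and B: "valid_cochain B" and C: "valid_cochain C"
    and f: "chain_map A B f" and g: "chain_map B C g"
    and inj: "\<And>n x. x \<in> carrier (grp A n) \<Longrightarrow> f n x = \<one>\<^bsub>grp B n\<^esub> \<Longrightarrow> x = \<one>\<^bsub>grp A n\<^esub>"
    and zero: "\<And>n x. x \<in> carrier (grp A n) \<Longrightarrow> g n (f n x) = \<one>\<^bsub>grp C n\<^esub>"
    and exact: "\<And>n y. y \<in> carrier (grp B n) \<Longrightarrow> g n y = \<one>\<^bsub>grp C n\<^esub> \<Longrightarrow> \<exists>x\<in>carrier (grp A n). f n x = y"
    and surj: "\<And>n z. z \<in> carrier (grp C n) \<Longrightarrow> \<exists>y\<in>carrier (grp B n). g n y = z"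
  shows "quasi_iso A B f \<longleftrightarrow> acyclic_cochain C"
proof -
  have hf: "f n \<in> hom (grp A n) (grp B n)" and cf: "x \<in> carrier (grp A n) \<Longrightarrow> f (n + 1) (diff A n x) = diff B n (f n x)" for n x
    using f by (auto simp: chain_map_def)
  have hg: "g n \<in> hom (grp B n) (grp C n)" and cg: "x \<in> carrier (grp B n) \<Longrightarrow> g (n + 1) (diff B n x) = diff C n (g n x)" for n x
    using g by (auto simp: chain_map_def)
  have cf': "f n (diff A (n - 1) x) = diff B (n - 1) (f (n - 1) x)" if "x \<in> carrier (grp A (n - 1))" for n x
    using cf[OF that] by simp
  have cg': "g n (diff B (n - 1) x) = diff C (n - 1) (g (n - 1) x)" if "x \<in> carrier (grp B (n - 1))" for n x
    using cg[OF that] by simp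
  have fc: "f n x \<in> carrier (grp B n)" if "x \<in> carrier (grp A n)" for n x by (rule hom_in_carrier[OF hf that])
  have gc: "g n x \<in> carrier (grp C n)" if "x \<in> carrier (grp B n)" for n x by (rule hom_in_carrier[OF hg that])
  have g1: "g n \<one>\<^bsub>grp B n\<^esub> = \<one>\<^bsub>grp C n\<^esub>" for n by (rule hom_one[OF hg valid_group[OF B] valid_group[OF C]])
  have ginv: "g n (inv\<^bsub>grp B n\<^esub> y) = inv\<^bsub>grp C n\<^esub> (g n y)" if "y \<in> carrier (grp B n)" for n y
    by (rule hom_inv_eq[OF hg valid_group[OF B] valid_group[OF C] that])
  have gB: "comm_group (grp B n)" and gC: "comm_group (grp C n)" for n
    by (rule valid_comm_group[OF B], rule valid_comm_group[OF C])
  show ?thesis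
  proof
    assume ac: "acyclic_cochain C"
    have ac': "\<exists>y\<in>carrier (grp C (n - 1)). diff C (n - 1) y = z"
      if "z \<in> carrier (grp C n)" "diff C n z = \<one>\<^bsub>grp C (n + 1)\<^esub>" for n z
      using ac that acyclic_cochain_iff[OF C] by blast
    show "quasi_iso A B f"
      unfolding quasi_iso_iff[OF A B f]
    proof (intro allI conjI ballI impI)
      fix n z assume z: "z \<in> cocycles A n" and bz: "f n z \<in> coboundaries B n"
      define m where "m = n - 1"
      interpret Bm: comm_group "grp B m" by (rule gB)
      interpret Cm: comm_group "grp C m" by (rule gC)
      interpret Bn: comm_group "grp B n" by (rule gB)
      have zc: "z \<in> carrier (grp A n)" using z cocycles_iff[OF A] by blast
      obtain y where y: "y \<in> carrier (grp B m)" "diff B m y = f n z" using bz coboundaries_iff[OF B] by (auto simp: m_def)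
      have "diff C m (g m y) = \<one>\<^bsub>grp C (m + 1)\<^esub>" using cg[OF y(1)] y(2) zero[OF zc] by (simp add: m_def)
      then obtain c where c: "c \<in> carrier (grp C (m - 1))" "diff C (m - 1) c = g m y" using ac'[OF gc[OF y(1)]] by blast
      obtain b where b: "b \<in> carrier (grp B (m - 1))" "g (m - 1) b = c" using surj[OF c(1)] by blast
      have db: "diff B (m - 1) b \<in> carrier (grp B m)" by (rule diff_pred_closed[OF B b(1)])
      have "g m (y \<otimes>\<^bsub>grp B m\<^esub> inv\<^bsub>grp B m\<^esub> diff B (m - 1) b) = \<one>\<^bsub>grp C m\<^esub>"
        using y db b(2) c(2) cg'[OF b(1)] gc[OF y(1)] by (simp add: hom_mult[OF hg] ginv)
      then obtain x where x: "x \<in> carrier (grp A m)" "f m x = y \<otimes>\<^bsub>grp B m\<^esub> inv\<^bsub>grp B m\<^esub> diff B (m - 1) b"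
        using exact[of "y \<otimes>\<^bsub>grp B m\<^esub> inv\<^bsub>grp B m\<^esub> diff B (m - 1) b" m] y db by auto
      have "f n (diff A m x) = diff B m (f m x)" using cf[OF x(1)] by (simp add: m_def)
      also have "\<dots> = f n z"
      proof -
        have "diff B m (f m x) = diff B m y \<otimes>\<^bsub>grp B (m + 1)\<^esub> inv\<^bsub>grp B (m + 1)\<^esub> diff B m (diff B (m - 1) b)"
          using y(1) db diff_inv[OF B db] by (simp add: x(2) diff_mult[OF B])
        then show ?thesis using y(2) diff_pred_diff[OF B b(1)] fc[OF zc] by (simp add: m_def)
      qed
      finally have fe: "f n (diff A m x) = f n z" .
      have dx: "diff A m x \<in> carrier (grp A n)" using diff_closed[OF A x(1)] by (simp add: m_def)
      interpret An: comm_group "grp A n" by (rule valid_comm_group[OF A])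
      have "f n (diff A m x \<otimes>\<^bsub>grp A n\<^esub> inv\<^bsub>grp A n\<^esub> z) = \<one>\<^bsub>grp B n\<^esub>"
        using fe dx zc fc[OF zc] hom_inv_eq[OF hf An.is_group Bn.is_group zc] by (simp add: hom_mult[OF hf])
      then have "diff A m x \<otimes>\<^bsub>grp A n\<^esub> inv\<^bsub>grp A n\<^esub> z = \<one>\<^bsub>grp A n\<^esub>" using inj dx zc by simp
      then have "diff A m x = z" using dx zc by (metis An.inv_closed An.inv_equality An.inv_inv)
      then show "z \<in> coboundaries A n" using x(1) coboundaries_iff[OF A] by (auto simp: m_def)
    next
      fix n w assume w: "w \<in> cocycles B n"
      interpret Bn: comm_group "grp B n" by (rule gB)
      interpret Cn: comm_group "grp C n" by (rule gC)
      have wc: "w \<in> carrier (grp B n)" and dw: "diff B n w = \<one>\<^bsub>grp B (n + 1)\<^esub>" using w cocycles_iff[OF B] by blast+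
      have "diff C n (g n w) = \<one>\<^bsub>grp C (n + 1)\<^esub>" using cg[OF wc] dw g1 by simp
      then obtain c where c: "c \<in> carrier (grp C (n - 1))" "diff C (n - 1) c = g n w" using ac'[OF gc[OF wc]] by blast
      obtain b where b: "b \<in> carrier (grp B (n - 1))" "g (n - 1) b = c" using surj[OF c(1)] by blast
      define e where "e = diff B (n - 1) b"
      have e: "e \<in> carrier (grp B n)" unfolding e_def by (rule diff_pred_closed[OF B b(1)])
      have "g n (w \<otimes>\<^bsub>grp B n\<^esub> inv\<^bsub>grp B n\<^esub> e) = \<one>\<^bsub>grp C n\<^esub>"
        using wc e b(2) c(2) cg'[OF b(1)] gc[OF wc] by (simp add: hom_mult[OF hg] ginv e_def)
      then obtain x where x: "x \<in> carrier (grp A n)" "f n x = w \<otimes>\<^bsub>grp B n\<^esub> inv\<^bsub>grp B n\<^esub> e"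
        using exact[of "w \<otimes>\<^bsub>grp B n\<^esub> inv\<^bsub>grp B n\<^esub> e" n] wc e by auto
      interpret B1: comm_group "grp B (n + 1)" by (rule gB)
      have "f (n + 1) (diff A n x) = \<one>\<^bsub>grp B (n + 1)\<^esub>"
        using cf[OF x(1)] x(2) wc e dw diff_inv[OF B e] diff_pred_diff[OF B b(1)] by (simp add: diff_mult[OF B] e_def)
      then have "x \<in> cocycles A n" using inj[OF diff_closed[OF A x(1)]] x(1) cocycles_iff[OF A] by blast
      moreover have "w \<otimes>\<^bsub>grp B n\<^esub> inv\<^bsub>grp B n\<^esub> f n x = e"
        using wc e x(2) by (simp add: Bn.inv_mult Bn.m_assoc[symmetric])
      ultimately show "\<exists>z\<in>cocycles A n. w \<otimes>\<^bsub>grp B n\<^esub> inv\<^bsub>grp B n\<^esub> f n z \<in> coboundaries B n"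
        using b(1) coboundaries_iff[OF B] e_def by metis
    qed
  next
    assume q: "quasi_iso A B f"
    have qi: "z \<in> coboundaries A n" if "z \<in> cocycles A n" "f n z \<in> coboundaries B n" for n z
      using q that unfolding quasi_iso_iff[OF A B f] by blast
    have qs: "\<exists>z\<in>cocycles A n. w \<otimes>\<^bsub>grp B n\<^esub> inv\<^bsub>grp B n\<^esub> f n z \<in> coboundaries B n" if "w \<in> cocycles B n" for n w
      using q that unfolding quasi_iso_iff[OF A B f] by blast
    show "acyclic_cochain C"
      unfolding acyclic_cochain_iff[OF C]
    proof (intro allI ballI impI)
      fix n c assume c: "c \<in> carrier (grp C n)" "diff C n c = \<one>\<^bsub>grp C (n + 1)\<^esub>"
      interpret Bn: comm_group "grp B n" by (rule gB)
      interpret Cn: comm_group "grp C n" by (rule gC)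
      interpret B1: comm_group "grp B (n + 1)" by (rule gB)
      obtain y where y: "y \<in> carrier (grp B n)" "g n y = c" using surj[OF c(1)] by blast
      have "g (n + 1) (diff B n y) = \<one>\<^bsub>grp C (n + 1)\<^esub>" using cg[OF y(1)] y(2) c(2) by simp
      then obtain a where a: "a \<in> carrier (grp A (n + 1))" "f (n + 1) a = diff B n y"
        using exact[OF diff_closed[OF B y(1)]] by blast
      have "f (n + 1 + 1) (diff A (n + 1) a) = \<one>\<^bsub>grp B (n + 1 + 1)\<^esub>"
        using cf[OF a(1)] a(2) valid_diff_diff[OF B y(1)] by (simp add: add.commute)
      then have "a \<in> cocycles A (n + 1)"
        using inj[OF diff_closed[OF A a(1)]] a(1) cocycles_iff[OF A] by blast
      moreover have "f (n + 1) a \<in> coboundaries B (n + 1)" using a(2) y(1) coboundaries_iff[OF B] by auto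
      ultimately have "a \<in> coboundaries A (n + 1)" by (rule qi)
      then obtain x where x: "x \<in> carrier (grp A n)" "diff A n x = a" using coboundaries_iff[OF A] by auto
      define y' where "y' = y \<otimes>\<^bsub>grp B n\<^esub> inv\<^bsub>grp B n\<^esub> f n x"
      have y': "y' \<in> carrier (grp B n)" using y(1) fc[OF x(1)] by (simp add: y'_def)
      have "diff B n y' = \<one>\<^bsub>grp B (n + 1)\<^esub>"
        using y(1) fc[OF x(1)] cf[OF x(1)] x(2) a(2) diff_closed[OF B y(1)] diff_inv[OF B fc[OF x(1)]]
        by (simp add: y'_def diff_mult[OF B])
      then have "y' \<in> cocycles B n" using y' cocycles_iff[OF B] by blast
      then obtain z where z: "z \<in> cocycles A n" "y' \<otimes>\<^bsub>grp B n\<^esub> inv\<^bsub>grp B n\<^esub> f n z \<in> coboundaries B n" using qs by blast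
      then have zc: "z \<in> carrier (grp A n)" using cocycles_iff[OF A] by blast
      obtain v where v: "v \<in> carrier (grp B (n - 1))" "diff B (n - 1) v = y' \<otimes>\<^bsub>grp B n\<^esub> inv\<^bsub>grp B n\<^esub> f n z"
        using z(2) coboundaries_iff[OF B] by blast
      have "diff C (n - 1) (g (n - 1) v) = g n (y' \<otimes>\<^bsub>grp B n\<^esub> inv\<^bsub>grp B n\<^esub> f n z)" using cg'[OF v(1)] v(2) by simp
      also have "\<dots> = c"
        using y' y fc[OF zc] fc[OF x(1)] c(1) zero[OF zc] zero[OF x(1)] by (simp add: y'_def hom_mult[OF hg] ginv)
      finally show "\<exists>y\<in>carrier (grp C (n - 1)). diff C (n - 1) y = c" using gc[OF v(1)] by blast
    qed
  qed
qed

subsection \<open>The complex of integers and mapping cones\<close>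

lemma grp_int_cochain [simp]:
  "\<one>\<^bsub>grp int_cochain n\<^esub> = 0" "diff int_cochain n = (\<lambda>k. 0)"
  "k \<in> carrier (grp int_cochain n) \<longleftrightarrow> n = 0 \<or> k = 0"
  "k \<otimes>\<^bsub>grp int_cochain n\<^esub> l = (if n = 0 then k + l else 0)"
  by (auto simp: int_cochain_def integer_group_def singleton_group_def)

lemma comm_group_int_cochain: "comm_group (grp int_cochain n)"
proof (rule comm_groupI)
  fix k assume "k \<in> carrier (grp int_cochain n)"
  then show "\<exists>l\<in>carrier (grp int_cochain n). l \<otimes>\<^bsub>grp int_cochain n\<^esub> k = \<one>\<^bsub>grp int_cochain n\<^esub>"
    by (intro bexI[of _ "- k"]) auto
qed auto

lemma inv_int_cochain [simp]: "inv\<^bsub>grp int_cochain n\<^esub> 0 = 0"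
proof -
  interpret comm_group "grp int_cochain n" by (rule comm_group_int_cochain)
  show ?thesis using inv_one by simp
qed

lemma valid_int_cochain: "valid_cochain int_cochain"
  unfolding valid_cochain_def by (auto simp: comm_group_int_cochain intro!: homI)

lemma grp_cone: "grp (cone C D f) n = grp C (n + 1) \<times>\<times> grp D n"
  and diff_cone: "diff (cone C D f) n ab =
    (inv\<^bsub>grp C (n + 2)\<^esub> (diff C (n + 1) (fst ab)), f (n + 1) (fst ab) \<otimes>\<^bsub>grp D (n + 1)\<^esub> diff D n (snd ab))"
  by (simp_all add: cone_def case_prod_unfold)

lemma valid_cone_int:
  assumes D: "valid_cochain D" and f: "chain_map int_cochain D f"
  shows "valid_cochain (cone int_cochain D f)"
  unfolding valid_cochain_def
proof (intro allI conjI ballI)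
  have hom: "f n \<in> hom (grp int_cochain n) (grp D n)" and comm: "k \<in> carrier (grp int_cochain n) \<Longrightarrow> f (n + 1) 0 = diff D n (f n k)" for n k
    using f by (auto simp: chain_map_def)
  have fc: "f n k \<in> carrier (grp D n)" if "k \<in> carrier (grp int_cochain n)" for n k by (rule hom_in_carrier[OF hom that])
  have f0: "f n 0 = \<one>\<^bsub>grp D n\<^esub>" for n
    using hom_one[OF hom valid_group[OF valid_int_cochain] valid_group[OF D]] by simp
  fix n
  interpret D1: comm_group "grp D (n + 1)" by (rule valid_comm_group[OF D])
  interpret D2: comm_group "grp D (n + 1 + 1)" by (rule valid_comm_group[OF D])
  show "comm_group (grp (cone int_cochain D f) n)"
    unfolding grp_cone by (rule comm_group_DirProd[OF comm_group_int_cochain valid_comm_group[OF D]])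
  show "diff (cone int_cochain D f) n \<in> hom (grp (cone int_cochain D f) n) (grp (cone int_cochain D f) (n + 1))"
  proof (rule homI)
    fix x assume "x \<in> carrier (grp (cone int_cochain D f) n)"
    then have "fst x \<in> carrier (grp int_cochain (n + 1))" "snd x \<in> carrier (grp D n)" by (auto simp: grp_cone mem_Times_iff)
    then show "diff (cone int_cochain D f) n x \<in> carrier (grp (cone int_cochain D f) (n + 1))"
      using fc diff_closed[OF D] by (auto simp: grp_cone diff_cone)
  next
    fix x y assume "x \<in> carrier (grp (cone int_cochain D f) n)" "y \<in> carrier (grp (cone int_cochain D f) n)"
    then have c: "fst x \<in> carrier (grp int_cochain (n + 1))" "snd x \<in> carrier (grp D n)"
      "fst y \<in> carrier (grp int_cochain (n + 1))" "snd y \<in> carrier (grp D n)" by (auto simp: grp_cone mem_Times_iff)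
    have "f (n + 1) (fst x \<otimes>\<^bsub>grp int_cochain (n + 1)\<^esub> fst y) \<otimes>\<^bsub>grp D (n + 1)\<^esub> diff D n (snd x \<otimes>\<^bsub>grp D n\<^esub> snd y) =
      (f (n + 1) (fst x) \<otimes>\<^bsub>grp D (n + 1)\<^esub> diff D n (snd x)) \<otimes>\<^bsub>grp D (n + 1)\<^esub> (f (n + 1) (fst y) \<otimes>\<^bsub>grp D (n + 1)\<^esub> diff D n (snd y))"
      using fc[OF c(1)] fc[OF c(3)] diff_closed[OF D c(2)] diff_closed[OF D c(4)]
      unfolding hom_mult[OF hom c(1,3)] diff_mult[OF D c(2,4)] by (simp add: D1.m_ac)
    then show "diff (cone int_cochain D f) n (x \<otimes>\<^bsub>grp (cone int_cochain D f) n\<^esub> y) =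
      diff (cone int_cochain D f) n x \<otimes>\<^bsub>grp (cone int_cochain D f) (n + 1)\<^esub> diff (cone int_cochain D f) n y"
      by (simp add: grp_cone diff_cone DirProd_mult del: grp_int_cochain(4)) simp
  qed
  fix x assume "x \<in> carrier (grp (cone int_cochain D f) n)"
  then have c: "fst x \<in> carrier (grp int_cochain (n + 1))" "snd x \<in> carrier (grp D n)" by (auto simp: grp_cone mem_Times_iff)
  have "diff D (n + 1) (f (n + 1) (fst x) \<otimes>\<^bsub>grp D (n + 1)\<^esub> diff D n (snd x)) = \<one>\<^bsub>grp D (n + 1 + 1)\<^esub>"
    unfolding diff_mult[OF D fc[OF c(1)] diff_closed[OF D c(2)]]
    using valid_diff_diff[OF D c(2)] comm[OF c(1)] f0[of "n + 1 + 1"] D2.r_one[OF D2.one_closed]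
    by (simp add: add.commute)
  then show "diff (cone int_cochain D f) (n + 1) (diff (cone int_cochain D f) n x) = \<one>\<^bsub>grp (cone int_cochain D f) (n + 2)\<^esub>"
    using f0[of "n + 1 + 1"] D2.r_one[OF D2.one_closed] by (simp add: grp_cone diff_cone add.commute)
qed

section \<open>Sections of resolutions as cochain complexes\<close>

text \<open>The sections over \<open>U\<close> of the terms of a resolution.\<close>

definition sec_complex :: "('x, 'b, 'u) resolution \<Rightarrow> 'x set \<Rightarrow> 'u cochain" where
  "sec_complex R U = \<lparr> grp = (\<lambda>n. sec (robj R n) U), diff = (\<lambda>n. rdiff R n U) \<rparr>"

text \<open>The global sections with support in \<open>Z\<close>.\<close>

definition supp_complex :: "'x topology \<Rightarrow> 'x set \<Rightarrow> ('x, 'b, 'u) resolution \<Rightarrow> 'u cochain" where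
  "supp_complex X Z R = \<lparr> grp = (\<lambda>n. supp_sec X Z (robj R n)), diff = (\<lambda>n. rdiff R n (topspace X)) \<rparr>"

text \<open>The morphism \<open>\<int> \<rightarrow> \<Gamma>(U, I)\<close> for a resolution \<open>I\<close> of the constant sheaf.\<close>

definition aug_map :: "('x, 'x \<Rightarrow> int, 'u) resolution \<Rightarrow> 'x set \<Rightarrow> int \<Rightarrow> int \<Rightarrow> 'u" where
  "aug_map R U n k = (if n = 0 then raug R U (\<lambda>x. if x \<in> U then k else 0) else \<one>\<^bsub>sec (robj R n) U\<^esub>)"

text \<open>The cone of this morphism.\<close>

definition red_complex :: "('x, 'x \<Rightarrow> int, 'u) resolution \<Rightarrow> 'x set \<Rightarrow> (int \<times> 'u) cochain" where
  "red_complex R U = cone int_cochain (sec_complex R U) (aug_map R U)"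

lemma RGamma_eq: "RGamma X F = sec_complex (inj_res X F) (topspace X)"
  by (simp add: RGamma_def sec_complex_def)

lemma RGamma_supp_eq: "RGamma_supp X Z F = supp_complex X Z (inj_res X F)"
  by (simp add: RGamma_supp_def supp_complex_def)

lemma RGamma_red_eq:
  fixes X :: "'x topology"
  shows "(RGamma_red X :: (int \<times> 'u) cochain) = red_complex (inj_res X (const_int_sheaf X)) (topspace X)"
proof -
  have "int_to_RGamma X = (aug_map (inj_res X (const_int_sheaf X)) (topspace X) :: int \<Rightarrow> int \<Rightarrow> 'u)"
    by (auto simp: int_to_RGamma_def aug_map_def RGamma_def fun_eq_iff)
  then show ?thesis by (simp add: RGamma_red_def red_complex_def RGamma_eq)
qed

section \<open>Augmented cochains and reduced cohomology\<close>

text \<open>The integer cochains of degree \<open>n\<close> of the order complex of \<open>U\<close>, with the empty chain in degree \<open>-1\<close>, and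
  the exactness of this augmented complex in degree \<open>n\<close>.\<close>

definition aug_cochain :: "'x topology \<Rightarrow> 'x set \<Rightarrow> int \<Rightarrow> ('x list \<Rightarrow> int) \<Rightarrow> bool" where
  "aug_cochain X U n f \<longleftrightarrow> (\<forall>c. f c \<noteq> 0 \<longrightarrow> schain X c \<and> set c \<subseteq> U \<and> int (length c) = n + 1)"

definition aug_exact :: "'x topology \<Rightarrow> 'x set \<Rightarrow> int \<Rightarrow> bool" where
  "aug_exact X U n \<longleftrightarrow> (\<forall>f. aug_cochain X U n f \<and> (\<forall>c. schain X c \<and> set c \<subseteq> U \<longrightarrow> delta c f = 0) \<longrightarrow>
     (\<exists>g. aug_cochain X U (n - 1) g \<and> (\<forall>c. schain X c \<and> set c \<subseteq> U \<longrightarrow> delta c g = f c)))"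

lemma delta_degree:
  assumes "aug_cochain X U n f" "int (length c) \<noteq> n + 2"
  shows "delta c f = 0"
proof (rule delta_zero)
  fix ys y zs assume "c = ys @ y # zs"
  then have "int (length (ys @ zs)) \<noteq> n + 1" using assms(2) by auto
  then show "f (ys @ zs) = 0" using assms(1) unfolding aug_cochain_def by blast
qed

lemma aug_cochain_iff:
  assumes "openin X U" "n \<ge> 0"
  shows "aug_cochain X U n f \<longleftrightarrow> f \<in> carrier (sec (cochains X (topspace X) n) U)"
proof -
  have "schain X c \<and> set c \<subseteq> U \<and> int (length c) = n + 1 \<longleftrightarrow> c \<in> smp X (topspace X) n \<and> hd c \<in> U" for c
  proof
    assume c: "schain X c \<and> set c \<subseteq> U \<and> int (length c) = n + 1"
    then have "c \<noteq> []" using assms(2) by auto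
    then show "c \<in> smp X (topspace X) n \<and> hd c \<in> U"
      using c last_in_set[of c] hd_in_set[of c] by (auto simp: smp_def schain_def)
  next
    assume c: "c \<in> smp X (topspace X) n \<and> hd c \<in> U"
    then show "schain X c \<and> set c \<subseteq> U \<and> int (length c) = n + 1"
      using schain_subset[OF _ assms(1), of c] by (simp add: smp_def)
  qed
  then show ?thesis by (simp add: aug_cochain_def carrier_sky)
qed

lemma cdiff_eq_delta:
  assumes U: "openin X U" and n: "n \<ge> 0" and f: "aug_cochain X U n f" and c: "schain X c" "set c \<subseteq> U"
  shows "cdiff X (topspace X) n U f c = delta c f"
proof (cases "int (length c) = n + 2")
  case True
  then have "c \<noteq> []" using n by auto
  then have "c \<in> smp X (topspace X) (n + 1)" "hd c \<in> U"
    using c True last_in_set[of c] hd_in_set[of c] by (auto simp: smp_def schain_def)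
  then show ?thesis by (simp add: cdiff_def)
next
  case False
  then show ?thesis using delta_degree[OF f] by (auto simp: cdiff_def)
qed

lemma cdiff_eq_iff:
  assumes U: "openin X U" and n: "n \<ge> 0" and f: "aug_cochain X U n f" and g: "aug_cochain X U (n + 1) g"
  shows "cdiff X (topspace X) n U f = g \<longleftrightarrow> (\<forall>c. schain X c \<and> set c \<subseteq> U \<longrightarrow> delta c f = g c)"
proof -
  have "cdiff X (topspace X) n U f c = g c" if "\<not> (schain X c \<and> set c \<subseteq> U)" for c
  proof -
    have "g c = 0" using g that by (auto simp: aug_cochain_def)
    moreover have "aug_cochain X U (n + 1) (cdiff X (topspace X) n U f)"
      using f n cdiff_closed[OF U, of f "topspace X" n] aug_cochain_iff[OF U] by simp
    ultimately show ?thesis using that by (auto simp: aug_cochain_def)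
  qed
  then show ?thesis using cdiff_eq_delta[OF U n f] by (metis ext)
qed

lemma aug_cochain_0: "aug_cochain X U n (\<lambda>c. 0)"
  by (simp add: aug_cochain_def)

lemma aug_exact_pos:
  assumes U: "openin X U" and n: "n > 0"
  shows "aug_exact X U n \<longleftrightarrow> (\<forall>f\<in>carrier (sec (cochains X (topspace X) n) U). cdiff X (topspace X) n U f = (\<lambda>c. 0) \<longrightarrow>
     (\<exists>g\<in>carrier (sec (cochains X (topspace X) (n - 1)) U). cdiff X (topspace X) (n - 1) U g = (f :: _ \<Rightarrow> int)))"
proof -
  have n': "n \<ge> 0" "n - 1 \<ge> 0" using n by auto
  have 1: "cdiff X (topspace X) n U f = (\<lambda>c. 0) \<longleftrightarrow> (\<forall>c. schain X c \<and> set c \<subseteq> U \<longrightarrow> delta c f = 0)"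
    if "aug_cochain X U n f" for f :: "_ \<Rightarrow> int"
    by (rule cdiff_eq_iff[OF U n'(1) that aug_cochain_0])
  have 2: "cdiff X (topspace X) (n - 1) U g = f \<longleftrightarrow> (\<forall>c. schain X c \<and> set c \<subseteq> U \<longrightarrow> delta c g = f c)"
    if "aug_cochain X U n f" "aug_cochain X U (n - 1) g" for f g :: "_ \<Rightarrow> int"
    using cdiff_eq_iff[OF U n'(2) that(2), of f] that(1) by simp
  show ?thesis
  proof
    assume e: "aug_exact X U n"
    show "\<forall>f\<in>carrier (sec (cochains X (topspace X) n) U). cdiff X (topspace X) n U f = (\<lambda>c. 0) \<longrightarrow>
     (\<exists>g\<in>carrier (sec (cochains X (topspace X) (n - 1)) U). cdiff X (topspace X) (n - 1) U g = (f :: _ \<Rightarrow> int))"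
    proof (intro ballI impI)
      fix f :: "_ \<Rightarrow> int"
      assume "f \<in> carrier (sec (cochains X (topspace X) n) U)" and d: "cdiff X (topspace X) n U f = (\<lambda>c. 0)"
      then have f: "aug_cochain X U n f" by (simp add: aug_cochain_iff[OF U n'(1)])
      then obtain g where g: "aug_cochain X U (n - 1) g" "\<forall>c. schain X c \<and> set c \<subseteq> U \<longrightarrow> delta c g = f c"
        using e d 1[OF f] unfolding aug_exact_def by meson
      then show "\<exists>g\<in>carrier (sec (cochains X (topspace X) (n - 1)) U). cdiff X (topspace X) (n - 1) U g = f"
        using 2[OF f g(1)] aug_cochain_iff[OF U n'(2), of g] by (intro bexI[of _ g]) simp_all
    qed
  next
    assume e: "\<forall>f\<in>carrier (sec (cochains X (topspace X) n) U). cdiff X (topspace X) n U f = (\<lambda>c. 0) \<longrightarrow>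
     (\<exists>g\<in>carrier (sec (cochains X (topspace X) (n - 1)) U). cdiff X (topspace X) (n - 1) U g = (f :: _ \<Rightarrow> int))"
    show "aug_exact X U n"
      unfolding aug_exact_def
    proof (intro allI impI)
      fix f assume f: "aug_cochain X U n f \<and> (\<forall>c. schain X c \<and> set c \<subseteq> U \<longrightarrow> delta c f = 0)"
      then obtain g where g: "g\<in>carrier (sec (cochains X (topspace X) (n - 1)) U)" "cdiff X (topspace X) (n - 1) U g = f"
        using e 1[of f] aug_cochain_iff[OF U n'(1), of f] by blast
      then have "aug_cochain X U (n - 1) g" by (simp add: aug_cochain_iff[OF U n'(2)])
      then show "\<exists>g. aug_cochain X U (n - 1) g \<and> (\<forall>c. schain X c \<and> set c \<subseteq> U \<longrightarrow> delta c g = f c)"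
        using 2[of f g] f g(2) by (intro exI[of _ g]) simp
    qed
  qed
qed

lemma aug_cochain_minus_1:
  "aug_cochain X U (- 1) f \<Longrightarrow> f = (\<lambda>c. if c = [] then f [] else 0)"
  by (auto simp: aug_cochain_def fun_eq_iff)

lemma delta_empty: "delta c (\<lambda>c. if c = [] then k else 0) = aug (\<lambda>x. k) c"
proof (cases c)
  case (Cons y c')
  have "delta c' (\<lambda>c. if y # c = [] then k else 0) = 0" by (simp add: delta_0)
  then show ?thesis using Cons by (simp add: aug_def delta_0)
qed (simp add: aug_def)

text \<open>Exactness in degree \<open>-1\<close> means that \<open>U\<close> is nonempty. It is stated by means of the constant functions on \<open>U\<close>,
  as it will be compared with the injectivity of \<open>\<int> \<rightarrow> \<Gamma>(U, \<int>)\<close>.\<close>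

lemma aug_exact_minus_1:
  assumes U: "openin X U"
  shows "aug_exact X U (- 1) \<longleftrightarrow> (\<forall>k::int. (\<forall>x\<in>U. k = 0) \<longrightarrow> k = 0)"
proof
  assume e: "aug_exact X U (- 1)"
  show "\<forall>k::int. (\<forall>x\<in>U. k = 0) \<longrightarrow> k = 0"
  proof (intro allI impI)
    fix k :: int assume k: "\<forall>x\<in>U. k = 0"
    let ?f = "\<lambda>c :: 'a list. if c = [] then k else 0"
    have "aug_cochain X U (- 1) ?f" by (auto simp: aug_cochain_def schain_def)
    moreover have "delta c ?f = 0" if "set c \<subseteq> U" for c
      using k that by (cases c) (auto simp: delta_empty aug_def)
    ultimately obtain g where g: "aug_cochain X U (- 2) g" "\<And>c. schain X c \<Longrightarrow> set c \<subseteq> U \<Longrightarrow> delta c g = ?f c"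
      using e unfolding aug_exact_def by force
    show "k = 0" using g(2)[of "[]"] by (simp add: schain_def)
  qed
next
  assume k: "\<forall>k::int. (\<forall>x\<in>U. k = 0) \<longrightarrow> k = 0"
  show "aug_exact X U (- 1)"
    unfolding aug_exact_def
  proof (intro allI impI)
    fix f assume f: "aug_cochain X U (- 1) f \<and> (\<forall>c. schain X c \<and> set c \<subseteq> U \<longrightarrow> delta c f = 0)"
    have "f [] = 0" if x: "x \<in> U" for x
    proof -
      have "schain X [x]" "set [x] \<subseteq> U" using x openin_subset[OF U] by (auto simp: schain_def)
      then have "delta [x] f = 0" using f by blast
      then show ?thesis by simp
    qed
    then have "f [] = 0" using k by blast
    then have "f = (\<lambda>c. 0)" using aug_cochain_minus_1 f by metis
    then show "\<exists>g. aug_cochain X U (- 1 - 1) g \<and> (\<forall>c. schain X c \<and> set c \<subseteq> U \<longrightarrow> delta c g = f c)"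
      by (intro exI[of _ "\<lambda>c. 0"]) (simp add: aug_cochain_0 delta_0)
  qed
qed

lemma aug_exact_0:
  assumes U: "openin X U"
  shows "aug_exact X U 0 \<longleftrightarrow>
     (\<forall>u::_ \<Rightarrow> int. loc_const X (topspace X) U u \<longrightarrow> (\<exists>k. u = (\<lambda>x. if x \<in> U then k else 0)))"
proof
  assume e: "aug_exact X U 0"
  show "\<forall>u::_ \<Rightarrow> int. loc_const X (topspace X) U u \<longrightarrow> (\<exists>k. u = (\<lambda>x. if x \<in> U then k else 0))"
  proof (intro allI impI)
    fix u :: "_ \<Rightarrow> int" assume u: "loc_const X (topspace X) U u"
    have a: "aug_cochain X U 0 (aug u)" using aug_closed[OF U u] aug_cochain_iff[OF U, of 0] by simp
    have "\<forall>c. schain X c \<and> set c \<subseteq> U \<longrightarrow> delta c (aug u) = 0"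
      using cdiff_aug[OF U u] cdiff_eq_iff[OF U order_refl a aug_cochain_0] by simp
    then obtain g where g: "aug_cochain X U (- 1) g" "\<And>c. schain X c \<Longrightarrow> set c \<subseteq> U \<Longrightarrow> delta c g = aug u c"
      using e a unfolding aug_exact_def by force
    have "u x = g []" if "x \<in> U" for x
      using g(2)[of "[x]"] that openin_subset[OF U] by (auto simp: schain_def aug_def)
    moreover have "u x = 0" if "x \<notin> U" for x using u that by (simp add: loc_const_def)
    ultimately show "\<exists>k. u = (\<lambda>x. if x \<in> U then k else 0)" by (intro exI[of _ "g []"]) auto
  qed
next
  assume l: "\<forall>u::_ \<Rightarrow> int. loc_const X (topspace X) U u \<longrightarrow> (\<exists>k. u = (\<lambda>x. if x \<in> U then k else 0))"
  show "aug_exact X U 0"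
    unfolding aug_exact_def
  proof (intro allI impI)
    fix f assume f: "aug_cochain X U 0 f \<and> (\<forall>c. schain X c \<and> set c \<subseteq> U \<longrightarrow> delta c f = 0)"
    then have "f \<in> carrier (sec (cochains X (topspace X) 0) U)" "cdiff X (topspace X) 0 U f = (\<lambda>c. 0)"
      using cdiff_eq_iff[OF U order_refl _ aug_cochain_0, of f] aug_cochain_iff[OF U, of 0] by auto
    then obtain u where u: "loc_const X (topspace X) U u" "aug u = f" using cdiff_0_aug[OF U] by blast
    then obtain k where k: "u = (\<lambda>x. if x \<in> U then k else 0)" using l by blast
    let ?g = "\<lambda>c :: 'a list. if c = [] then k else 0"
    have "aug_cochain X U (- 1) ?g" by (auto simp: aug_cochain_def schain_def)
    moreover have "delta c ?g = f c" if "set c \<subseteq> U" for c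
    proof -
      have "aug (\<lambda>x. k) c = aug u c" using that k by (cases c) (auto simp: aug_def)
      then show ?thesis using u(2) by (simp add: delta_empty)
    qed
    ultimately show "\<exists>g. aug_cochain X U (0 - 1) g \<and> (\<forall>c. schain X c \<and> set c \<subseteq> U \<longrightarrow> delta c g = f c)"
      by (intro exI[of _ ?g]) simp
  qed
qed

lemma aug_exact_neg:
  assumes "n < - 1"
  shows "aug_exact X U n"
  unfolding aug_exact_def
proof (intro allI impI)
  fix f assume "aug_cochain X U n f \<and> (\<forall>c. schain X c \<and> set c \<subseteq> U \<longrightarrow> delta c f = 0)"
  then have "f c = 0" for c using assms by (auto simp: aug_cochain_def)
  then show "\<exists>g. aug_cochain X U (n - 1) g \<and> (\<forall>c. schain X c \<and> set c \<subseteq> U \<longrightarrow> delta c g = f c)"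
    by (intro exI[of _ "\<lambda>c. 0"]) (simp add: aug_cochain_0 delta_0)
qed

context int_resolution
begin

lemma valid_sec_complex: "openin X U \<Longrightarrow> valid_cochain (sec_complex R U)"
  unfolding valid_cochain_def sec_complex_def
  using sh_comm_group[OF sheaf_I] sheaf_hom_hom[OF hom_dI] dI_dI by simp

lemma acyclic_sec_complex_iff:
  assumes U: "openin X U"
  shows "acyclic_cochain (sec_complex R U) \<longleftrightarrow>
    (\<forall>n. \<forall>g\<in>carrier (sec (G n) U). dG n U g = (\<lambda>c. 0) \<longrightarrow> (\<exists>g'\<in>carrier (sec (G (n - 1)) U). dG (n - 1) U g' = g))"
  unfolding acyclic_cochain_iff[OF valid_sec_complex[OF U]]
  using sections_exact_iff[OF U] by (simp add: sec_complex_def)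

context
  fixes x0 assumes x0: "closed_point X x0"
begin

lemma open_compl: "openin X (topspace X - {x0})"
  using x0 by (auto simp: closed_point_def)

lemma carrier_supp_sec:
  "s \<in> carrier (supp_sec X {x0} (I n)) \<longleftrightarrow> s \<in> carrier (sec (I n) (topspace X)) \<and>
     res (I n) (topspace X) (topspace X - {x0}) s = \<one>\<^bsub>sec (I n) (topspace X - {x0})\<^esub>"
  and one_supp_sec: "\<one>\<^bsub>supp_sec X {x0} (I n)\<^esub> = \<one>\<^bsub>sec (I n) (topspace X)\<^esub>"
  and mult_supp_sec: "monoid.mult (supp_sec X {x0} (I n)) = monoid.mult (sec (I n) (topspace X))"
  by (auto simp: supp_sec_def kernel_def)

lemma diff_supp_sec:
  assumes "s \<in> carrier (supp_sec X {x0} (I n))"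
  shows "dI n (topspace X) s \<in> carrier (supp_sec X {x0} (I (n + 1)))"
  using assms sheaf_hom_closed[OF hom_dI openin_topspace]
    sheaf_hom_res[OF hom_dI openin_topspace open_compl Diff_subset, of s n]
    sheaf_hom_one[OF hom_dI sheaf_I sheaf_I open_compl, of n]
  by (simp add: carrier_supp_sec)

lemma valid_supp_complex: "valid_cochain (supp_complex X {x0} R)"
  unfolding valid_cochain_def
proof (intro allI conjI ballI)
  fix n
  have "group_hom (sec (I n) (topspace X)) (sec (I n) (topspace X - {x0})) (res (I n) (topspace X) (topspace X - {x0}))"
    unfolding group_hom_def group_hom_axioms_def
    using sh_group[OF sheaf_I openin_topspace] sh_group[OF sheaf_I open_compl]
      res_hom[OF psh_I openin_topspace open_compl Diff_subset] by simp
  then have "subgroup (kernel (sec (I n) (topspace X)) (sec (I n) (topspace X - {x0})) (res (I n) (topspace X) (topspace X - {x0})))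
     (sec (I n) (topspace X))" by (rule group_hom.subgroup_kernel)
  then show "comm_group (grp (supp_complex X {x0} R) n)"
    unfolding supp_complex_def supp_sec_def
    by (simp add: comm_group_subgroup[OF sh_comm_group[OF sheaf_I openin_topspace]])
  show "diff (supp_complex X {x0} R) n \<in> hom (grp (supp_complex X {x0} R) n) (grp (supp_complex X {x0} R) (n + 1))"
    unfolding supp_complex_def
    by (auto intro!: homI simp: diff_supp_sec mult_supp_sec carrier_supp_sec[of _ n] sheaf_hom_mult[OF hom_dI openin_topspace])
  fix s assume "s \<in> carrier (grp (supp_complex X {x0} R) n)"
  then show "diff (supp_complex X {x0} R) (n + 1) (diff (supp_complex X {x0} R) n s) = \<one>\<^bsub>grp (supp_complex X {x0} R) (n + 2)\<^esub>"
    using dI_dI[OF openin_topspace] by (simp add: supp_complex_def carrier_supp_sec one_supp_sec)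
qed

text \<open>\<open>\<Gamma>\<^sub>x\<^sub>0(X, I)\<close> is the kernel of the surjection \<open>\<Gamma>(X, I) \<rightarrow> \<Gamma>(X - x\<^sub>0, I)\<close>.\<close>

lemma quasi_iso_supp_iff:
  "quasi_iso (supp_complex X {x0} R) (sec_complex R (topspace X)) (\<lambda>n s. s) \<longleftrightarrow>
   acyclic_cochain (sec_complex R (topspace X - {x0}))"
proof (rule quasi_iso_iff_quotient_acyclic[where g = "\<lambda>n. res (I n) (topspace X) (topspace X - {x0})",
      OF valid_supp_complex valid_sec_complex[OF openin_topspace] valid_sec_complex[OF open_compl]])
  note oo = openin_topspace open_compl Diff_subset
  show "chain_map (supp_complex X {x0} R) (sec_complex R (topspace X)) (\<lambda>n s. s)"
    unfolding chain_map_def by (auto intro!: homI simp: supp_complex_def sec_complex_def carrier_supp_sec mult_supp_sec)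
  show "chain_map (sec_complex R (topspace X)) (sec_complex R (topspace X - {x0})) (\<lambda>n. res (I n) (topspace X) (topspace X - {x0}))"
    unfolding chain_map_def using res_hom[OF psh_I oo] sheaf_hom_res[OF hom_dI oo] by (simp add: sec_complex_def)
  fix n z assume "z \<in> carrier (grp (sec_complex R (topspace X - {x0})) n)"
  then show "\<exists>y\<in>carrier (grp (sec_complex R (topspace X)) n). res (I n) (topspace X) (topspace X - {x0}) y = z"
    using flabby_I[of n] oo unfolding flabby_def sec_complex_def by simp
qed (auto simp: supp_complex_def sec_complex_def carrier_supp_sec one_supp_sec)

end

end

text \<open>The case of the constant sheaf.\<close>

locale const_resolution = int_resolution X "topspace X" R
  for X :: "'x topology" and R :: "('x, 'x \<Rightarrow> int, 'u::infinite) resolution"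
begin

lemma loc_const_const: "openin X U \<Longrightarrow> loc_const X (topspace X) U (\<lambda>x. if x \<in> U then k else 0)"
  using openin_subset by (fastforce simp: loc_const_def)

lemma aug_map_closed: "openin X U \<Longrightarrow> aug_map R U n k \<in> carrier (sec (I n) U)"
  using aug_I_closed[OF _ loc_const_const] one_I by (simp add: aug_map_def)

lemma raug_0: "openin X U \<Longrightarrow> raug R U (\<lambda>x. 0) = \<one>\<^bsub>sec (I 0) U\<^esub>"
proof -
  assume U: "openin X U"
  have l: "(\<lambda>x. 0) \<in> carrier (sec (int_sheaf_on X (topspace X)) U)" by (simp add: carrier_Z[OF U] loc_const_def)
  have "raug R U (\<lambda>x. 0) = raug R U (\<lambda>x. 0) \<otimes>\<^bsub>sec (I 0) U\<^esub> raug R U (\<lambda>x. 0)"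
    using sheaf_hom_mult[OF hom_aug U l l] by simp
  then show ?thesis
    using sheaf_hom_closed[OF hom_aug U l] group.l_cancel_one[OF sh_group[OF sheaf_I U]] by metis
qed

lemma aug_map_0: "openin X U \<Longrightarrow> aug_map R U n 0 = \<one>\<^bsub>sec (I n) U\<^esub>"
  using raug_0 by (simp add: aug_map_def)

lemma raug_eq_one_iff:
  assumes U: "openin X U"
  shows "raug R U (\<lambda>x. if x \<in> U then k else 0) = \<one>\<^bsub>sec (I 0) U\<^esub> \<longleftrightarrow> (\<forall>x\<in>U. k = 0)"
proof -
  have "raug R U (\<lambda>x. if x \<in> U then k else 0) = raug R U (\<lambda>x. 0) \<longleftrightarrow> (\<lambda>x. if x \<in> U then k else 0) = (\<lambda>x. 0)"
    using loc_const_const[OF U, of k] loc_const_const[OF U, of 0]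
    by (intro inj_on_eq_iff[OF inj_aug[OF U]]) (simp_all add: carrier_Z[OF U])
  then show ?thesis by (auto simp: raug_0[OF U] fun_eq_iff)
qed

lemma chain_map_aug_map:
  assumes U: "openin X U"
  shows "chain_map int_cochain (sec_complex R U) (aug_map R U)"
  unfolding chain_map_def
proof (intro allI conjI ballI)
  fix n
  interpret J: comm_group "sec (I n) U" by (rule sh_comm_group[OF sheaf_I U])
  show "aug_map R U n \<in> hom (grp int_cochain n) (grp (sec_complex R U) n)"
  proof (rule homI)
    fix k l assume kl: "k \<in> carrier (grp int_cochain n)" "l \<in> carrier (grp int_cochain n)"
    show "aug_map R U n (k \<otimes>\<^bsub>grp int_cochain n\<^esub> l) = aug_map R U n k \<otimes>\<^bsub>grp (sec_complex R U) n\<^esub> aug_map R U n l"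
    proof (cases "n = 0")
      case True
      have "raug R U (\<lambda>x. (if x \<in> U then k else 0) + (if x \<in> U then l else 0)) =
         raug R U (\<lambda>x. if x \<in> U then k else 0) \<otimes>\<^bsub>sec (I 0) U\<^esub> raug R U (\<lambda>x. if x \<in> U then l else 0)"
        using sheaf_hom_mult[OF hom_aug U, of "\<lambda>x. if x \<in> U then k else 0" "\<lambda>x. if x \<in> U then l else 0"]
          loc_const_const[OF U, of k] loc_const_const[OF U, of l] by (simp add: carrier_Z[OF U])
      moreover have "(\<lambda>x. (if x \<in> U then k else 0) + (if x \<in> U then l else 0)) = (\<lambda>x. if x \<in> U then k + l else 0)" by auto
      ultimately show ?thesis using True by (simp add: aug_map_def sec_complex_def)
    next
      case False
      then show ?thesis by (simp add: aug_map_def sec_complex_def)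
    qed
  qed (simp add: sec_complex_def aug_map_closed[OF U])
  fix k assume "k \<in> carrier (grp int_cochain n)"
  have "dI n U (aug_map R U n k) = \<one>\<^bsub>sec (I (n + 1)) U\<^esub>"
    using dI_aug[OF U loc_const_const[OF U]] sheaf_hom_one[OF hom_dI sheaf_I sheaf_I U, of n]
    by (simp add: aug_map_def)
  then show "aug_map R U (n + 1) (diff int_cochain n k) = diff (sec_complex R U) n (aug_map R U n k)"
    by (simp add: aug_map_0[OF U] sec_complex_def)
qed

lemma valid_red_complex: "openin X U \<Longrightarrow> valid_cochain (red_complex R U)"
  unfolding red_complex_def by (rule valid_cone_int[OF valid_sec_complex chain_map_aug_map])

lemma carrier_red_complex:
  "ks \<in> carrier (grp (red_complex R U) n) \<longleftrightarrow> (n = - 1 \<or> fst ks = 0) \<and> snd ks \<in> carrier (sec (I n) U)"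
  and one_red_complex: "\<one>\<^bsub>grp (red_complex R U) n\<^esub> = (0, \<one>\<^bsub>sec (I n) U\<^esub>)"
  and diff_red_complex: "diff (red_complex R U) n ks =
      (0, aug_map R U (n + 1) (fst ks) \<otimes>\<^bsub>sec (I (n + 1)) U\<^esub> dI n U (snd ks))"
  by (auto simp: red_complex_def grp_cone diff_cone sec_complex_def mem_Times_iff)

text \<open>The reduced cohomology of \<open>U\<close> is computed by the augmented cochain complex. In positive degrees both
  conditions speak of the unaugmented complexes; in degrees \<open>-1\<close> and \<open>0\<close> they say that \<open>\<int> \<rightarrow> \<Gamma>(U, \<int>)\<close> is
  injective and surjective.\<close>

lemma acyclic_red_complex_iff:
  assumes U: "openin X U"
  shows "acyclic_cochain (red_complex R U) \<longleftrightarrow> (\<forall>n. aug_exact X U n)"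
  unfolding acyclic_cochain_iff[OF valid_red_complex[OF U]]
proof (rule all_cong1)
  fix n
  interpret J: comm_group "sec (I n) U" by (rule sh_comm_group[OF sheaf_I U])
  interpret J1: comm_group "sec (I (n + 1)) U" by (rule sh_comm_group[OF sheaf_I U])
  have dI1: "dI m U \<one>\<^bsub>sec (I m) U\<^esub> = \<one>\<^bsub>sec (I (m + 1)) U\<^esub>" for m
    by (rule sheaf_hom_one[OF hom_dI sheaf_I sheaf_I U])
  have dIc: "dI m U s \<in> carrier (sec (I (m + 1)) U)" if "s \<in> carrier (sec (I m) U)" for m s
    by (rule sheaf_hom_closed[OF hom_dI U that])
  let ?E = "\<forall>z\<in>carrier (grp (red_complex R U) n). diff (red_complex R U) n z = \<one>\<^bsub>grp (red_complex R U) (n + 1)\<^esub> \<longrightarrow>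
      (\<exists>y\<in>carrier (grp (red_complex R U) (n - 1)). diff (red_complex R U) (n - 1) y = z)"
  have E: "?E \<longleftrightarrow> (\<forall>k s. (n = - 1 \<or> k = 0) \<longrightarrow> s \<in> carrier (sec (I n) U) \<longrightarrow>
       aug_map R U (n + 1) k \<otimes>\<^bsub>sec (I (n + 1)) U\<^esub> dI n U s = \<one>\<^bsub>sec (I (n + 1)) U\<^esub> \<longrightarrow>
       (\<exists>l t. (n = 0 \<or> l = 0) \<and> t \<in> carrier (sec (I (n - 1)) U) \<and> k = 0 \<and>
          aug_map R U n l \<otimes>\<^bsub>sec (I n) U\<^esub> dI (n - 1) U t = s))"
  proof (intro iffI allI impI ballI)
    fix k s
    assume e: ?E and ks: "n = - 1 \<or> k = 0" "s \<in> carrier (sec (I n) U)"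
      "aug_map R U (n + 1) k \<otimes>\<^bsub>sec (I (n + 1)) U\<^esub> dI n U s = \<one>\<^bsub>sec (I (n + 1)) U\<^esub>"
    then have "(k, s) \<in> carrier (grp (red_complex R U) n)"
      "diff (red_complex R U) n (k, s) = \<one>\<^bsub>grp (red_complex R U) (n + 1)\<^esub>"
      by (simp_all add: carrier_red_complex diff_red_complex one_red_complex)
    then obtain y where "y \<in> carrier (grp (red_complex R U) (n - 1))" "diff (red_complex R U) (n - 1) y = (k, s)"
      using e by blast
    then show "\<exists>l t. (n = 0 \<or> l = 0) \<and> t \<in> carrier (sec (I (n - 1)) U) \<and> k = 0 \<and>
          aug_map R U n l \<otimes>\<^bsub>sec (I n) U\<^esub> dI (n - 1) U t = s"
      by (intro exI[of _ "fst y"] exI[of _ "snd y"]) (auto simp: carrier_red_complex diff_red_complex)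
  next
    fix z
    assume r: "\<forall>k s. (n = - 1 \<or> k = 0) \<longrightarrow> s \<in> carrier (sec (I n) U) \<longrightarrow>
       aug_map R U (n + 1) k \<otimes>\<^bsub>sec (I (n + 1)) U\<^esub> dI n U s = \<one>\<^bsub>sec (I (n + 1)) U\<^esub> \<longrightarrow>
       (\<exists>l t. (n = 0 \<or> l = 0) \<and> t \<in> carrier (sec (I (n - 1)) U) \<and> k = 0 \<and>
          aug_map R U n l \<otimes>\<^bsub>sec (I n) U\<^esub> dI (n - 1) U t = s)"
      and z: "z \<in> carrier (grp (red_complex R U) n)"
      "diff (red_complex R U) n z = \<one>\<^bsub>grp (red_complex R U) (n + 1)\<^esub>"
    obtain l t where "n = 0 \<or> l = 0" "t \<in> carrier (sec (I (n - 1)) U)" "fst z = 0"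
          "aug_map R U n l \<otimes>\<^bsub>sec (I n) U\<^esub> dI (n - 1) U t = snd z"
      using r[rule_format, of "fst z" "snd z"] z by (auto simp: carrier_red_complex diff_red_complex one_red_complex)
    then show "\<exists>y\<in>carrier (grp (red_complex R U) (n - 1)). diff (red_complex R U) (n - 1) y = z"
      by (intro bexI[of _ "(l, t)"]) (auto simp: carrier_red_complex diff_red_complex prod_eq_iff)
  qed
  consider "n < - 1" | "n = - 1" | "n = 0" | "n > 0" by linarith
  then show "?E \<longleftrightarrow> aug_exact X U n"
  proof cases
    case 1
    have "?E"
      unfolding E
    proof (intro allI impI)
      fix k s assume "n = - 1 \<or> k = 0" and s: "s \<in> carrier (sec (I n) U)"
      then have "k = 0" "s = \<one>\<^bsub>sec (I n) U\<^esub>" using 1 neg_I_eq[OF _ U s] by auto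
      then show "\<exists>l t. (n = 0 \<or> l = 0) \<and> t \<in> carrier (sec (I (n - 1)) U) \<and> k = 0 \<and>
          aug_map R U n l \<otimes>\<^bsub>sec (I n) U\<^esub> dI (n - 1) U t = s"
        using one_I[OF U, of "n - 1"] dI1[of "n - 1"] aug_map_0[OF U, of n]
        by (intro exI[of _ 0] exI[of _ "\<one>\<^bsub>sec (I (n - 1)) U\<^esub>"]) simp
    qed
    then show ?thesis using aug_exact_neg[OF 1] by blast
  next
    case 2
    have "?E \<longleftrightarrow> (\<forall>k. raug R U (\<lambda>x. if x \<in> U then k else 0) = \<one>\<^bsub>sec (I 0) U\<^esub> \<longrightarrow> k = 0)"
    proof
      assume e: ?E
      show "\<forall>k. raug R U (\<lambda>x. if x \<in> U then k else 0) = \<one>\<^bsub>sec (I 0) U\<^esub> \<longrightarrow> k = 0"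
      proof (intro allI impI)
        fix k assume "raug R U (\<lambda>x. if x \<in> U then k else 0) = \<one>\<^bsub>sec (I 0) U\<^esub>"
        then have "aug_map R U (n + 1) k \<otimes>\<^bsub>sec (I (n + 1)) U\<^esub> dI n U \<one>\<^bsub>sec (I n) U\<^esub> = \<one>\<^bsub>sec (I (n + 1)) U\<^esub>"
          using 2 dI1[of n] J1.r_one[OF J1.one_closed] by (simp add: aug_map_def)
        then show "k = 0" using e[unfolded E, rule_format, of k "\<one>\<^bsub>sec (I n) U\<^esub>"] 2 one_I[OF U, of n] by auto
      qed
    next
      assume k: "\<forall>k. raug R U (\<lambda>x. if x \<in> U then k else 0) = \<one>\<^bsub>sec (I 0) U\<^esub> \<longrightarrow> k = 0"
      show ?E
        unfolding E
      proof (intro allI impI)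
        fix k s assume s: "s \<in> carrier (sec (I n) U)"
          and eq: "aug_map R U (n + 1) k \<otimes>\<^bsub>sec (I (n + 1)) U\<^esub> dI n U s = \<one>\<^bsub>sec (I (n + 1)) U\<^esub>"
        have s1: "s = \<one>\<^bsub>sec (I n) U\<^esub>" using 2 neg_I_eq[OF _ U s] by simp
        then have "aug_map R U (n + 1) k = \<one>\<^bsub>sec (I (n + 1)) U\<^esub>"
          using eq dI1[of n] J1.r_one[OF aug_map_closed[OF U]] by simp
        then have "k = 0" using k 2 by (simp add: aug_map_def)
        then show "\<exists>l t. (n = 0 \<or> l = 0) \<and> t \<in> carrier (sec (I (n - 1)) U) \<and> k = 0 \<and>
            aug_map R U n l \<otimes>\<^bsub>sec (I n) U\<^esub> dI (n - 1) U t = s"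
          using one_I[OF U, of "n - 1"] dI1[of "n - 1"] aug_map_0[OF U, of n] s1
          by (intro exI[of _ 0] exI[of _ "\<one>\<^bsub>sec (I (n - 1)) U\<^esub>"]) simp
      qed
    qed
    then show ?thesis using 2 aug_exact_minus_1[OF U] raug_eq_one_iff[OF U] by simp
  next
    case 3
    have E0: "?E \<longleftrightarrow> (\<forall>s\<in>carrier (sec (I 0) U). dI 0 U s = \<one>\<^bsub>sec (I 1) U\<^esub> \<longrightarrow>
        (\<exists>k. s = raug R U (\<lambda>x. if x \<in> U then k else 0)))"
    proof
      assume e: ?E
      show "\<forall>s\<in>carrier (sec (I 0) U). dI 0 U s = \<one>\<^bsub>sec (I 1) U\<^esub> \<longrightarrow>
        (\<exists>k. s = raug R U (\<lambda>x. if x \<in> U then k else 0))"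
      proof (intro ballI impI)
        fix s assume s: "s \<in> carrier (sec (I 0) U)" "dI 0 U s = \<one>\<^bsub>sec (I 1) U\<^esub>"
        have "aug_map R U (n + 1) 0 \<otimes>\<^bsub>sec (I (n + 1)) U\<^esub> dI n U s = \<one>\<^bsub>sec (I (n + 1)) U\<^esub>"
          using s 3 aug_map_0[OF U, of "n + 1"] J1.r_one[OF J1.one_closed] by simp
        then obtain l t where lt: "t \<in> carrier (sec (I (n - 1)) U)" "aug_map R U n l \<otimes>\<^bsub>sec (I n) U\<^esub> dI (n - 1) U t = s"
          using e[unfolded E, rule_format, of 0 s] s(1) 3 by auto
        have "t = \<one>\<^bsub>sec (I (n - 1)) U\<^esub>" using 3 neg_I_eq[OF _ U lt(1)] by simp
        then have "s = aug_map R U n l" using lt(2) dI1[of "n - 1"] aug_map_closed[OF U] by simp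
        then show "\<exists>k. s = raug R U (\<lambda>x. if x \<in> U then k else 0)" using 3 by (auto simp: aug_map_def)
      qed
    next
      assume r: "\<forall>s\<in>carrier (sec (I 0) U). dI 0 U s = \<one>\<^bsub>sec (I 1) U\<^esub> \<longrightarrow>
        (\<exists>k. s = raug R U (\<lambda>x. if x \<in> U then k else 0))"
      show ?E
        unfolding E
      proof (intro allI impI)
        fix k s assume k: "n = - 1 \<or> k = 0" and s: "s \<in> carrier (sec (I n) U)"
          and eq: "aug_map R U (n + 1) k \<otimes>\<^bsub>sec (I (n + 1)) U\<^esub> dI n U s = \<one>\<^bsub>sec (I (n + 1)) U\<^esub>"
        have "dI n U s = \<one>\<^bsub>sec (I (n + 1)) U\<^esub>"
          using eq k 3 aug_map_0[OF U, of "n + 1"] J1.l_one[OF dIc[OF s]] by simp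
        then obtain l where "s = aug_map R U n l" using r s 3 by (auto simp: aug_map_def)
        then show "\<exists>l t. (n = 0 \<or> l = 0) \<and> t \<in> carrier (sec (I (n - 1)) U) \<and> k = 0 \<and>
            aug_map R U n l \<otimes>\<^bsub>sec (I n) U\<^esub> dI (n - 1) U t = s"
          using one_I[OF U, of "n - 1"] dI1[of "n - 1"] k 3 s J.r_one[OF s]
          by (intro exI[of _ l] exI[of _ "\<one>\<^bsub>sec (I (n - 1)) U\<^esub>"]) simp
      qed
    qed
    have inj: "u = v" if "loc_const X (topspace X) U u" "loc_const X (topspace X) U v" "raug R U u = raug R U v" for u v
      using inj_onD[OF inj_aug[OF U], OF that(3)] that by (simp add: carrier_Z[OF U])
    have "(\<forall>s\<in>carrier (sec (I 0) U). dI 0 U s = \<one>\<^bsub>sec (I 1) U\<^esub> \<longrightarrow>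
        (\<exists>k. s = raug R U (\<lambda>x. if x \<in> U then k else 0))) \<longleftrightarrow> aug_exact X U 0"
      unfolding aug_exact_0[OF U]
    proof
      assume r: "\<forall>s\<in>carrier (sec (I 0) U). dI 0 U s = \<one>\<^bsub>sec (I 1) U\<^esub> \<longrightarrow>
        (\<exists>k. s = raug R U (\<lambda>x. if x \<in> U then k else 0))"
      show "\<forall>u::'x \<Rightarrow> int. loc_const X (topspace X) U u \<longrightarrow> (\<exists>k. u = (\<lambda>x. if x \<in> U then k else 0))"
      proof (intro allI impI)
        fix u :: "'x \<Rightarrow> int" assume u: "loc_const X (topspace X) U u"
        obtain k where "raug R U u = raug R U (\<lambda>x. if x \<in> U then k else 0)"
          using r aug_I_closed[OF U u] dI_aug[OF U u] by blast
        then have "u = (\<lambda>x. if x \<in> U then k else 0)" by (rule inj[OF u loc_const_const[OF U]])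
        then show "\<exists>k. u = (\<lambda>x. if x \<in> U then k else 0)" by blast
      qed
    next
      assume "\<forall>u. loc_const X (topspace X) U u \<longrightarrow> (\<exists>k::int. u = (\<lambda>x. if x \<in> U then k else 0))"
      then show "\<forall>s\<in>carrier (sec (I 0) U). dI 0 U s = \<one>\<^bsub>sec (I 1) U\<^esub> \<longrightarrow>
        (\<exists>k. s = raug R U (\<lambda>x. if x \<in> U then k else 0))"
        using global_sections_0[OF U] by blast
    qed
    then show ?thesis unfolding E0 using 3 by simp
  next
    case 4
    have "?E \<longleftrightarrow> (\<forall>s\<in>carrier (sec (I n) U). dI n U s = \<one>\<^bsub>sec (I (n + 1)) U\<^esub> \<longrightarrow>
         (\<exists>t\<in>carrier (sec (I (n - 1)) U). dI (n - 1) U t = s))"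
    proof -
      have "dI (n - 1) U t \<in> carrier (sec (I n) U)" if "t \<in> carrier (sec (I (n - 1)) U)" for t using dIc[OF that] by simp
      then have l1: "\<one>\<^bsub>sec (I n) U\<^esub> \<otimes>\<^bsub>sec (I n) U\<^esub> dI (n - 1) U t = dI (n - 1) U t"
        if "t \<in> carrier (sec (I (n - 1)) U)" for t using J.l_one that by blast
      have "(\<exists>t. t \<in> carrier (sec (I (n - 1)) U) \<and> \<one>\<^bsub>sec (I n) U\<^esub> \<otimes>\<^bsub>sec (I n) U\<^esub> dI (n - 1) U t = s) \<longleftrightarrow>
         (\<exists>t\<in>carrier (sec (I (n - 1)) U). dI (n - 1) U t = s)" for s
        unfolding Bex_def by (intro ex_cong1 conj_cong refl) (simp add: l1)
      then show ?thesis
        unfolding E using 4 aug_map_0[OF U, of n] aug_map_0[OF U, of "n + 1"] J1.l_one[OF dIc]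
        by (simp add: Ball_def cong: conj_cong)
    qed
    then show ?thesis using sections_exact_iff[OF U, of n] aug_exact_pos[OF U 4] by simp
  qed
qed

text \<open>The comparison of \<open>\<Gamma>\<^sub>x\<^sub>0\<close> with the reduced cohomology: the quotient of the cone of
  \<open>\<int> \<rightarrow> \<Gamma>(X, I)\<close> by \<open>\<Gamma>\<^sub>x\<^sub>0(X, I)\<close> is the cone of \<open>\<int> \<rightarrow> \<Gamma>(X - x\<^sub>0, I)\<close>.\<close>

lemma quasi_iso_supp_red_iff:
  assumes x0: "closed_point X x0"
  shows "quasi_iso (supp_complex X {x0} R) (red_complex R (topspace X)) (\<lambda>n s. to_cone int_cochain n s) \<longleftrightarrow>
   acyclic_cochain (red_complex R (topspace X - {x0}))"
proof -
  define W where "W = topspace X - {x0}"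
  have oo: "openin X (topspace X)" "openin X W" "W \<subseteq> topspace X" using open_compl[OF x0] by (auto simp: W_def)
  let ?g = "\<lambda>n (ks :: int \<times> 'u). (fst ks, res (I n) (topspace X) W (snd ks))"
  have res_aug: "res (I n) (topspace X) W (aug_map R (topspace X) n k) = aug_map R W n k" for n k
  proof (cases "n = 0")
    case True
    have "(\<lambda>x. if x \<in> W then if x \<in> topspace X then k else 0 else 0) = (\<lambda>x. if x \<in> W then k else 0)"
      using oo(3) by (auto simp: fun_eq_iff)
    then show ?thesis
      using sheaf_hom_res[OF hom_aug oo, of "\<lambda>x. if x \<in> topspace X then k else 0"] True loc_const_const[OF oo(1), of k]
      by (simp add: aug_map_def carrier_Z)
  next
    case False
    then show ?thesis using res_one[OF psh_I oo] by (simp add: aug_map_def)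
  qed
  have dIc: "dI n (topspace X) s \<in> carrier (sec (I (n + 1)) (topspace X))" if "s \<in> carrier (sec (I n) (topspace X))" for n s
    by (rule sheaf_hom_closed[OF hom_dI oo(1) that])
  have mult: "ks \<otimes>\<^bsub>grp (red_complex R U) n\<^esub> lt = (fst ks \<otimes>\<^bsub>grp int_cochain (n + 1)\<^esub> fst lt, snd ks \<otimes>\<^bsub>sec (I n) U\<^esub> snd lt)" for ks lt n U
    by (simp add: red_complex_def grp_cone DirProd_mult sec_complex_def)
  have grp_supp: "grp (supp_complex X {x0} R) n = supp_sec X {x0} (I n)"
    "diff (supp_complex X {x0} R) n = dI n (topspace X)" for n by (simp_all add: supp_complex_def)
  have to_cone: "to_cone int_cochain n s = (0, s)" for n and s :: 'u by (simp add: to_cone_def)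
  have supp: "s \<in> carrier (sec (I n) (topspace X))" "res (I n) (topspace X) W s = \<one>\<^bsub>sec (I n) W\<^esub>"
    if "s \<in> carrier (supp_sec X {x0} (I n))" for s n using that carrier_supp_sec[OF x0] by (auto simp: W_def)
  show ?thesis
    unfolding W_def[symmetric]
  proof (rule quasi_iso_iff_quotient_acyclic[where g = ?g,
        OF valid_supp_complex[OF x0] valid_red_complex[OF oo(1)] valid_red_complex[OF oo(2)]])
    show "chain_map (supp_complex X {x0} R) (red_complex R (topspace X)) (\<lambda>n s. to_cone int_cochain n s)"
      unfolding chain_map_def grp_supp to_cone
    proof (intro allI conjI ballI)
      fix n
      show "Pair 0 \<in> hom (supp_sec X {x0} (I n)) (grp (red_complex R (topspace X)) n)"
        by (rule homI) (auto simp: carrier_red_complex supp mult mult_supp_sec[OF x0])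
      fix s assume "s \<in> carrier (supp_sec X {x0} (I n))"
      then show "(0, dI n (topspace X) s) = diff (red_complex R (topspace X)) n (0, s)"
        using monoid.l_one[OF group.is_monoid[OF sh_group[OF sheaf_I oo(1)]] dIc[OF supp(1)]]
        by (simp add: diff_red_complex aug_map_0[OF oo(1)])
    qed
    show "chain_map (red_complex R (topspace X)) (red_complex R W) ?g"
      unfolding chain_map_def
    proof (intro allI conjI ballI)
      fix n
      show "?g n \<in> hom (grp (red_complex R (topspace X)) n) (grp (red_complex R W) n)"
        by (rule homI) (auto simp: carrier_red_complex mult res_closed[OF psh_I oo] res_mult[OF psh_I oo])
      fix ks assume "ks \<in> carrier (grp (red_complex R (topspace X)) n)"
      then have s: "snd ks \<in> carrier (sec (I n) (topspace X))" by (simp add: carrier_red_complex)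
      show "?g (n + 1) (diff (red_complex R (topspace X)) n ks) = diff (red_complex R W) n (?g n ks)"
        using sheaf_hom_res[OF hom_dI oo s]
        by (simp add: diff_red_complex res_mult[OF psh_I oo aug_map_closed[OF oo(1)] dIc[OF s]] res_aug)
    qed
    fix n
    show "x = \<one>\<^bsub>grp (supp_complex X {x0} R) n\<^esub>" if "to_cone int_cochain n x = \<one>\<^bsub>grp (red_complex R (topspace X)) n\<^esub>" for x
      using that by (simp add: to_cone one_red_complex grp_supp one_supp_sec[OF x0])
    show "?g n (to_cone int_cochain n x) = \<one>\<^bsub>grp (red_complex R W) n\<^esub>" if "x \<in> carrier (grp (supp_complex X {x0} R) n)" for x
      using supp(2)[OF that[unfolded grp_supp]] by (simp add: to_cone one_red_complex)
    show "\<exists>x\<in>carrier (grp (supp_complex X {x0} R) n). to_cone int_cochain n x = y"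
      if "y \<in> carrier (grp (red_complex R (topspace X)) n)" "?g n y = \<one>\<^bsub>grp (red_complex R W) n\<^esub>" for y
      using that carrier_supp_sec[OF x0, of "snd y" n]
      by (intro bexI[of _ "snd y"]) (auto simp: to_cone one_red_complex grp_supp carrier_red_complex W_def prod_eq_iff)
    show "\<exists>y\<in>carrier (grp (red_complex R (topspace X)) n). ?g n y = z"
      if z: "z \<in> carrier (grp (red_complex R W) n)" for z
    proof -
      obtain t where "t \<in> carrier (sec (I n) (topspace X))" "res (I n) (topspace X) W t = snd z"
        using flabby_I[of n] oo z unfolding flabby_def carrier_red_complex by blast
      then show ?thesis using z by (intro bexI[of _ "(fst z, t)"]) (auto simp: carrier_red_complex)
    qed
  qed
qed

end

section \<open>Proof of the equivalences\<close>

text \<open>Chains in \<open>U\<close> that end in \<open>p\<close> are the chains in \<open>U \<inter> {x. x < p}\<close> with \<open>p\<close> appended. Hence the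
  cochains of \<open>\<int>\<^sub>p\<close>, the constant sheaf supported in \<open>p\<close>, are the augmented cochains of
  \<open>U \<inter> {x. x < p}\<close>, shifted by one degree.\<close>

lemma cochains_point_exact_iff:
  fixes X :: "'x topology"
  assumes fs: "finite_space X" and U: "openin X U" and p: "p \<in> U"
    and W: "W = {x \<in> U. spec_less X x p}"
  shows "(\<forall>f\<in>carrier (sec (cochains X {p} n) U). cdiff X {p} n U f = (\<lambda>c. 0) \<longrightarrow>
     (\<exists>g\<in>carrier (sec (cochains X {p} (n - 1)) U). cdiff X {p} (n - 1) U g = (f :: _ \<Rightarrow> int))) \<longleftrightarrow> aug_exact X W (n - 1)"
proof -
  have pX: "p \<in> topspace X" using p openin_subset[OF U] by blast
  have chain: "c @ [p] \<in> smp X {p} m \<and> hd (c @ [p]) \<in> U \<longleftrightarrow> schain X c \<and> set c \<subseteq> W \<and> int (length c) = m" for c m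
  proof
    assume c: "c @ [p] \<in> smp X {p} m \<and> hd (c @ [p]) \<in> U"
    then have s: "schain X (c @ [p])" by (simp add: smp_def)
    have "set (c @ [p]) \<subseteq> U" using schain_subset[OF s U] c by simp
    then show "schain X c \<and> set c \<subseteq> W \<and> int (length c) = m"
      using c s by (auto simp: smp_def schain_def sorted_wrt_append W)
  next
    assume c: "schain X c \<and> set c \<subseteq> W \<and> int (length c) = m"
    then have "hd (c @ [p]) \<in> U" using p by (cases c) (auto simp: W)
    then show "c @ [p] \<in> smp X {p} m \<and> hd (c @ [p]) \<in> U"
      using c pX by (auto simp: smp_def schain_def sorted_wrt_append W)
  qed
  have split: "\<exists>c'. c = c' @ [p]" if "c \<in> smp X {p} m" for c m
    using that append_butlast_last_id[of c] by (auto simp: smp_def intro: exI[of _ "butlast c"])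
  \<comment> \<open>the two mutually inverse translations between cochains of \<open>\<int>\<^sub>p\<close> and augmented cochains of \<open>W\<close>\<close>
  define T where "T f = (\<lambda>c. f (c @ [p]))" for f :: "'x list \<Rightarrow> int"
  define T' where "T' a = (\<lambda>c. if c \<noteq> [] \<and> last c = p then a (butlast c) else 0)" for a :: "'x list \<Rightarrow> int"
  have T: "aug_cochain X W (m - 1) (T f)" if "f \<in> carrier (sec (cochains X {p} m) U)" for f m
    using that chain[of _ m] by (auto simp: aug_cochain_def T_def carrier_sky)
  have T': "T' a \<in> carrier (sec (cochains X {p} m) U)" if a: "aug_cochain X W (m - 1) a" for a m
    unfolding carrier_sky
  proof (intro allI impI)
    fix c assume "T' a c \<noteq> 0"
    then have "c \<noteq> []" "last c = p" and nz: "a (butlast c) \<noteq> 0" by (auto simp: T'_def split: if_splits)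
    then have c: "c = butlast c @ [p]" using append_butlast_last_id by metis
    have "schain X (butlast c) \<and> set (butlast c) \<subseteq> W \<and> int (length (butlast c)) = m"
      using a nz by (auto simp: aug_cochain_def)
    then show "c \<in> smp X {p} m \<and> hd c \<in> U" using chain[of "butlast c" m] c by simp
  qed
  have TT': "T (T' a) = a" for a by (simp add: T_def T'_def)
  have delta_T: "delta (c @ [p]) f = delta c (T f)" if f: "f \<in> carrier (sec (cochains X {p} m) U)" and c: "set c \<subseteq> W" for f c m
  proof -
    have "c \<notin> smp X {p} m"
    proof
      assume "c \<in> smp X {p} m"
      then have "p \<in> set c" using last_in_set[of c] by (auto simp: smp_def)
      then show False using c by (auto simp: W spec_less_def)
    qed
    then have "f c = 0" using cochains_eq_0[OF f] by blast
    then show ?thesis unfolding T_def by (rule delta_append_last)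
  qed
  have d: "cdiff X {p} m U f (c @ [p]) = delta c (T f)"
    if f: "f \<in> carrier (sec (cochains X {p} m) U)" and c: "schain X c" "set c \<subseteq> W" for f c m
  proof (cases "int (length c) = m + 1")
    case True
    then have "c @ [p] \<in> smp X {p} (m + 1) \<and> hd (c @ [p]) \<in> U" using chain[of c "m + 1"] c by simp
    then show ?thesis using delta_T[OF f c(2)] by (simp add: cdiff_def)
  next
    case False
    then have "c @ [p] \<notin> smp X {p} (m + 1)" by (auto simp: smp_def)
    moreover have "delta c (T f) = 0" using delta_degree[OF T[OF f]] False by simp
    ultimately show ?thesis by (simp add: cdiff_def)
  qed
  have d_eq: "cdiff X {p} m U f = g \<longleftrightarrow> (\<forall>c. schain X c \<and> set c \<subseteq> W \<longrightarrow> delta c (T f) = T g c)"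
    if f: "f \<in> carrier (sec (cochains X {p} m) U)" and g: "g \<in> carrier (sec (cochains X {p} (m + 1)) U)" for f g m
  proof
    assume "cdiff X {p} m U f = g"
    then show "\<forall>c. schain X c \<and> set c \<subseteq> W \<longrightarrow> delta c (T f) = T g c" using d[OF f] by (auto simp: T_def)
  next
    assume r: "\<forall>c. schain X c \<and> set c \<subseteq> W \<longrightarrow> delta c (T f) = T g c"
    show "cdiff X {p} m U f = g"
    proof
      fix c
      show "cdiff X {p} m U f c = g c"
      proof (cases "c \<in> smp X {p} (m + 1) \<and> hd c \<in> U")
        case True
        then obtain c' where c': "c = c' @ [p]" using split by blast
        then have "schain X c'" "set c' \<subseteq> W" using chain[of c' "m + 1"] True by auto
        then show ?thesis using d[OF f] r by (simp add: c' T_def)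
      next
        case False
        then show ?thesis using cochains_eq_0[OF g] by (auto simp: cdiff_def)
      qed
    qed
  qed
  have zero: "cdiff X {p} m U f = (\<lambda>c. 0) \<longleftrightarrow> (\<forall>c. schain X c \<and> set c \<subseteq> W \<longrightarrow> delta c (T f) = 0)"
    if f: "f \<in> carrier (sec (cochains X {p} m) U)" for f m
    using d_eq[OF f cochains_add(4)] by (simp add: T_def)
  show ?thesis
  proof
    assume e: "\<forall>f\<in>carrier (sec (cochains X {p} n) U). cdiff X {p} n U f = (\<lambda>c. 0) \<longrightarrow>
     (\<exists>g\<in>carrier (sec (cochains X {p} (n - 1)) U). cdiff X {p} (n - 1) U g = (f :: _ \<Rightarrow> int))"
    show "aug_exact X W (n - 1)"
      unfolding aug_exact_def
    proof (intro allI impI)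
      fix a assume a: "aug_cochain X W (n - 1) a \<and> (\<forall>c. schain X c \<and> set c \<subseteq> W \<longrightarrow> delta c a = 0)"
      have f: "T' a \<in> carrier (sec (cochains X {p} n) U)" by (rule T'[OF conjunct1[OF a]])
      have "cdiff X {p} n U (T' a) = (\<lambda>c. 0)" unfolding zero[OF f] TT' using a by blast
      then obtain g where g: "g\<in>carrier (sec (cochains X {p} (n - 1)) U)" "cdiff X {p} (n - 1) U g = T' a" using e f by blast
      have "\<forall>c. schain X c \<and> set c \<subseteq> W \<longrightarrow> delta c (T g) = a c"
        using d_eq[OF g(1), of "T' a"] f g(2) by (simp add: TT')
      then show "\<exists>g. aug_cochain X W (n - 1 - 1) g \<and> (\<forall>c. schain X c \<and> set c \<subseteq> W \<longrightarrow> delta c g = a c)"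
        using T[OF g(1)] by (intro exI[of _ "T g"]) simp
    qed
  next
    assume e: "aug_exact X W (n - 1)"
    show "\<forall>f\<in>carrier (sec (cochains X {p} n) U). cdiff X {p} n U f = (\<lambda>c. 0) \<longrightarrow>
     (\<exists>g\<in>carrier (sec (cochains X {p} (n - 1)) U). cdiff X {p} (n - 1) U g = (f :: _ \<Rightarrow> int))"
    proof (intro ballI impI)
      fix f :: "'x list \<Rightarrow> int"
      assume f: "f\<in>carrier (sec (cochains X {p} n) U)" and "cdiff X {p} n U f = (\<lambda>c. 0)"
      then have "\<forall>c. schain X c \<and> set c \<subseteq> W \<longrightarrow> delta c (T f) = 0" using zero[OF f] by blast
      then obtain b where b: "aug_cochain X W (n - 1 - 1) b" "\<forall>c. schain X c \<and> set c \<subseteq> W \<longrightarrow> delta c b = T f c"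
        using e T[OF f] unfolding aug_exact_def by blast
      have g: "T' b \<in> carrier (sec (cochains X {p} (n - 1)) U)" by (rule T'[OF b(1)])
      have "cdiff X {p} (n - 1) U (T' b) = f" using d_eq[OF g, of f] f b(2) by (simp add: TT')
      then show "\<exists>g\<in>carrier (sec (cochains X {p} (n - 1)) U). cdiff X {p} (n - 1) U g = f" using g by blast
    qed
  qed
qed

lemma spec_le_subtopology:
  assumes "W \<subseteq> topspace X"
  shows "spec_le (subtopology X W) p q \<longleftrightarrow> p \<in> W \<and> q \<in> W \<and> spec_le X p q"
proof -
  have "topspace (subtopology X W) = W" using assms by auto
  then show ?thesis using assms unfolding spec_le_iff by (auto simp: openin_subtopology)
qed

lemma schain_subtopology:
  assumes "W \<subseteq> topspace X"
  shows "schain (subtopology X W) c \<longleftrightarrow> schain X c \<and> set c \<subseteq> W"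
proof -
  have t: "topspace (subtopology X W) = W" using assms by auto
  have "sorted_wrt (spec_less (subtopology X W)) c \<longleftrightarrow> sorted_wrt (spec_less X) c" if "set c \<subseteq> W"
  proof
    assume "sorted_wrt (spec_less (subtopology X W)) c"
    then show "sorted_wrt (spec_less X) c"
      by (rule sorted_wrt_mono_rel[rotated]) (simp add: spec_less_def spec_le_subtopology[OF assms])
  next
    assume "sorted_wrt (spec_less X) c"
    then show "sorted_wrt (spec_less (subtopology X W)) c"
      by (rule sorted_wrt_mono_rel[rotated]) (use that in \<open>auto simp: spec_less_def spec_le_subtopology[OF assms]\<close>)
  qed
  then show ?thesis using assms unfolding schain_def t by blast
qed

lemma aug_exact_subtopology:
  assumes "W \<subseteq> V" "V \<subseteq> topspace X"
  shows "aug_exact (subtopology X V) W n \<longleftrightarrow> aug_exact X W n"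
proof -
  have "schain (subtopology X V) c \<and> set c \<subseteq> W \<longleftrightarrow> schain X c \<and> set c \<subseteq> W" for c
    using schain_subtopology[OF assms(2), of c] assms(1) by blast
  moreover from this have "schain (subtopology X V) c \<and> set c \<subseteq> W \<and> P \<longleftrightarrow> schain X c \<and> set c \<subseteq> W \<and> P" for c P
    by blast
  ultimately show ?thesis unfolding aug_exact_def aug_cochain_def by simp
qed

lemma finite_space_subtopology: "finite_space X \<Longrightarrow> finite_space (subtopology X W)"
  by (auto simp: finite_space_def t0_space_subtopology)

lemma int_resolution_inj_res:
  fixes X :: "'x topology"
  assumes "finite_space X" "convex_pts X S"
  shows "int_resolution X S (inj_res X (int_sheaf_on X S) :: ('x, 'x \<Rightarrow> int, 'u::infinite) resolution)"
proof
  have "\<exists>R :: ('x, 'x \<Rightarrow> int, 'u) resolution. injective_resolution X (int_sheaf_on X S) R"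
    by (rule ex_injective_resolution[OF assms])
  then show "injective_resolution X (int_sheaf_on X S) (inj_res X (int_sheaf_on X S) :: ('x, 'x \<Rightarrow> int, 'u) resolution)"
    unfolding inj_res_def by (rule someI_ex)
qed (use assms in auto)

lemma const_resolution_inj_res:
  fixes X :: "'x topology"
  assumes "finite_space X"
  shows "const_resolution X (inj_res X (const_int_sheaf X) :: ('x, 'x \<Rightarrow> int, 'u::infinite) resolution)"
  unfolding const_resolution_def const_int_sheaf_def
  by (rule int_resolution_inj_res[OF assms]) (auto simp: convex_pts_def spec_le_def)

lemma cohomologically_trivial_iff:
  assumes fs: "finite_space X" and W: "W \<subseteq> topspace X"
  shows "cohomologically_trivial TYPE('u::infinite) (subtopology X W) \<longleftrightarrow> (\<forall>n. aug_exact X W n)"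
proof -
  have t: "topspace (subtopology X W) = W" using W by auto
  have o: "openin (subtopology X W) W" using openin_topspace[of "subtopology X W"] t by simp
  show ?thesis
    unfolding cohomologically_trivial_def RGamma_red_eq
    using const_resolution.acyclic_red_complex_iff[OF const_resolution_inj_res[OF finite_space_subtopology[OF fs]] o, where 'u = 'u]
    by (simp add: t aug_exact_subtopology[OF order_refl W] del: topspace_subtopology)
qed

lemma RGamma_supp_quasi_iso_iff:
  assumes fs: "finite_space X" and x0: "closed_point X x0" and le: "spec_le X x0 p"
  shows "quasi_iso (RGamma_supp X {x0} (int_sheaf_on X {p}) :: 'u::infinite cochain)
                  (RGamma X (int_sheaf_on X {p})) (\<lambda>n s. s) \<longleftrightarrow>
     (x0 \<noteq> p \<longrightarrow> (\<forall>n. aug_exact X (bdC X p - {x0}) n))"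
proof -
  have pX: "p \<in> topspace X" using le by (rule spec_le_topspace)
  have "convex_pts X {p}" using spec_le_antisym[OF fs] by (auto simp: convex_pts_def)
  then interpret int_resolution X "{p}" "inj_res X (int_sheaf_on X {p}) :: (_, _, 'u) resolution"
    by (rule int_resolution_inj_res[OF fs])
  let ?U = "topspace X - {x0}"
  have U: "openin X ?U" by (rule open_compl[OF x0])
  have "quasi_iso (RGamma_supp X {x0} (int_sheaf_on X {p}) :: 'u cochain) (RGamma X (int_sheaf_on X {p})) (\<lambda>n s. s) \<longleftrightarrow>
    (\<forall>n. \<forall>g\<in>carrier (sec (G n) ?U). dG n ?U g = (\<lambda>c. 0) \<longrightarrow> (\<exists>g'\<in>carrier (sec (G (n - 1)) ?U). dG (n - 1) ?U g' = g))"
    unfolding RGamma_eq RGamma_supp_eq quasi_iso_supp_iff[OF x0] acyclic_sec_complex_iff[OF U] ..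
  also have "\<dots> \<longleftrightarrow> (x0 \<noteq> p \<longrightarrow> (\<forall>n. aug_exact X (bdC X p - {x0}) n))"
  proof (cases "x0 = p")
    case True
    \<comment> \<open>no chain in the open set \<open>X - x\<^sub>0\<close> ends in \<open>x\<^sub>0\<close>\<close>
    have zero: "g = (\<lambda>c. 0)" if g: "g \<in> carrier (sec (G n) ?U)" for g n
    proof
      fix c show "g c = 0"
      proof (rule ccontr)
        assume "g c \<noteq> 0"
        then have c: "c \<in> smp X {p} n" "hd c \<in> ?U" using g by (auto simp: carrier_sky)
        then have "set c \<subseteq> ?U" using schain_subset[OF _ U] by (simp add: smp_def)
        then show False using c last_in_set[of c] True by (auto simp: smp_def)
      qed
    qed
    have "\<exists>g'\<in>carrier (sec (G (n - 1)) ?U). dG (n - 1) ?U g' = g" if "g \<in> carrier (sec (G n) ?U)" for g n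
      unfolding zero[OF that] by (rule bexI[of _ "\<lambda>c. 0"]) (simp_all add: cdiff_0 cochains_add(4))
    then show ?thesis using True by blast
  next
    case False
    have W: "bdC X p - {x0} = {x \<in> ?U. spec_less X x p}"
      by (auto simp: bdC_def Cset_def spec_less_def)
    have p: "p \<in> ?U" using pX False by blast
    have "(\<forall>n. aug_exact X (bdC X p - {x0}) (n - 1)) \<longleftrightarrow> (\<forall>n. aug_exact X (bdC X p - {x0}) n)"
      by (metis add_diff_cancel_right')
    then show ?thesis using False cochains_point_exact_iff[OF fs U p W] by simp
  qed
  finally show ?thesis .
qed

lemma RGamma_supp_red_quasi_iso_iff:
  assumes fs: "finite_space X" and x0: "closed_point X x0" and V: "V \<subseteq> topspace X" "x0 \<in> V"
  shows "(let Y = subtopology X V in quasi_iso (RGamma_supp Y {x0} (const_int_sheaf Y) :: 'u::infinite cochain)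
                  (RGamma_red Y) (\<lambda>n s. to_cone int_cochain n s)) \<longleftrightarrow> (\<forall>n. aug_exact X (V - {x0}) n)"
proof -
  let ?Y = "subtopology X V"
  have t: "topspace ?Y = V" using V by auto
  interpret const_resolution ?Y "inj_res ?Y (const_int_sheaf ?Y) :: (_, _, 'u) resolution"
    by (rule const_resolution_inj_res[OF finite_space_subtopology[OF fs]])
  have y0: "closed_point ?Y x0"
    using x0 V unfolding closed_point_def t by (auto simp: closedin_subtopology)
  have "quasi_iso (RGamma_supp ?Y {x0} (const_int_sheaf ?Y) :: 'u cochain) (RGamma_red ?Y) (\<lambda>n s. to_cone int_cochain n s)
      \<longleftrightarrow> (\<forall>n. aug_exact ?Y (topspace ?Y - {x0}) n)"
    unfolding RGamma_red_eq RGamma_supp_eq quasi_iso_supp_red_iff[OF y0]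
    by (rule acyclic_red_complex_iff[OF open_compl[OF y0]])
  moreover have "aug_exact ?Y (V - {x0}) n \<longleftrightarrow> aug_exact X (V - {x0}) n" for n
    by (rule aug_exact_subtopology[OF _ V(1)]) blast
  ultimately show ?thesis unfolding Let_def t by simp
qed

theorem theorem3p3:
  fixes X :: "'x topology"
  assumes "finite_space X"
  shows
    "(proper_space TYPE('u::infinite) X \<longleftrightarrow>
        (\<forall>x0 p. closed_point X x0 \<and> spec_less X x0 p \<longrightarrow>
           cohomologically_trivial TYPE('u) (subtopology X (bdC X p - {x0})))) \<and>
     ((\<forall>x0 p. closed_point X x0 \<and> spec_less X x0 p \<longrightarrow>
           cohomologically_trivial TYPE('u) (subtopology X (bdC X p - {x0}))) \<longleftrightarrow>
        (\<forall>x0 p. closed_point X x0 \<and> spec_less X x0 p \<longrightarrow>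
           (let Y = subtopology X (bdC X p) in
            quasi_iso (RGamma_supp Y {x0} (const_int_sheaf Y) :: 'u cochain)
                      (RGamma_red Y :: (int \<times> 'u) cochain)
                      (\<lambda>n s. to_cone int_cochain n s))))"
proof -
  let ?E = "\<lambda>x0 p. \<forall>n. aug_exact X (bdC X p - {x0}) n"
  have sub: "bdC X p \<subseteq> topspace X" for p by (auto simp: bdC_def Cset_def)
  have 1: "proper_space TYPE('u) X \<longleftrightarrow> (\<forall>x0 p. closed_point X x0 \<and> spec_less X x0 p \<longrightarrow> ?E x0 p)"
  proof -
    have "(closed_point X x0 \<and> spec_le X x0 p \<longrightarrow>
        quasi_iso (RGamma_supp X {x0} (int_sheaf_on X {p}) :: 'u cochain) (RGamma X (int_sheaf_on X {p})) (\<lambda>n s. s)) \<longleftrightarrow>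
      (closed_point X x0 \<and> spec_less X x0 p \<longrightarrow> ?E x0 p)" for x0 p
    proof (cases "closed_point X x0 \<and> spec_le X x0 p")
      case True
      then show ?thesis
        using RGamma_supp_quasi_iso_iff[where 'u = 'u, OF assms, of x0 p] by (simp add: spec_less_def)
    qed (auto simp: spec_less_def)
    then show ?thesis unfolding proper_space_def by (simp only:)
  qed
  have 2: "cohomologically_trivial TYPE('u) (subtopology X (bdC X p - {x0})) \<longleftrightarrow> ?E x0 p" for x0 p
    by (rule cohomologically_trivial_iff[OF assms]) (use sub in blast)
  have 3: "(let Y = subtopology X (bdC X p) in
            quasi_iso (RGamma_supp Y {x0} (const_int_sheaf Y) :: 'u cochain)
                      (RGamma_red Y :: (int \<times> 'u) cochain)
                      (\<lambda>n s. to_cone int_cochain n s)) \<longleftrightarrow> ?E x0 p"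
    if "closed_point X x0" "spec_less X x0 p" for x0 p
    using that by (intro RGamma_supp_red_quasi_iso_iff[OF assms _ sub])
      (auto simp: bdC_def Cset_def spec_less_def dest: spec_le_topspace)
  show ?thesis using 1 2 3 by auto
qed

end
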